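(* Suppose $n=k+1$ (so $k=n-1$), $r\ge2$. Then for every $\lambda\in S^{(n-1,r)}$ the polynomial $E_\lambda$ has no pole at $(\ast)$; the images in $V/I^{(n-1,r)}$ of the specializations of $\{E_\lambda:\lambda\in S^{(n-1,r)}\}$ form a $\mathbb K$-basis of $V/I^{(n-1,r)}$; and the quotient representation $V/I^{(n-1,r)}$ of $\mathcal H_n^{(n-1,r)}$ is irreducible.
   Context: Let $\tilde{\mathbb K}=\mathbb C(t^{1/2},q)$. The double affine Hecke algebra $\mathcal H_n$ of type $GL_n$ is the $\tilde{\mathbb K}$-algebra generated by $X_i^{\pm1},Y_i^{\pm1}$ ($1\le i\le n$), $T_j$ ($1\le j\le n-1$) with relations: $X$'s commute, $Y$'s commute; $(T_i-t^{1/2})(T_i+t^{-1/2})=0$; braid relations; $T_iX_iT_i=X_{i+1}$; $T_iX_j=X_jT_i$ ($j\ne i,i+1$); $T_i^{-1}Y_iT_i^{-1}=Y_{i+1}$; $T_iY_j=Y_jT_i$ ($j\ne i,i+1$); $Y_2^{-1}X_1Y_2X_1^{-1}=T_1^2$; $Y_i\tilde X=q\tilde XY_i$; $X_i\tilde Y=q^{-1}\tilde YX_i$ ($\tilde X=\prod X_i$, $\tilde Y=\prod Y_i$). It acts on $U=\tilde{\mathbb K}[x_1^{\pm1},\dots,x_n^{\pm1}]$ by $X_i\mapsto x_i$, $T_i\mapsto t^{1/2}s_i+\frac{t^{1/2}-t^{-1/2}}{x_i/x_{i+1}-1}(s_i-1)$, $Y_i\mapsto T_i\cdots T_{n-1}\omega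 T_1^{-1}\cdots T_{i-1}^{-1}$ ($s_i$ swaps $x_i,x_{i+1}$; $(\omega f)(x)=f(qx_n,x_1,\dots,x_{n-1})$). $P=\mathbb Z^n$; $\rho(\lambda)$ is the unique permutation of $(\frac{n-1}2,\dots,-\frac{n-1}2)$ with $\rho(\lambda)_i>\rho(\lambda)_j$ iff $\lambda_i>\lambda_j$ or ($\lambda_i=\lambda_j$, $i<j$); $\lambda\succ\mu$ iff $\lambda^+>\mu^+$ or ($\lambda^+=\mu^+$ and $\lambda>\mu$) in dominance order. $E_\lambda$ is the unique element of $U$ with $E_\lambda=x^\lambda+\sum_{\mu\prec\lambda}c_{\lambda\mu}x^\mu$ and $Y_iE_\lambda=t^{\rho(\lambda)_i}q^{\lambda_i}E_\lambda$. Fix $1\le k\le n-1$, $r\ge2$, $g=\gcd(k+1,r-1)$, $\tau=e^{2\pi\sqrt{-1}/(r-1)}$, specialization $(\ast)$: $t=u^{(r-1)/g}$, $q=\tau u^{-(k+1)/g}$. $\mathbb K$, $\mathcal H_n^{(k,r)}$, $V=\mathbb K[x_1^{\pm1},\dots,x_n^{\pm1}]$ are the images under $(\ast)$ of elements of $\tilde{\mathbb K}$, $\mathcal H_n$, $U$ regular at $(\ast)$. $Z^{(k,r)}$ is the set of $z\in\mathbb K^n$ for which there exist distinct $i_1,\dots,i_{k+1}$ and $s_1,\dots,s_k\in\mathbb Z_{\ge0}$ with $z_{i_{a+1}}=z_{i_a}tq^{s_a}$ ($1\le a\le k$), $\sum_as_a\le r-2$, and $i_a<i_{a+1}$ whenever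 $s_a=0$; $I^{(k,r)}=\{f\in V:f(z)=0\ \forall z\in Z^{(k,r)}\}$ (an $\mathcal H_n^{(k,r)}$-subrepresentation of $V$). $(i,j)$ is a neighborhood of type $(a,b)$ in $\lambda$ if $\rho(\lambda)_i-\rho(\lambda)_j=a-1$ and either $\lambda_i-\lambda_j\le b-1$, or $\lambda_i-\lambda_j=b$ and $j<i$. $S^{(k,r)}$ is the set of $\lambda\in P$ having a neighborhood of type $(k+1,r-1)$. *)

theory Defs
  imports Complex_Main "HOL-Computational_Algebra.Polynomial" "HOL-Computational_Algebra.Fraction_Field"
begin

text \<open>A Laurent polynomial in x_0,...,x_(n-1) is a finitely supported coefficient
function on exponent vectors, which are integer lists of length n.
Indices are 0-based (paper index i corresponds to i-1 here).\<close>

type_synonym 'a lpoly = "int list \<Rightarrow> 'a"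

definition lp :: "nat \<Rightarrow> ('a::zero) lpoly \<Rightarrow> bool" where
  "lp n f \<longleftrightarrow> finite {a. f a \<noteq> 0} \<and> (\<forall>a. f a \<noteq> 0 \<longrightarrow> length a = n)"

definition lp_mono :: "int list \<Rightarrow> 'a::zero \<Rightarrow> 'a lpoly" where
  "lp_mono a c = (\<lambda>b. if b = a then c else 0)"

definition unitv :: "nat \<Rightarrow> nat \<Rightarrow> int list" where
  "unitv n i = (replicate n 0)[i := 1]"

definition lp_X :: "nat \<Rightarrow> nat \<Rightarrow> ('a::{zero,one}) lpoly" where
  "lp_X n i = lp_mono (unitv n i) 1"

definition lp_Xinv :: "nat \<Rightarrow> nat \<Rightarrow> ('a::{zero,one}) lpoly" where
  "lp_Xinv n i = lp_mono (map uminus (unitv n i)) 1"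

definition lp_mult :: "nat \<Rightarrow> ('a::comm_ring_1) lpoly \<Rightarrow> 'a lpoly \<Rightarrow> 'a lpoly" where
  "lp_mult n f g = (\<lambda>a. if length a = n
      then (\<Sum>b\<in>{b. f b \<noteq> 0}. f b * g (map2 (-) a b)) else 0)"

definition lp_swap :: "nat \<Rightarrow> 'a lpoly \<Rightarrow> 'a lpoly" where
  "lp_swap i f = (\<lambda>a. f (a[i := a ! Suc i, Suc i := a ! i]))"

definition lp_div_lin :: "nat \<Rightarrow> nat \<Rightarrow> ('a::field) lpoly \<Rightarrow> 'a lpoly" where
  "lp_div_lin n i h = (THE g. lp n g \<and>
      lp_mult n (\<lambda>a. lp_X n i a - lp_X n (Suc i) a) g = h)"

text \<open>Demazure--Lusztig operator T_i with parameter sv = t^(1/2):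
  T_i f = sv s_i f + (sv - sv^-1) (s_i f - f)/(x_i/x_(i+1) - 1),
  where (s_i f - f)/(x_i/x_(i+1) - 1) = x_(i+1) (s_i f - f)/(x_i - x_(i+1)).\<close>
definition Top :: "nat \<Rightarrow> 'a::field \<Rightarrow> nat \<Rightarrow> 'a lpoly \<Rightarrow> 'a lpoly" where
  "Top n sv i f = (\<lambda>a. sv * lp_swap i f a + (sv - inverse sv) *
      lp_mult n (lp_X n (Suc i)) (lp_div_lin n i (\<lambda>b. lp_swap i f b - f b)) a)"

text \<open>T_i^-1 = T_i - (t^(1/2) - t^(-1/2)) (from the quadratic relation)\<close>
definition Tinv :: "nat \<Rightarrow> 'a::field \<Rightarrow> nat \<Rightarrow> 'a lpoly \<Rightarrow> 'a lpoly" where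
  "Tinv n sv i f = (\<lambda>a. Top n sv i f a - (sv - inverse sv) * f a)"

text \<open>(omega f)(x) = f(q x_n, x_1, ..., x_(n-1)):  x^a maps to q^(a_1) x^(rotate1 a)\<close>
definition omega :: "'a::field \<Rightarrow> 'a lpoly \<Rightarrow> 'a lpoly" where
  "omega qv f = (\<lambda>b. if b = [] then f b else f (last b # butlast b) * qv powi (last b))"

text \<open>inverse of omega: (omega^-1 f)(x) = f(x_2, ..., x_n, q^-1 x_1)\<close>
definition omega_inv :: "'a::field \<Rightarrow> 'a lpoly \<Rightarrow> 'a lpoly" where
  "omega_inv qv f = (\<lambda>b. if b = [] then f b else f (rotate1 b) * qv powi (- hd b))"

definition Yop :: "nat \<Rightarrow> 'a::field \<Rightarrow> 'a \<Rightarrow> nat \<Rightarrow> 'a lpoly \<Rightarrow> 'a lpoly" where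
  "Yop n sv qv i f = foldr (Top n sv) [i..<n-1] (omega qv (foldr (Tinv n sv) [0..<i] f))"

definition Yinv :: "nat \<Rightarrow> 'a::field \<Rightarrow> 'a \<Rightarrow> nat \<Rightarrow> 'a lpoly \<Rightarrow> 'a lpoly" where
  "Yinv n sv qv i f = foldr (Top n sv) (rev [0..<i])
      (omega_inv qv (foldr (Tinv n sv) (rev [i..<n-1]) f))"

definition lp_eval :: "nat \<Rightarrow> ('a::field) lpoly \<Rightarrow> 'a list \<Rightarrow> 'a" where
  "lp_eval n f z = (\<Sum>a\<in>{a. f a \<noteq> 0}. f a * (\<Prod>i<n. (z ! i) powi (a ! i)))"

text \<open>rho2 lam i = 2 * rho(lam)_i  (an integer)\<close>
definition rho2 :: "int list \<Rightarrow> nat \<Rightarrow> int" where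
  "rho2 lam i = int (length lam) - 1 - 2 * int (card {j. j < length lam \<and>
      (lam ! j > lam ! i \<or> (lam ! j = lam ! i \<and> j < i))})"

definition dom_le :: "int list \<Rightarrow> int list \<Rightarrow> bool" where
  "dom_le mu lam \<longleftrightarrow> length mu = length lam \<and> sum_list mu = sum_list lam \<and>
     (\<forall>m \<le> length lam. sum_list (take m mu) \<le> sum_list (take m lam))"

definition dom_lt :: "int list \<Rightarrow> int list \<Rightarrow> bool" where
  "dom_lt mu lam \<longleftrightarrow> dom_le mu lam \<and> mu \<noteq> lam"

definition dplus :: "int list \<Rightarrow> int list" where
  "dplus lam = rev (sort lam)"

definition prec :: "int list \<Rightarrow> int list \<Rightarrow> bool" where
  "prec mu lam \<longleftrightarrow> dom_lt (dplus mu) (dplus lam) \<or>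
      (dplus mu = dplus lam \<and> dom_lt mu lam)"

text \<open>Nonsymmetric Macdonald polynomial E_lam (parameters sv = t^(1/2), qv = q)\<close>
definition Emac :: "nat \<Rightarrow> 'a::field \<Rightarrow> 'a \<Rightarrow> int list \<Rightarrow> 'a lpoly" where
  "Emac n sv qv lam = (THE f. lp n f \<and> f lam = 1 \<and>
      (\<forall>mu. f mu \<noteq> 0 \<longrightarrow> mu = lam \<or> prec mu lam) \<and>
      (\<forall>i<n. Yop n sv qv i f = (\<lambda>a. sv powi (rho2 lam i) * qv powi (lam ! i) * f a)))"

definition nbhd :: "int list \<Rightarrow> int \<Rightarrow> int \<Rightarrow> nat \<Rightarrow> nat \<Rightarrow> bool" where
  "nbhd lam a b i j \<longleftrightarrow> i < length lam \<and> j < length lam \<and>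
     rho2 lam i - rho2 lam j = 2 * (a - 1) \<and>
     (lam ! i - lam ! j \<le> b - 1 \<or> (lam ! i - lam ! j = b \<and> j < i))"

definition Sset :: "nat \<Rightarrow> nat \<Rightarrow> nat \<Rightarrow> int list set" where
  "Sset n k r = {lam. length lam = n \<and> (\<exists>i j. nbhd lam (int k + 1) (int r - 1) i j)}"

text \<open>K~ = C(t^(1/2), q): fractions of polynomials in q whose coefficients are
polynomials in s = t^(1/2).\<close>
type_synonym Ktil = "complex poly poly fract"
type_synonym Kbig = "complex poly fract"  \<comment> \<open>C(v), v = u^(1/2)\<close>

definition s_t :: Ktil where "s_t = Fract ([:[:0, 1:]:]) 1"
definition q_t :: Ktil where "q_t = Fract ([:0, 1:]) 1"

definition vv :: Kbig where "vv = Fract ([:0, 1:]) 1"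

definition gg :: "nat \<Rightarrow> nat \<Rightarrow> nat" where "gg k r = gcd (k + 1) (r - 1)"
definition tau :: "nat \<Rightarrow> complex" where "tau r = cis (2 * pi / real (r - 1))"

text \<open>specialized values: t^(1/2) = u^((r-1)/(2g)) = v^((r-1)/g),
  q = tau u^(-(k+1)/g) = tau v^(-2(k+1)/g)\<close>
definition sV :: "nat \<Rightarrow> nat \<Rightarrow> Kbig" where "sV k r = vv ^ ((r - 1) div gg k r)"
definition qV :: "nat \<Rightarrow> nat \<Rightarrow> Kbig" where
  "qV k r = Fract ([:tau r:]) 1 * inverse (vv ^ (2 * ((k + 1) div gg k r)))"

definition spec_poly :: "nat \<Rightarrow> nat \<Rightarrow> complex poly poly \<Rightarrow> Kbig" where
  "spec_poly k r P = poly (map_poly (\<lambda>c. poly (map_poly (\<lambda>z. Fract ([:z:]) 1) c) (sV k r)) P) (qV k r)"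

definition regular :: "nat \<Rightarrow> nat \<Rightarrow> Ktil \<Rightarrow> bool" where
  "regular k r x \<longleftrightarrow> (\<exists>a b. spec_poly k r b \<noteq> 0 \<and> x = Fract a b)"

definition spec :: "nat \<Rightarrow> nat \<Rightarrow> Ktil \<Rightarrow> Kbig" where
  "spec k r x = (SOME y. \<exists>a b. spec_poly k r b \<noteq> 0 \<and> x = Fract a b \<and>
      y = spec_poly k r a / spec_poly k r b)"

definition Kset :: "nat \<Rightarrow> nat \<Rightarrow> Kbig set" where
  "Kset k r = spec k r ` {x. regular k r x}"

definition Vset :: "nat \<Rightarrow> nat \<Rightarrow> nat \<Rightarrow> Kbig lpoly set" where
  "Vset n k r = {f. lp n f \<and> (\<forall>a. f a \<in> Kset k r)}"

definition Zset :: "nat \<Rightarrow> nat \<Rightarrow> nat \<Rightarrow> Kbig list set" where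
  "Zset n k r = {z. length z = n \<and> (\<forall>i<n. z ! i \<in> Kset k r \<and> z ! i \<noteq> 0) \<and>
     (\<exists>idx ss. length idx = k + 1 \<and> distinct idx \<and> set idx \<subseteq> {..<n} \<and>
        length ss = k \<and> sum_list ss \<le> r - 2 \<and>
        (\<forall>a<k. z ! (idx ! (a + 1)) = z ! (idx ! a) * (sV k r)\<^sup>2 * (qV k r) ^ (ss ! a) \<and>
               (ss ! a = 0 \<longrightarrow> idx ! a < idx ! (a + 1))))}"

definition Iset :: "nat \<Rightarrow> nat \<Rightarrow> nat \<Rightarrow> Kbig lpoly set" where
  "Iset n k r = {f \<in> Vset n k r. \<forall>z\<in>Zset n k r. lp_eval n f z = 0}"

definition Espec :: "nat \<Rightarrow> nat \<Rightarrow> nat \<Rightarrow> int list \<Rightarrow> Kbig lpoly" where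
  "Espec n k r lam = (\<lambda>a. spec k r (Emac n s_t q_t lam a))"

definition quot_basis :: "'f set \<Rightarrow> ('a \<Rightarrow> 'f::field) set \<Rightarrow> ('a \<Rightarrow> 'f) set
    \<Rightarrow> 'b set \<Rightarrow> ('b \<Rightarrow> 'a \<Rightarrow> 'f) \<Rightarrow> bool" where
  "quot_basis K V I B e \<longleftrightarrow>
     (\<forall>b\<in>B. e b \<in> V) \<and>
     (\<forall>F c. finite F \<longrightarrow> F \<subseteq> B \<longrightarrow> (\<forall>b\<in>F. c b \<in> K) \<longrightarrow>
        (\<lambda>a. \<Sum>b\<in>F. c b * e b a) \<in> I \<longrightarrow> (\<forall>b\<in>F. c b = 0)) \<and>
     (\<forall>f\<in>V. \<exists>F c. finite F \<and> F \<subseteq> B \<and> (\<forall>b\<in>F. c b \<in> K) \<and>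
        (\<lambda>a. f a - (\<Sum>b\<in>F. c b * e b a)) \<in> I)"

text \<open>W is (the preimage in V of) an H_n^(k,r)-subrepresentation: a K-subspace of V
closed under the specialized actions of X_i^(+-1), Y_i^(+-1), T_i.\<close>
definition H_invariant :: "nat \<Rightarrow> nat \<Rightarrow> nat \<Rightarrow> Kbig lpoly set \<Rightarrow> bool" where
  "H_invariant n k r W \<longleftrightarrow> W \<subseteq> Vset n k r \<and>
     (\<forall>f\<in>W. \<forall>g\<in>W. (\<lambda>a. f a + g a) \<in> W) \<and>
     (\<forall>c\<in>Kset k r. \<forall>f\<in>W. (\<lambda>a. c * f a) \<in> W) \<and>
     (\<forall>i<n. \<forall>f\<in>W. lp_mult n (lp_X n i) f \<in> W \<and> lp_mult n (lp_Xinv n i) f \<in> W \<and>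
        Yop n (sV k r) (qV k r) i f \<in> W \<and> Yinv n (sV k r) (qV k r) i f \<in> W) \<and>
     (\<forall>i. Suc i < n \<longrightarrow> (\<forall>f\<in>W. Top n (sV k r) i f \<in> W))"

definition quot_irreducible :: "nat \<Rightarrow> nat \<Rightarrow> nat \<Rightarrow> bool" where
  "quot_irreducible n k r \<longleftrightarrow> Iset n k r \<noteq> Vset n k r \<and>
     (\<forall>W. Iset n k r \<subseteq> W \<longrightarrow> H_invariant n k r W \<longrightarrow> W = Iset n k r \<or> W = Vset n k r)"

end

theory Submission
  imports Defs
begin

text \<open>
At the specialization with \<open>k = n - 1\<close> the joint spectrum of the \<open>Y\<^sub>i\<close> on all of \<open>V\<close> is simple, because
\<open>t^h q^m = 1\<close> with \<open>|h| < n\<close> forces \<open>h = m = 0\<close>. Applying the factors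
\<open>(Y\<^sub>i - y\<^sub>i(\<mu>)) / (y\<^sub>i(\<lambda>) - y\<^sub>i(\<mu>))\<close>, one for each \<open>\<mu> \<prec> \<lambda>\<close>, to \<open>x\<^sup>\<lambda>\<close> therefore yields every
\<open>E\<^sub>\<lambda>\<close> without a pole, and the specialized \<open>E\<^sub>\<lambda>\<close> are an eigenbasis of \<open>V\<close>.

The points of \<open>Z\<close> are, up to scalars, the inverses of the spectral vectors of the \<open>\<lambda> \<in> S\<close>, so \<open>Z\<close> is a
finite union of lines. A subrepresentation \<open>W\<close> containing \<open>I\<close> is an ideal that is stable under \<open>x \<mapsto> q x\<close>,
hence graded. The operators \<open>T\<^sub>i\<close> and \<open>\<omega>\<close> move the set of lines on which \<open>W\<close> does not vanish, and
they act transitively on the lines; if \<open>W\<close> is not contained in \<open>I\<close>, it contains a function equal to \<open>1\<close>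
on \<open>Z\<close>, so \<open>W = V\<close>.

The same combinatorial connectedness of \<open>S\<close>, now realized by intertwiners, shows \<open>E\<^sub>\<lambda> \<notin> I\<close> for
\<open>\<lambda> \<in> S\<close>. The span \<open>J\<close> of the other \<open>E\<^sub>\<lambda>\<close> is a subrepresentation, since the intertwiners leading from
outside \<open>S\<close> into \<open>S\<close> vanish. As \<open>I \<subseteq> J \<noteq> V\<close>, irreducibility gives \<open>I = J\<close>.
\<close>

section \<open>Laurent polynomials\<close>

text \<open>At the specialization t^n q^(r-1) = 1, while t^h q^m = 1 has no nontrivial solution with
  |h| < n. The absence of short relations separates the eigenvalues. The single relation at |h| = n
  has another effect: where the exchange of two neighbouring entries leads out of the index set, the
  two eigenvalues differ exactly by a factor t. At the same place the coefficient of f(s_i z) in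
  (T_i f)(z) is zero and the squared intertwiner is zero. The stability of I and that of J both rest
  on this coincidence.

  The parameters are kept abstract, because generic and specialized ones need the same theory: the
  specialized polynomials are characterized by their own eigenvalue equations, and regularity is the
  statement that a construction stays inside a subring. Identities between operators are tested at
  points with distinct nonzero coordinates, where T_i has a simple formula; triangularity and change
  of coefficients use explicit coefficients instead.\<close>

definition mval :: "nat \<Rightarrow> 'a::field list \<Rightarrow> int list \<Rightarrow> 'a" where
  "mval n z a = (\<Prod>i<n. (z ! i) powi (a ! i))"

definition lp_shift :: "nat \<Rightarrow> int list \<Rightarrow> 'a::zero lpoly \<Rightarrow> 'a lpoly" where
  "lp_shift n b g = (\<lambda>a. if length a = n then g (map2 (-) a b) else 0)"

definition lsw :: "nat \<Rightarrow> 'b list \<Rightarrow> 'b list" where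
  "lsw i a = a[i := a ! Suc i, Suc i := a ! i]"

text \<open>Exponents on the line through \<open>a\<close> in direction e_i - e_(i+1). A
  Demazure--Lusztig operator mixes coefficients only along such lines, so it can be analysed one
  line at a time.\<close>

definition lmv :: "nat \<Rightarrow> int \<Rightarrow> int list \<Rightarrow> int list" where
  "lmv i k a = a[i := a ! i + k, Suc i := a ! Suc i - k]"

lemma length_lsw [simp]: "length (lsw i a) = length a"
  by (simp add: lsw_def)

lemma length_lmv [simp]: "length (lmv i k a) = length a"
  by (simp add: lmv_def)

lemma nth_lsw: "Suc i < length a \<Longrightarrow> j < length a \<Longrightarrow>
    lsw i a ! j = (if j = i then a ! Suc i else if j = Suc i then a ! i else a ! j)"
  by (auto simp: lsw_def nth_list_update)

lemma nth_lmv: "Suc i < length a \<Longrightarrow> j < length a \<Longrightarrow>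
    lmv i k a ! j = (if j = i then a ! i + k else if j = Suc i then a ! Suc i - k else a ! j)"
  by (auto simp: lmv_def nth_list_update)

lemma lsw_lsw [simp]: "Suc i < length a \<Longrightarrow> lsw i (lsw i a) = a"
  by (rule nth_equalityI) (auto simp: nth_lsw)

lemma lsw_eq_lmv: "Suc i < length a \<Longrightarrow> lsw i a = lmv i (a ! Suc i - a ! i) a"
  by (rule nth_equalityI) (auto simp: nth_lsw nth_lmv)

lemma lsw_lmv: "Suc i < length a \<Longrightarrow> lsw i (lmv i k a) = lmv i (a ! Suc i - a ! i - k) a"
  by (rule nth_equalityI) (auto simp: nth_lsw nth_lmv)

lemma lmv_lmv: "Suc i < length a \<Longrightarrow> lmv i k (lmv i l a) = lmv i (k + l) a"
  by (rule nth_equalityI) (auto simp: nth_lmv)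

lemma lmv_0 [simp]: "lmv i 0 a = a"
  by (simp add: lmv_def)

lemma lmv_inj: "Suc i < length a \<Longrightarrow> lmv i k a = lmv i l a \<longleftrightarrow> k = l"
  by (metis Suc_lessD add_left_cancel nth_lmv)

lemma set_lsw: "Suc i < length z \<Longrightarrow> set (lsw i z) = set z"
  by (simp add: lsw_def)

lemma lp_fin: "lp n f \<Longrightarrow> finite {a. f a \<noteq> 0}"
  and lp_len: "lp n f \<Longrightarrow> f a \<noteq> 0 \<Longrightarrow> length a = n"
  and lp_zero: "lp n f \<Longrightarrow> length a \<noteq> n \<Longrightarrow> f a = 0"
  by (auto simp: lp_def)

lemma lpI: "finite A \<Longrightarrow> (\<And>a. f a \<noteq> 0 \<Longrightarrow> a \<in> A \<and> length a = n) \<Longrightarrow> lp n f"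
  unfolding lp_def by (auto intro: finite_subset[of _ A])

lemma lp_0 [simp]: "lp n (\<lambda>a. 0)"
  by (simp add: lp_def)

lemma lp_add: "lp n f \<Longrightarrow> lp n g \<Longrightarrow> lp n (\<lambda>a. f a + g a)" for f g :: "'a::comm_monoid_add lpoly"
  by (rule lpI[of "{a. f a \<noteq> 0} \<union> {a. g a \<noteq> 0}"])
    (auto simp: lp_fin, (metis add_0 lp_len)+)

lemma lp_diff: "lp n f \<Longrightarrow> lp n g \<Longrightarrow> lp n (\<lambda>a. f a - g a)" for f g :: "'a::ab_group_add lpoly"
  by (rule lpI[of "{a. f a \<noteq> 0} \<union> {a. g a \<noteq> 0}"])
    (auto simp: lp_fin, metis lp_len)

lemma lp_scale: "lp n f \<Longrightarrow> lp n (\<lambda>a. c * f a)" for f :: "'a::mult_zero lpoly"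
  by (rule lpI[of "{a. f a \<noteq> 0}"]) (auto simp: lp_fin, metis lp_len mult_zero_right)

lemma lp_sum: "(\<And>b. b \<in> B \<Longrightarrow> lp n (F b)) \<Longrightarrow> lp n (\<lambda>a. \<Sum>b\<in>B. F b a)"
  for F :: "'b \<Rightarrow> 'a::comm_monoid_add lpoly"
  by (induction B rule: infinite_finite_induct) (auto intro: lp_add)

lemma lp_eval_eq: "finite A \<Longrightarrow> {a. f a \<noteq> 0} \<subseteq> A \<Longrightarrow> lp_eval n f z = (\<Sum>a\<in>A. f a * mval n z a)"
  unfolding lp_eval_def mval_def by (rule sum.mono_neutral_left) auto

lemma eval_add: "lp n f \<Longrightarrow> lp n g \<Longrightarrow> lp_eval n (\<lambda>a. f a + g a) z = lp_eval n f z + lp_eval n g z"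
  using lp_eval_eq[of "{a. f a \<noteq> 0} \<union> {a. g a \<noteq> 0}" _ n z]
  by (subst (1 2 3) lp_eval_eq[of "{a. f a \<noteq> 0} \<union> {a. g a \<noteq> 0}"])
    (auto simp: lp_def distrib_right sum.distrib)

lemma eval_scale: "lp n f \<Longrightarrow> lp_eval n (\<lambda>a. c * f a) z = c * lp_eval n f z"
  by (subst (1 2) lp_eval_eq[of "{a. f a \<noteq> 0}"]) (auto simp: lp_def sum_distrib_left mult.assoc)

lemma eval_diff: "lp n f \<Longrightarrow> lp n g \<Longrightarrow> lp_eval n (\<lambda>a. f a - g a) z = lp_eval n f z - lp_eval n g z"
  using eval_add[of n f "\<lambda>a. (-1) * g a" z] eval_scale[of n g "-1" z] lp_scale[of n g "-1"] by simp

lemma eval_0 [simp]: "lp_eval n (\<lambda>a. 0) z = 0"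
  by (simp add: lp_eval_def)

lemma eval_sum: "(\<And>b. b \<in> B \<Longrightarrow> lp n (F b)) \<Longrightarrow>
    lp_eval n (\<lambda>a. \<Sum>b\<in>B. F b a) z = (\<Sum>b\<in>B. lp_eval n (F b) z)"
  by (induction B rule: infinite_finite_induct) (auto simp: eval_add lp_sum)

lemma mval_add: "length a = n \<Longrightarrow> length b = n \<Longrightarrow> length z = n \<Longrightarrow> 0 \<notin> set z \<Longrightarrow>
    mval n z (map2 (+) a b) = mval n z a * mval n z b"
  unfolding mval_def prod.distrib[symmetric]
  by (intro prod.cong) (auto simp: power_int_add in_set_conv_nth)

lemma mval_nonzero: "length z = n \<Longrightarrow> 0 \<notin> set z \<Longrightarrow> mval n z a \<noteq> 0"
  by (auto simp: mval_def in_set_conv_nth)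

section \<open>Multiplication by monomials and by Laurent polynomials\<close>

lemma map2_minus_plus: "length a = length b \<Longrightarrow> map2 (-) (map2 (+) a b) b = a"
  and map2_plus_minus: "length a = length b \<Longrightarrow> map2 (+) (map2 (-) a b) b = a" for a b :: "int list"
  by (auto intro!: nth_equalityI)

lemma shift_supp: "length b = n \<Longrightarrow> lp n g \<Longrightarrow>
    {a. lp_shift n b g a \<noteq> 0} = (\<lambda>a. map2 (+) a b) ` {a. g a \<noteq> 0}"
  by (auto simp: lp_shift_def lp_def image_iff map2_minus_plus split: if_splits)
    (metis map2_plus_minus)

lemma lp_shift [simp]: "length b = n \<Longrightarrow> lp n g \<Longrightarrow> lp n (lp_shift n b g)"
  unfolding lp_def[of n "lp_shift n b g"] shift_supp by (auto simp: lp_fin lp_shift_def)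

lemma eval_shift:
  assumes "length b = n" "lp n g" "length z = n" "0 \<notin> set z"
  shows "lp_eval n (lp_shift n b g) z = mval n z b * lp_eval n g z"
proof -
  have inj: "inj_on (\<lambda>a. map2 (+) a b) {a. g a \<noteq> 0}"
    by (rule inj_on_inverseI[of _ "\<lambda>a. map2 (-) a b"])
      (use assms in \<open>auto simp: map2_minus_plus lp_def\<close>)
  have "lp_eval n (lp_shift n b g) z
      = (\<Sum>a\<in>(\<lambda>a. map2 (+) a b) ` {a. g a \<noteq> 0}. lp_shift n b g a * mval n z a)"
    by (rule lp_eval_eq) (use assms in \<open>auto simp: shift_supp lp_fin\<close>)
  also have "\<dots> = (\<Sum>a\<in>{a. g a \<noteq> 0}. g a * (mval n z a * mval n z b))"
    unfolding sum.reindex[OF inj] o_def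
    by (intro sum.cong refl) (use assms in \<open>auto simp: lp_shift_def map2_minus_plus mval_add lp_def\<close>)
  also have "\<dots> = mval n z b * (\<Sum>a\<in>{a. g a \<noteq> 0}. g a * mval n z a)"
    by (simp add: sum_distrib_left mult_ac)
  finally show ?thesis using assms lp_eval_eq[of "{a. g a \<noteq> 0}" g n z] by (simp add: lp_fin)
qed

lemma shift_shift: "length b = n \<Longrightarrow> length c = n \<Longrightarrow>
    lp_shift n b (lp_shift n c g) = lp_shift n (map2 (+) b c) g"
  by (auto simp: lp_shift_def fun_eq_iff intro!: arg_cong[of _ _ g] nth_equalityI)

lemma shift_0: "lp n g \<Longrightarrow> lp_shift n (replicate n 0) g = g"
  by (auto simp: lp_shift_def fun_eq_iff lp_zero intro!: arg_cong[of _ _ g] nth_equalityI)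

lemma lp_mult_eq_sum: "lp_mult n f g = (\<lambda>a. \<Sum>b\<in>{b. f b \<noteq> 0}. f b * lp_shift n b g a)"
  by (auto simp: lp_mult_def lp_shift_def fun_eq_iff)

lemma lp_mult_mono: "lp_mult n (lp_mono b 1) g = lp_shift n b g" for g :: "'a::field lpoly"
proof -
  have "{c. lp_mono b (1::'a) c \<noteq> 0} = {b}" by (auto simp: lp_mono_def)
  then show ?thesis unfolding lp_mult_eq_sum by (simp add: lp_mono_def)
qed

lemma lp_mult_lp: "lp n f \<Longrightarrow> lp n g \<Longrightarrow> lp n (lp_mult n f g)"
  unfolding lp_mult_eq_sum by (intro lp_sum lp_scale lp_shift) (auto simp: lp_def)

lemma eval_mult: "lp n f \<Longrightarrow> lp n g \<Longrightarrow> length z = n \<Longrightarrow> 0 \<notin> set z \<Longrightarrow>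
    lp_eval n (lp_mult n f g) z = lp_eval n f z * lp_eval n g z"
  unfolding lp_mult_eq_sum
  by (subst eval_sum)
    (auto simp: lp_scale lp_len eval_scale eval_shift sum_distrib_right mult.assoc
      lp_eval_eq[of "{a. f a \<noteq> 0}" f] lp_fin intro!: sum.cong)

lemma length_unitv [simp]: "length (unitv n i) = n"
  by (simp add: unitv_def)

lemma nth_unitv: "i < n \<Longrightarrow> j < n \<Longrightarrow> unitv n i ! j = (if j = i then 1 else 0)"
  by (simp add: unitv_def nth_list_update)

lemma mult_X: "lp_mult n (lp_X n i) g = lp_shift n (unitv n i) g" for g :: "'a::field lpoly"
  by (simp add: lp_X_def lp_mult_mono)

lemma mult_Xinv: "lp_mult n (lp_Xinv n i) g = lp_shift n (map uminus (unitv n i)) g"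
  for g :: "'a::field lpoly"
  by (simp add: lp_Xinv_def lp_mult_mono)

lemma unitv_inj: "i < n \<Longrightarrow> j < n \<Longrightarrow> unitv n i = unitv n j \<longleftrightarrow> i = j"
  by (metis nth_unitv zero_neq_one)

lemma mult_lin:
  fixes g :: "'a::field lpoly"
  assumes "Suc i < n"
  shows "lp_mult n (\<lambda>a. lp_X n i a - lp_X n (Suc i) a) g
    = (\<lambda>a. lp_shift n (unitv n i) g a - lp_shift n (unitv n (Suc i)) g a)"
proof -
  have ne: "unitv n i \<noteq> unitv n (Suc i)" using assms by (simp add: unitv_inj)
  then have "{b. lp_X n i b - lp_X n (Suc i) b \<noteq> (0::'a)} = {unitv n i, unitv n (Suc i)}"
    by (auto simp: lp_X_def lp_mono_def)
  then show ?thesis using ne unfolding lp_mult_eq_sum by (auto simp: lp_X_def lp_mono_def)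
qed

lemma shift_unitv: "length a = n \<Longrightarrow> i < n \<Longrightarrow> lp_shift n (unitv n i) g a = g (a[i := a ! i - 1])"
  by (auto simp: lp_shift_def nth_unitv nth_list_update intro!: arg_cong[of _ _ g] nth_equalityI)

lemma mval_unitv: "i < n \<Longrightarrow> mval n z (unitv n i) = z ! i"
  unfolding mval_def by (subst prod.remove[of _ i]) (auto simp: nth_unitv)

section \<open>Exchange of adjacent variables\<close>

lemma swap_eq: "lp_swap i f a = f (lsw i a)"
  by (simp add: lp_swap_def lsw_def)

lemma swap_supp: "Suc i < n \<Longrightarrow> lp n f \<Longrightarrow> {a. lp_swap i f a \<noteq> 0} = lsw i ` {a. f a \<noteq> 0}"
  by (auto simp: swap_eq image_iff lp_def) (metis length_lsw lsw_lsw)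

lemma lp_swap [simp]: "Suc i < n \<Longrightarrow> lp n f \<Longrightarrow> lp n (lp_swap i f)"
  unfolding lp_def[of n "lp_swap i f"] swap_supp by (auto simp: lp_fin swap_eq dest: lp_len)

lemma mval_lsw:
  assumes "Suc i < n" "length z = n" "length a = n"
  shows "mval n z (lsw i a) = mval n (lsw i z) a"
proof -
  let ?p = "\<lambda>j. if j = i then Suc i else if j = Suc i then i else j"
  have inj: "inj_on ?p {..<n}" by (auto simp: inj_on_def)
  have "?p ` {..<n} \<subseteq> {..<n}" using assms by auto
  then have im: "?p ` {..<n} = {..<n}" using inj by (intro endo_inj_surj) auto
  have "mval n z (lsw i a) = (\<Prod>j\<in>?p ` {..<n}. (z ! j) powi (lsw i a ! j))"
    unfolding mval_def im ..
  also have "\<dots> = mval n (lsw i z) a"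
    unfolding mval_def prod.reindex[OF inj] o_def
    by (intro prod.cong refl) (use assms in \<open>auto simp: nth_lsw\<close>)
  finally show ?thesis .
qed

lemma eval_swap:
  assumes "Suc i < n" "length z = n" "lp n f"
  shows "lp_eval n (lp_swap i f) z = lp_eval n f (lsw i z)"
proof -
  have inj: "inj_on (lsw i) {a. f a \<noteq> 0}"
    by (rule inj_on_inverseI[of _ "lsw i"]) (use assms in \<open>auto simp: lp_def\<close>)
  have "lp_eval n (lp_swap i f) z = (\<Sum>a\<in>lsw i ` {a. f a \<noteq> 0}. lp_swap i f a * mval n z a)"
    by (rule lp_eval_eq) (use assms in \<open>auto simp: swap_supp lp_fin\<close>)
  also have "\<dots> = (\<Sum>a\<in>{a. f a \<noteq> 0}. f a * mval n (lsw i z) a)"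
    unfolding sum.reindex[OF inj] o_def
    by (intro sum.cong refl) (use assms in \<open>auto simp: swap_eq mval_lsw lp_def\<close>)
  finally show ?thesis using assms lp_eval_eq[of "{a. f a \<noteq> 0}" f n "lsw i z"] by (simp add: lp_fin)
qed

section \<open>Demazure--Lusztig operators\<close>

text \<open>Made for sums over half-lines of integers: restriction to the support turns them into
  finite sums for the finitely supported functions in question, without bounds to carry
  along.\<close>

definition fsum :: "(int \<Rightarrow> 'a::comm_monoid_add) \<Rightarrow> int set \<Rightarrow> 'a" where
  "fsum F B = sum F {k \<in> B. F k \<noteq> 0}"

lemma fsum_eq: "finite A \<Longrightarrow> {k. F k \<noteq> 0} \<subseteq> A \<Longrightarrow> fsum F B = sum F (A \<inter> B)"
  unfolding fsum_def by (rule sum.mono_neutral_left) auto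

lemma fsum_zero: "(\<And>k. k \<in> B \<Longrightarrow> F k = 0) \<Longrightarrow> fsum F B = 0"
  unfolding fsum_def by (rule sum.neutral) auto

lemma finite_line:
  assumes "Suc i < length a" "lp n f"
  shows "finite {k. f (lmv i k a) \<noteq> 0}"
proof (rule finite_imageD[of "\<lambda>k. lmv i k a"])
  show "finite ((\<lambda>k. lmv i k a) ` {k. f (lmv i k a) \<noteq> 0})"
    by (rule finite_subset[OF _ lp_fin[OF assms(2)]]) auto
qed (use assms in \<open>auto simp: inj_on_def lmv_inj\<close>)

lemma finite_lists_bounded:
  assumes "finite A" shows "\<exists>M\<ge>0::int. \<forall>a\<in>A. \<forall>x\<in>set a. \<bar>x\<bar> \<le> M"
proof -
  have "finite (\<Union>a\<in>A. abs ` set a)" using assms by auto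
  then obtain M where "\<forall>y\<in>(\<Union>a\<in>A. abs ` set a). y \<le> M" using bdd_above_finite bdd_above_def by metis
  then show ?thesis by (intro exI[of _ "max 0 M"]) fastforce
qed

lemma finite_lists_between: "finite {a::int list. length a = n \<and> set a \<subseteq> {l..u}}"
  using finite_lists_length_eq[of "{l..u}" n] by (simp add: conj_commute)

text \<open>The difference of two quotients is constant along every line in direction e_i - e_(i+1),
  so finite support forces it to be zero. This makes the description in \<open>lp_div_lin\<close>
  unambiguous.\<close>

lemma div_lin_unique:
  fixes g :: "'a::field lpoly"
  assumes i: "Suc i < n" and g: "lp n g" and g': "lp n g'"
    and eq: "\<And>a. length a = n \<Longrightarrow> g (a[i := a ! i - 1]) - g (a[Suc i := a ! Suc i - 1])
      = g' (a[i := a ! i - 1]) - g' (a[Suc i := a ! Suc i - 1])"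
  shows "g = g'"
proof (rule ccontr)
  define d where "d = (\<lambda>a. g a - g' a)"
  have d: "lp n d" unfolding d_def using g g' by (rule lp_diff)
  assume "g \<noteq> g'"
  then obtain a where a: "d a \<noteq> 0" by (auto simp: d_def fun_eq_iff)
  then have la: "length a = n" using d lp_len by blast
  have step: "d (lmv i 1 b) = d b" if b: "length b = n" for b
  proof -
    let ?c = "b[i := b ! i + 1]"
    have c: "?c[i := ?c ! i - 1] = b" "?c[Suc i := ?c ! Suc i - 1] = lmv i 1 b" "length ?c = n"
      using i b by (auto simp: lmv_def)
    have "g b - g (lmv i 1 b) = g' b - g' (lmv i 1 b)" using eq[OF c(3)] unfolding c .
    then show ?thesis by (simp add: d_def algebra_simps)
  qed
  have "d (lmv i (int k) a) = d a" for k
  proof (induction k)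
    case (Suc k)
    have "lmv i (int (Suc k)) a = lmv i 1 (lmv i (int k) a)" using i la by (simp add: lmv_lmv)
    then show ?case using Suc step[of "lmv i (int k) a"] la by simp
  qed simp
  then have "range int \<subseteq> {k. d (lmv i k a) \<noteq> 0}" using a by auto
  moreover have "finite {k. d (lmv i k a) \<noteq> 0}" using finite_line[of i a n d] i la d by simp
  ultimately have "finite (range int)" by (rule finite_subset)
  then show False using finite_imageD[of int UNIV] by (simp add: inj_def)
qed

text \<open>Expansion of h / (x_i - x_(i+1)) as a geometric series in x_(i+1) / x_i, read off
  coefficientwise. For general \<open>h\<close> its support is infinite.\<close>

definition div_quot :: "nat \<Rightarrow> nat \<Rightarrow> 'a::field lpoly \<Rightarrow> 'a lpoly" where
  "div_quot n i h = (\<lambda>b. if length b = n then fsum (\<lambda>k. h (lmv i k (b[i := b ! i + 1]))) {0..} else 0)"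

lemma div_quot_shift:
  assumes i: "Suc i < n" and a: "length a = n"
  shows "div_quot n i h (a[i := a ! i - 1]) = fsum (\<lambda>k. h (lmv i k a)) {0..}"
    and "div_quot n i h (a[Suc i := a ! Suc i - 1]) = fsum (\<lambda>k. h (lmv i k a)) {0<..}"
proof -
  show "div_quot n i h (a[i := a ! i - 1]) = fsum (\<lambda>k. h (lmv i k a)) {0..}"
    using assms by (simp add: div_quot_def)
  have 1: "lmv i k (a[Suc i := a ! Suc i - 1, i := a ! i + 1]) = lmv i (k + 1) a" for k
    by (rule nth_equalityI) (use i a in \<open>auto simp: nth_lmv nth_list_update\<close>)
  have im: "{k \<in> {0<..}. h (lmv i k a) \<noteq> 0} = (\<lambda>k. k + 1) ` {k \<in> {0..}. h (lmv i (k + 1) a) \<noteq> 0}"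
  proof (intro equalityI subsetI)
    fix k assume "k \<in> {k \<in> {0<..}. h (lmv i k a) \<noteq> 0}"
    then show "k \<in> (\<lambda>k. k + 1) ` {k \<in> {0..}. h (lmv i (k + 1) a) \<noteq> 0}"
      by (intro image_eqI[of _ _ "k - 1"]) auto
  qed auto
  show "div_quot n i h (a[Suc i := a ! Suc i - 1]) = fsum (\<lambda>k. h (lmv i k a)) {0<..}"
    using assms unfolding fsum_def im by (simp add: div_quot_def 1 fsum_def sum.reindex)
qed

text \<open>The exchange reflects the line, k becoming d - k with d the difference of the two
  entries, so the half-line k > 0 turns into k < d. The finite set \<open>A\<close> is chosen stable
  under this reflection.\<close>

lemma fsum_reflect:
  fixes f :: "'a::field lpoly"
  assumes i: "Suc i < n" and a: "length a = n" and f: "lp n f"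
  shows "fsum (\<lambda>k. f (lsw i (lmv i k a)) - f (lmv i k a)) {0<..}
    = fsum (\<lambda>k. f (lmv i k a)) {..<a ! Suc i - a ! i} - fsum (\<lambda>k. f (lmv i k a)) {0<..}"
proof -
  define d where "d = a ! Suc i - a ! i"
  define F where "F = (\<lambda>k. f (lmv i k a))"
  define A where "A = {k. F k \<noteq> 0} \<union> (\<lambda>k. d - k) ` {k. F k \<noteq> 0}"
  have A: "finite A" unfolding A_def F_def using finite_line[of i a n f] i a f by simp
  have A': "k \<in> A \<longleftrightarrow> F k \<noteq> 0 \<or> F (d - k) \<noteq> 0" for k
    unfolding A_def by (auto intro!: image_eqI[of _ _ "d - k"])
  have sA: "d - k \<in> A \<longleftrightarrow> k \<in> A" for k unfolding A' by auto
  have "fsum (\<lambda>k. f (lsw i (lmv i k a)) - f (lmv i k a)) {0<..} = fsum (\<lambda>k. F (d - k) - F k) {0<..}"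
    using i a by (simp add: lsw_lmv F_def d_def)
  also have "\<dots> = (\<Sum>k\<in>A \<inter> {0<..}. F (d - k) - F k)"
  proof (rule fsum_eq[OF A], safe)
    fix k assume k: "F (d - k) - F k \<noteq> 0"
    then show "k \<in> A" by (cases "F k = 0") (auto simp: A')
  qed
  also have "\<dots> = (\<Sum>k\<in>A \<inter> {0<..}. F (d - k)) - (\<Sum>k\<in>A \<inter> {0<..}. F k)"
    by (rule sum_subtractf)
  also have "(\<Sum>k\<in>A \<inter> {0<..}. F (d - k)) = (\<Sum>k\<in>A \<inter> {..<d}. F k)"
    by (rule sum.reindex_bij_witness[of _ "\<lambda>k. d - k" "\<lambda>k. d - k"]) (auto simp: sA)
  also have "(\<Sum>k\<in>A \<inter> {..<d}. F k) = fsum F {..<d}"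
    by (rule fsum_eq[symmetric, OF A]) (auto simp: A_def)
  also have "(\<Sum>k\<in>A \<inter> {0<..}. F k) = fsum F {0<..}"
    by (rule fsum_eq[symmetric, OF A]) (auto simp: A_def)
  finally show ?thesis by (simp add: F_def d_def)
qed

text \<open>\<open>s_i f - f\<close> is antisymmetric on each line and hence sums to zero there. A
  nonzero sum over k \<ge> 0 must be balanced by a term with k < 0, and support on both sides of the
  starting exponent bounds its entries.\<close>

lemma lp_div_quot:
  fixes f :: "'a::field lpoly"
  assumes i: "Suc i < n" and f: "lp n f"
  shows "lp n (div_quot n i (\<lambda>b. lp_swap i f b - f b))"
proof -
  define h where "h = (\<lambda>b. lp_swap i f b - f b)"
  have h: "lp n h" unfolding h_def using i f by (intro lp_diff lp_swap)
  obtain M where M: "M \<ge> 0" "\<And>a x. h a \<noteq> 0 \<Longrightarrow> x \<in> set a \<Longrightarrow> \<bar>x\<bar> \<le> M"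
    using finite_lists_bounded[OF lp_fin[OF h]] by auto
  \<comment> \<open>Only the finiteness of this box matters; its bounds are generous.\<close>
  let ?B = "{a. length a = n \<and> set a \<subseteq> {-3*M-1..M}}"
  have "b \<in> ?B \<and> length b = n" if b0: "div_quot n i h b \<noteq> 0" for b
  proof -
    have lb: "length b = n" using b0 by (auto simp: div_quot_def split: if_splits)
    define a where "a = b[i := b ! i + 1]"
    have la: "length a = n" by (simp add: a_def lb)
    have nz: "fsum (\<lambda>k. h (lmv i k a)) {0..} \<noteq> 0"
      using b0 lb by (simp add: div_quot_def a_def)
    obtain k where k: "k \<ge> 0" "h (lmv i k a) \<noteq> 0"
      using nz fsum_zero[of "{0..}" "\<lambda>k. h (lmv i k a)"] by force
    have "\<exists>l<0. h (lmv i l a) \<noteq> 0"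
    proof (rule ccontr)
      assume "\<not> (\<exists>l<0. h (lmv i l a) \<noteq> 0)"
      then have neg: "h (lmv i k a) = 0" if "k < 0" for k using that by blast
      define d where "d = a ! Suc i - a ! i"
      define H where "H = (\<lambda>k. h (lmv i k a))"
      have F: "H k = f (lmv i (d - k) a) - f (lmv i k a)" for k
        unfolding H_def h_def swap_eq d_def using i la by (simp add: lsw_lmv)
      define A where "A = {k. f (lmv i k a) \<noteq> 0} \<union> (\<lambda>k. d - k) ` {k. f (lmv i k a) \<noteq> 0}"
      have A: "finite A" unfolding A_def using finite_line[of i a n f] i la f by simp
      have A': "k \<in> A \<longleftrightarrow> f (lmv i k a) \<noteq> 0 \<or> f (lmv i (d - k) a) \<noteq> 0" for k
        unfolding A_def by (auto intro!: image_eqI[of _ _ "d - k"])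
      have sA: "d - k \<in> A \<longleftrightarrow> k \<in> A" for k unfolding A' by auto
      have HA: "k \<in> A" if "H k \<noteq> 0" for k using that by (auto simp: F A')
      have "fsum H {0..} = sum H (A \<inter> {0..})" by (rule fsum_eq[OF A]) (use HA in auto)
      also have "\<dots> = sum H A"
        by (rule sum.mono_neutral_left[OF A]) (auto simp: H_def intro!: neg)
      also have "\<dots> = (\<Sum>k\<in>A. f (lmv i (d - k) a)) - (\<Sum>k\<in>A. f (lmv i k a))"
        by (simp add: F sum_subtractf)
      also have "(\<Sum>k\<in>A. f (lmv i (d - k) a)) = (\<Sum>k\<in>A. f (lmv i k a))"
        by (rule sum.reindex_bij_witness[of _ "\<lambda>k. d - k" "\<lambda>k. d - k"]) (auto simp: sA)
      finally show False using nz by (simp add: H_def)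
    qed
    then obtain l where l: "l < 0" "h (lmv i l a) \<noteq> 0" by blast
    have bk: "\<bar>lmv i k a ! j\<bar> \<le> M" "\<bar>lmv i l a ! j\<bar> \<le> M" if "j < n" for j
      using M(2)[OF k(2), of "lmv i k a ! j"] M(2)[OF l(2), of "lmv i l a ! j"] that la by auto
    have "b ! j \<in> {-3*M-1..M}" if "j < n" for j
      using bk[of j] bk[of i] bk[of "Suc i"] that i la lb k l M(1)
      by (auto simp: nth_lmv a_def nth_list_update split: if_splits)
    then show ?thesis using lb by (auto simp: in_set_conv_nth)
  qed
  then show ?thesis unfolding h_def[symmetric] by (intro lpI[of ?B] finite_lists_between) auto
qed

lemma div_lin_eq:
  fixes f :: "'a::field lpoly"
  assumes i: "Suc i < n" and f: "lp n f"
  defines "h \<equiv> (\<lambda>b. lp_swap i f b - f b)"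
  shows "lp_div_lin n i h = div_quot n i h"
    and "lp_mult n (\<lambda>a. lp_X n i a - lp_X n (Suc i) a) (div_quot n i h) = h"
proof -
  have h: "lp n h" unfolding h_def using i f by (intro lp_diff lp_swap)
  have lq: "lp n (div_quot n i h)" unfolding h_def using i f by (rule lp_div_quot)
  show eq: "lp_mult n (\<lambda>a. lp_X n i a - lp_X n (Suc i) a) (div_quot n i h) = h"
  proof
    fix a
    show "lp_mult n (\<lambda>a. lp_X n i a - lp_X n (Suc i) a) (div_quot n i h) a = h a"
    proof (cases "length a = n")
      case True
      define H where "H = (\<lambda>k. h (lmv i k a))"
      have A: "finite {k. H k \<noteq> 0}" unfolding H_def using finite_line[of i a n h] i True h by simp
      have "fsum H {0..} = fsum H {0<..} + H 0"
      proof -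
        have "fsum H {0..} = sum H (insert 0 {k. H k \<noteq> 0} \<inter> {0..})"
          by (rule fsum_eq) (use A in auto)
        also have "insert 0 {k. H k \<noteq> 0} \<inter> {0..} = insert 0 ({k. H k \<noteq> 0} \<inter> {0<..})" by auto
        also have "sum H \<dots> = H 0 + sum H ({k. H k \<noteq> 0} \<inter> {0<..})"
          by (rule sum.insert) (use A in auto)
        also have "sum H ({k. H k \<noteq> 0} \<inter> {0<..}) = fsum H {0<..}"
          by (rule fsum_eq[symmetric]) (use A in auto)
        finally show ?thesis by simp
      qed
      then show ?thesis using i True
        by (simp add: mult_lin shift_unitv div_quot_shift H_def)
    next
      case False
      then show ?thesis using i h by (simp add: mult_lin lp_shift_def lp_zero)
    qed
  qed
  show "lp_div_lin n i h = div_quot n i h" unfolding lp_div_lin_def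
  proof (rule the_equality)
    fix g assume g: "lp n g \<and> lp_mult n (\<lambda>a. lp_X n i a - lp_X n (Suc i) a) g = h"
    show "g = div_quot n i h"
    proof (rule div_lin_unique[OF i _ lq])
      fix a :: "int list" assume a: "length a = n"
      have "lp_mult n (\<lambda>a. lp_X n i a - lp_X n (Suc i) a) g a
          = lp_mult n (\<lambda>a. lp_X n i a - lp_X n (Suc i) a) (div_quot n i h) a" using g eq by simp
      then show "g (a[i := a ! i - 1]) - g (a[Suc i := a ! Suc i - 1])
          = div_quot n i h (a[i := a ! i - 1]) - div_quot n i h (a[Suc i := a ! Suc i - 1])"
        using i a by (simp add: mult_lin shift_unitv)
    qed (use g in simp)
  qed (use lq eq in simp)
qed

text \<open>Explicit coefficients, free of the definite description in \<open>lp_div_lin\<close>.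
  Triangularity and compatibility with coefficient homomorphisms are both read off from
  here.\<close>

lemma Top_coeff:
  assumes i: "Suc i < n" and f: "lp n f" and a: "length a = n"
  shows "Top n s i f a = s * f (lmv i (a ! Suc i - a ! i) a) + (s - inverse s) *
    (fsum (\<lambda>k. f (lmv i k a)) {..<a ! Suc i - a ! i} - fsum (\<lambda>k. f (lmv i k a)) {0<..})"
proof -
  have "Top n s i f a = s * f (lsw i a) + (s - inverse s) *
      fsum (\<lambda>k. f (lsw i (lmv i k a)) - f (lmv i k a)) {0<..}"
    unfolding Top_def div_lin_eq(1)[OF i f] mult_X
    using i a by (simp add: shift_unitv div_quot_shift swap_eq)
  then show ?thesis unfolding fsum_reflect[OF i a f] using i a by (simp add: lsw_eq_lmv)
qed

lemma Top_lp [simp]: "Suc i < n \<Longrightarrow> lp n f \<Longrightarrow> lp n (Top n s i f)"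
  unfolding Top_def
  by (intro lp_add lp_scale lp_swap) (simp_all add: div_lin_eq mult_X lp_div_quot)

lemma Tinv_lp [simp]: "Suc i < n \<Longrightarrow> lp n f \<Longrightarrow> lp n (Tinv n s i f)"
  unfolding Tinv_def by (intro lp_diff lp_scale Top_lp)

text \<open>Off the hyperplane x_i = x_(i+1) the quotient in the definition of T_i can be evaluated
  as a quotient in the field.\<close>

lemma eval_Top:
  fixes f :: "'a::field lpoly"
  assumes i: "Suc i < n" and f: "lp n f" and z: "length z = n" "0 \<notin> set z" and ne: "z ! i \<noteq> z ! Suc i"
  shows "lp_eval n (Top n s i f) z
    = ((s * z ! i - inverse s * z ! Suc i) * lp_eval n f (lsw i z)
      - (s - inverse s) * z ! Suc i * lp_eval n f z) / (z ! i - z ! Suc i)"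
proof -
  define h where "h = (\<lambda>b. lp_swap i f b - f b)"
  define g where "g = div_quot n i h"
  have h: "lp n h" unfolding h_def using i f by (intro lp_diff lp_swap)
  have g: "lp n g" unfolding g_def h_def using i f by (rule lp_div_quot)
  have "lp_eval n (lp_mult n (\<lambda>a. lp_X n i a - lp_X n (Suc i) a) g) z
      = (z ! i - z ! Suc i) * lp_eval n g z"
    using i g z by (simp add: mult_lin eval_diff eval_shift mval_unitv algebra_simps)
  also have "lp_mult n (\<lambda>a. lp_X n i a - lp_X n (Suc i) a) g = h"
    unfolding g_def h_def using div_lin_eq(2)[OF i f] .
  also have "lp_eval n h z = lp_eval n f (lsw i z) - lp_eval n f z"
    unfolding h_def using i f z by (simp add: eval_diff eval_swap)
  finally have eg: "lp_eval n g z = (lp_eval n f (lsw i z) - lp_eval n f z) / (z ! i - z ! Suc i)"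
    using ne by (simp add: field_simps)
  have "Top n s i f = (\<lambda>a. s * lp_swap i f a + (s - inverse s) * lp_shift n (unitv n (Suc i)) g a)"
    unfolding Top_def g_def h_def using i f by (simp add: div_lin_eq mult_X)
  then have "lp_eval n (Top n s i f) z = s * lp_eval n f (lsw i z) + (s - inverse s) * (z ! Suc i * lp_eval n g z)"
    using i f z g by (simp add: eval_add lp_scale eval_scale eval_swap eval_shift mval_unitv)
  then show ?thesis unfolding eg using ne by (simp add: field_simps)
qed

section \<open>Laurent polynomials are determined by their values\<close>

fun horner_val :: "int \<Rightarrow> int list \<Rightarrow> int" where
  "horner_val N [] = 0"
| "horner_val N (x # xs) = x + N * horner_val N xs"

text \<open>Digits of absolute value at most M are determined by their residues modulo N > 2 M, so
  the value in base N gives them back one after the other.\<close>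

lemma horner_val_inj:
  assumes "length a = length b" "\<forall>x\<in>set a. \<bar>x\<bar> \<le> M" "\<forall>x\<in>set b. \<bar>x\<bar> \<le> M"
    "2 * M < N" "horner_val N a = horner_val N b"
  shows "a = b"
  using assms
proof (induction a b rule: list_induct2)
  case (Cons x xs y ys)
  have e: "x - y = N * (horner_val N ys - horner_val N xs)" using Cons.prems by (simp add: algebra_simps)
  have "\<bar>x\<bar> \<le> M" "\<bar>y\<bar> \<le> M" using Cons.prems by auto
  then have "\<bar>x - y\<bar> < N" using Cons.prems(3) by linarith
  moreover have "N dvd x - y" using e by simp
  ultimately have xy: "x - y = 0" using zdvd_imp_le[of N "\<bar>x - y\<bar>"] by (cases "x - y = 0") auto
  moreover have "N > 0" using Cons.prems(3) \<open>\<bar>x\<bar> \<le> M\<close> by linarith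
  ultimately have "horner_val N xs = horner_val N ys" using e by simp
  then show ?case using Cons.IH Cons.prems xy by simp
qed simp

lemma horner_val_sum: "horner_val N a = (\<Sum>i<length a. N ^ i * a ! i)"
  by (induction a) (auto simp: sum.lessThan_Suc_shift sum_distrib_left mult_ac simp del: sum.lessThan_Suc)

lemma power_int_sum: "x \<noteq> 0 \<Longrightarrow> x powi (\<Sum>i\<in>A. g i) = (\<Prod>i\<in>A. x powi g i)" for x :: "'a::field"
  by (induction A rule: infinite_finite_induct) (auto simp: power_int_add)

text \<open>Kronecker substitution: x_i = Q^(N^i) with N large turns \<open>f\<close> into a
  one-variable Laurent polynomial with the same coefficients. It is zero at all Q = q^m with m > 0,
  and these are infinitely many. The points used have distinct coordinates, as they must for the
  later evaluation of T_i.\<close>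

lemma lp_eq_0I:
  fixes q :: "'a::field" and f :: "'a lpoly"
  assumes q: "q \<noteq> 0" "\<And>m. m > 0 \<Longrightarrow> q ^ m \<noteq> 1" and f: "lp n f"
    and ev: "\<And>z. length z = n \<Longrightarrow> distinct z \<Longrightarrow> 0 \<notin> set z \<Longrightarrow> lp_eval n f z = 0"
  shows "f = (\<lambda>a. 0)"
proof -
  let ?S = "{a. f a \<noteq> 0}"
  have S: "finite ?S" using f by (rule lp_fin)
  obtain M where M: "M \<ge> 0" "\<And>a x. f a \<noteq> 0 \<Longrightarrow> x \<in> set a \<Longrightarrow> \<bar>x\<bar> \<le> M"
    using finite_lists_bounded[OF S] by auto
  \<comment> \<open>N > 2 M makes the encoding injective on the support; N \<ge> 2 keeps the
    exponents N^i, hence the coordinates, distinct.\<close>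
  define N where "N = nat (2 * M + 2)"
  have N: "int N = 2 * M + 2" "N \<ge> 2" using M(1) by (auto simp: N_def)
  define e where "e = horner_val (int N)"
  have e_inj: "a = b" if "f a \<noteq> 0" "f b \<noteq> 0" "e a = e b" for a b
    using horner_val_inj[of a b M "int N"] M(2) that f N by (auto simp: e_def lp_len)
  \<comment> \<open>The shift by \<open>B\<close> makes all exponents nonnegative, so that
    \<open>p\<close> below is a genuine polynomial.\<close>
  define B where "B = Max (insert 0 (abs ` e ` ?S))"
  have B: "e a + B \<ge> 0" if "f a \<noteq> 0" for a
  proof -
    have "\<bar>e a\<bar> \<le> B" unfolding B_def using S that by (intro Max_ge) auto
    then show ?thesis by linarith
  qed
  have inj_q: "q ^ i = q ^ j \<longleftrightarrow> i = j" for i j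
  proof -
    have "i = j" if "q ^ i = q ^ j" "i \<le> j" for i j
    proof (rule ccontr)
      assume "i \<noteq> j"
      have "q ^ j = q ^ i * q ^ (j - i)" using that(2) by (simp flip: power_add)
      then have "q ^ i * q ^ (j - i) = q ^ i * 1" using that(1) by simp
      then have "q ^ (j - i) = 1" using q(1) by simp
      then show False using q(2)[of "j - i"] \<open>i \<noteq> j\<close> that by simp
    qed
    then show ?thesis by (metis nat_le_linear)
  qed
  define p where "p = (\<Sum>a\<in>?S. monom (f a) (nat (e a + B)))"
  have root: "poly p (q ^ m) = 0" if m: "m > 0" for m
  proof -
    define Q where "Q = q ^ m"
    have Q: "Q \<noteq> 0" using q by (simp add: Q_def)
    define z where "z = map (\<lambda>i. Q ^ (N ^ i)) [0..<n]"
    have "distinct z" unfolding z_def distinct_map Q_def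
      using m N(2) by (auto simp: inj_on_def inj_q simp flip: power_mult)
    moreover have "0 \<notin> set z" "length z = n" using Q by (auto simp: z_def)
    ultimately have "lp_eval n f z = 0" using ev by blast
    moreover have "mval n z a = Q powi e a" if "f a \<noteq> 0" for a
    proof -
      have "length a = n" using that f by (simp add: lp_len)
      then show ?thesis unfolding mval_def e_def horner_val_sum using Q
        by (auto simp: power_int_sum z_def power_int_power intro!: prod.cong)
    qed
    ultimately have "(\<Sum>a\<in>?S. f a * Q powi e a) = 0"
      using lp_eval_eq[of ?S f n z] S by simp
    then have "0 = Q powi B * (\<Sum>a\<in>?S. f a * Q powi e a)" by simp
    also have "\<dots> = (\<Sum>a\<in>?S. f a * Q ^ nat (e a + B))"
      unfolding sum_distrib_left
      by (intro sum.cong refl) (use B Q in \<open>auto simp: power_int_add mult_ac simp flip: power_int_nonneg_exp\<close>)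
    also have "\<dots> = poly p Q" by (simp add: p_def poly_sum poly_monom)
    finally show ?thesis by (simp add: Q_def)
  qed
  have "p = 0"
  proof (rule ccontr)
    assume "p \<noteq> 0"
    then have "finite {x. poly p x = 0}" by (rule poly_roots_finite)
    moreover have "(\<lambda>m. q ^ Suc m) ` UNIV \<subseteq> {x. poly p x = 0}" using root by (auto simp del: power_Suc)
    ultimately have "finite ((\<lambda>m. q ^ Suc m) ` UNIV)" by (rule rev_finite_subset)
    then show False using finite_imageD[of "\<lambda>m. q ^ Suc m" UNIV] inj_q by (simp add: inj_def del: power_Suc)
  qed
  have "f a = 0" for a
  proof (rule ccontr)
    assume a: "f a \<noteq> 0"
    have "coeff p (nat (e a + B)) = (\<Sum>b\<in>?S. if b = a then f b else 0)"
      unfolding p_def coeff_sum using a B e_inj by (intro sum.cong refl) (auto simp: nat_eq_iff)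
    also have "\<dots> = f a" using S a by simp
    finally show False using a \<open>p = 0\<close> by simp
  qed
  then show ?thesis by blast
qed

section \<open>Relations between the operators\<close>

definition zrot :: "'a::field \<Rightarrow> 'a list \<Rightarrow> 'a list" where
  "zrot q z = (q * last z) # butlast z"

lemma length_zrot [simp]: "length z = n \<Longrightarrow> n > 0 \<Longrightarrow> length (zrot q z) = n"
  by (cases z) (auto simp: zrot_def)

lemma nth_zrot: "length z = n \<Longrightarrow> j < n \<Longrightarrow>
    zrot q z ! j = (if j = 0 then q * z ! (n - 1) else z ! (j - 1))"
  by (cases z rule: rev_cases) (auto simp: zrot_def nth_append nth_Cons split: nat.splits)

lemma zrot_nonzero: "z \<noteq> [] \<Longrightarrow> q \<noteq> 0 \<Longrightarrow> 0 \<notin> set z \<Longrightarrow> 0 \<notin> set (zrot q z)"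
  by (cases z rule: rev_cases) (auto simp: zrot_def)

lemma omega_supp: "n > 0 \<Longrightarrow> q \<noteq> 0 \<Longrightarrow> lp n f \<Longrightarrow> {b. omega q f b \<noteq> 0} = rotate1 ` {a. f a \<noteq> 0}"
proof (intro equalityI subsetI)
  fix b assume n: "n > 0" "lp n f" and b: "b \<in> {b. omega q f b \<noteq> 0}"
  show "b \<in> rotate1 ` {a. f a \<noteq> 0}"
  proof (cases "b = []")
    case True then show ?thesis using n b by (auto simp: omega_def lp_def)
  next
    case False
    then show ?thesis using b
      by (intro image_eqI[of _ _ "last b # butlast b"]) (auto simp: omega_def)
  qed
next
  fix b assume n: "n > 0" "q \<noteq> 0" "lp n f" and b: "b \<in> rotate1 ` {a. f a \<noteq> 0}"
  then obtain a where a: "b = rotate1 a" "f a \<noteq> 0" by blast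
  then have "a \<noteq> []" using n lp_len by fastforce
  then obtain x xs where "a = x # xs" by (cases a) auto
  then show "b \<in> {b. omega q f b \<noteq> 0}" using a n by (auto simp: omega_def)
qed

lemma omega_lp [simp]: "n > 0 \<Longrightarrow> q \<noteq> 0 \<Longrightarrow> lp n f \<Longrightarrow> lp n (omega q f)"
  unfolding lp_def[of n "omega q f"] using omega_supp[of n q f] lp_len[of n f]
  by (auto simp: lp_fin set_eq_iff)

lemma eval_omega:
  assumes n: "n > 0" "q \<noteq> 0" and f: "lp n f" and z: "length z = n" "0 \<notin> set z"
  shows "lp_eval n (omega q f) z = lp_eval n f (zrot q z)"
proof -
  have inj: "inj_on rotate1 {a. f a \<noteq> 0}" by (rule inj_on_subset[OF inj_rotate1]) auto
  have "lp_eval n (omega q f) z = (\<Sum>a\<in>rotate1 ` {a. f a \<noteq> 0}. omega q f a * mval n z a)"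
    by (rule lp_eval_eq) (use n f in \<open>auto simp: omega_supp lp_fin\<close>)
  also have "\<dots> = (\<Sum>a\<in>{a. f a \<noteq> 0}. f a * mval n (zrot q z) a)"
    unfolding sum.reindex[OF inj] o_def
  proof (intro sum.cong refl)
    fix a assume "a \<in> {a. f a \<noteq> 0}"
    then have la: "length a = n" using f lp_len by blast
    then obtain x xs where a: "a = x # xs" using n by (cases a) auto
    obtain m where m: "n = Suc m" using n by (cases n) auto
    have lx: "length xs = m" using a la m by simp
    have "mval n (zrot q z) a = (q * z ! m) powi x * (\<Prod>i<m. (z ! i) powi (xs ! i))"
      unfolding mval_def m prod.lessThan_Suc_shift using z m by (simp add: nth_zrot a)
    also have "(\<Prod>i<m. (z ! i) powi (xs ! i)) = (\<Prod>i<m. (z ! i) powi (rotate1 a ! i))"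
      by (intro prod.cong refl) (simp add: a nth_append lx)
    also have "(q * z ! m) powi x * (\<Prod>i<m. (z ! i) powi (rotate1 a ! i)) = q powi x * mval n z (rotate1 a)"
      unfolding mval_def m prod.lessThan_Suc by (simp add: a nth_append lx power_int_mult_distrib mult_ac)
    finally have "mval n (zrot q z) a = q powi x * mval n z (rotate1 a)" .
    then show "omega q f (rotate1 a) * mval n z (rotate1 a) = f a * mval n (zrot q z) a"
      by (simp add: omega_def a)
  qed
  finally show ?thesis using f lp_eval_eq[of "{a. f a \<noteq> 0}" f n "zrot q z"] by (simp add: lp_fin)
qed

lemma omega_omega_inv: "q \<noteq> 0 \<Longrightarrow> omega q (omega_inv q f) = f"
  by (auto simp: fun_eq_iff omega_def omega_inv_def power_int_minus)

lemma omega_inv_omega: "q \<noteq> 0 \<Longrightarrow> omega_inv q (omega q f) = f"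
proof (rule ext)
  fix b :: "int list" assume "q \<noteq> 0"
  then show "omega_inv q (omega q f) b = f b"
    by (cases b) (auto simp: omega_def omega_inv_def power_int_minus)
qed

lemma omega_inv_lp [simp]:
  assumes "n > 0" "q \<noteq> 0" "lp n f" shows "lp n (omega_inv q f)"
proof (rule lpI[of "{a. rotate1 a \<in> {a. f a \<noteq> 0}}"])
  show "finite {a. rotate1 a \<in> {a. f a \<noteq> 0}}"
    using finite_vimageI[of "{a. f a \<noteq> 0}" rotate1] assms inj_rotate1
    by (simp add: vimage_def lp_fin)
  fix a assume "omega_inv q f a \<noteq> 0"
  then have "f (rotate1 a) \<noteq> 0" by (cases "a = []") (auto simp: omega_inv_def)
  then show "a \<in> {a. rotate1 a \<in> {a. f a \<noteq> 0}} \<and> length a = n"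
    using lp_len[OF assms(3), of "rotate1 a"] by simp
qed

text \<open>The scalar content of the braid relation, with a and b the two coefficients of T_i. When
  both words are evaluated at z, the coefficients of f at the three longer rearrangements of z agree
  as products; those at z and at its two neighbours need these identities.\<close>

lemma braid_identity:
  fixes x y w p m :: "'a::field"
  assumes "x \<noteq> y" "y \<noteq> w" "x \<noteq> w"
  defines "a \<equiv> \<lambda>x y. (p * x - m * y) / (x - y)" and "b \<equiv> \<lambda>x y. - ((p - m) * y / (x - y))"
  shows "b x y * b y w * b x y + a x y * b x w * a y x = b y w * b x y * b y w + a y w * b x w * a w y"
    and "b x y * b y w * a x y + a x y * b x w * b y x = b y w * a x y * b x w"
    and "b x y * a y w * b x w = b y w * b x y * a y w + a y w * b x w * b w y"
  using assms(1-3) unfolding a_def b_def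
  by (simp_all add: divide_simps) (simp_all add: algebra_simps)

locale daha =
  fixes n :: nat and s q :: "'a::field"
  assumes n2: "n \<ge> 2" and s0: "s \<noteq> 0" and q0: "q \<noteq> 0" and q_inf: "\<And>m. m > 0 \<Longrightarrow> q ^ m \<noteq> 1"
begin

abbreviation T where "T \<equiv> Top n s"
abbreviation U where "U \<equiv> Tinv n s"
abbreviation om where "om \<equiv> omega q"
abbreviation omi where "omi \<equiv> omega_inv q"
abbreviation X where "X i \<equiv> lp_shift n (unitv n i)"

lemma n0 [simp]: "n > 0" using n2 by simp

lemma lp_om [simp]: "lp n f \<Longrightarrow> lp n (om f)"
  and lp_omi [simp]: "lp n f \<Longrightarrow> lp n (omi f)"
  using q0 by simp_all

text \<open>Test points have distinct coordinates because only there does \<open>ev_T\<close>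
  express T_i f through values of f. The relations between the operators thereby become identities
  between rational functions of the coordinates.\<close>

lemma lp_eqI:
  fixes f g :: "'a lpoly"
  assumes "lp n f" "lp n g"
    and "\<And>z. length z = n \<Longrightarrow> distinct z \<Longrightarrow> 0 \<notin> set z \<Longrightarrow> lp_eval n f z = lp_eval n g z"
  shows "f = g"
proof -
  have "(\<lambda>a. f a - g a) = (\<lambda>a. 0)"
    by (rule lp_eq_0I[OF q0 q_inf, where n = n]) (use assms in \<open>auto simp: lp_diff eval_diff\<close>)
  then show ?thesis by (metis eq_iff_diff_eq_0 ext)
qed

text \<open>The coefficients in (T_i f)(z) = ca f(s_i z) + cb f(z). At y = s^2 x the first one is
  zero and T_i does not see the exchanged point.\<close>

definition ca where "ca x y = (s * x - inverse s * y) / (x - y)"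
definition cb where "cb x y = - ((s - inverse s) * y / (x - y))"

lemma ev_T: "Suc i < n \<Longrightarrow> lp n f \<Longrightarrow> length z = n \<Longrightarrow> 0 \<notin> set z \<Longrightarrow> z ! i \<noteq> z ! Suc i \<Longrightarrow>
    lp_eval n (T i f) z = ca (z ! i) (z ! Suc i) * lp_eval n f (lsw i z)
      + cb (z ! i) (z ! Suc i) * lp_eval n f z"
  by (simp add: eval_Top diff_divide_distrib ca_def cb_def left_diff_distrib)

lemma ca_scale: "ca (q * x) (q * y) = ca x y" and cb_scale: "cb (q * x) (q * y) = cb x y"
  using q0 by (simp_all add: ca_def cb_def mult.left_commute[of _ q] flip: right_diff_distrib)

lemma ne: "distinct z \<Longrightarrow> length z = n \<Longrightarrow> i < n \<Longrightarrow> j < n \<Longrightarrow> i \<noteq> j \<Longrightarrow> z ! i \<noteq> z ! j"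
  by (simp add: nth_eq_iff_index_eq)

lemma T_add: "Suc i < n \<Longrightarrow> lp n f \<Longrightarrow> lp n g \<Longrightarrow> T i (\<lambda>a. f a + g a) = (\<lambda>a. T i f a + T i g a)"
  by (rule lp_eqI) (auto simp: lp_add ev_T eval_add ne algebra_simps)

lemma T_scale: "Suc i < n \<Longrightarrow> lp n f \<Longrightarrow> T i (\<lambda>a. c * f a) = (\<lambda>a. c * T i f a)"
  by (rule lp_eqI) (auto simp: lp_scale ev_T eval_scale ne algebra_simps)

lemma U_add: "Suc i < n \<Longrightarrow> lp n f \<Longrightarrow> lp n g \<Longrightarrow> U i (\<lambda>a. f a + g a) = (\<lambda>a. U i f a + U i g a)"
  by (simp add: Tinv_def T_add fun_eq_iff algebra_simps)

lemma U_scale: "Suc i < n \<Longrightarrow> lp n f \<Longrightarrow> U i (\<lambda>a. c * f a) = (\<lambda>a. c * U i f a)"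
  by (simp add: Tinv_def T_scale fun_eq_iff algebra_simps)

lemma om_add: "om (\<lambda>a. f a + g a) = (\<lambda>a. om f a + om g a)"
  and om_scale: "om (\<lambda>a. c * f a) = (\<lambda>a. c * om f a)"
  and omi_add: "omi (\<lambda>a. f a + g a) = (\<lambda>a. omi f a + omi g a)"
  and omi_scale: "omi (\<lambda>a. c * f a) = (\<lambda>a. c * omi f a)"
  by (auto simp: omega_def omega_inv_def fun_eq_iff algebra_simps)

lemma om_omi [simp]: "om (omi f) = f" and omi_om [simp]: "omi (om f) = f"
  using q0 by (simp_all add: omega_omega_inv omega_inv_omega)

lemma quadratic:
  assumes i: "Suc i < n" and f: "lp n f"
  shows "T i (T i f) = (\<lambda>a. (s - inverse s) * T i f a + f a)"
proof (rule lp_eqI)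
  fix z :: "'a list" assume z: "length z = n" "distinct z" "0 \<notin> set z"
  define x y where "x = z ! i" and "y = z ! Suc i"
  have xy: "x \<noteq> y" using z i by (simp add: ne x_def y_def)
  have sw: "lsw i z ! i = y" "lsw i z ! Suc i = x" "0 \<notin> set (lsw i z)"
    using i z by (auto simp: nth_lsw set_lsw x_def y_def)
  have "lp_eval n (T i (T i f)) z
     = (ca x y * cb y x + cb x y * ca x y) * lp_eval n f (lsw i z)
      + (ca x y * ca y x + cb x y * cb x y) * lp_eval n f z"
    using i z f xy sw by (simp add: ev_T x_def[symmetric] y_def[symmetric] algebra_simps)
  moreover have "ca x y * cb y x + cb x y * ca x y = (s - inverse s) * ca x y"
    using xy s0 by (simp add: ca_def cb_def divide_simps) (simp add: algebra_simps)
  moreover have "ca x y * ca y x + cb x y * cb x y = (s - inverse s) * cb x y + 1"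
    using xy s0 by (simp add: ca_def cb_def divide_simps) (simp add: algebra_simps)
  moreover have "lp_eval n (\<lambda>a. (s - inverse s) * T i f a + f a) z
     = (s - inverse s) * (ca x y * lp_eval n f (lsw i z) + cb x y * lp_eval n f z) + lp_eval n f z"
    using i z f xy by (simp add: eval_add lp_scale eval_scale ev_T x_def[symmetric] y_def[symmetric])
  ultimately show "lp_eval n (T i (T i f)) z = lp_eval n (\<lambda>a. (s - inverse s) * T i f a + f a) z"
    by (simp only:) (simp add: distrib_left distrib_right mult.assoc)
qed (use i f in \<open>auto intro!: lp_add lp_scale\<close>)

lemma TU [simp]: "Suc i < n \<Longrightarrow> lp n f \<Longrightarrow> T i (U i f) = f"
proof -
  assume i: "Suc i < n" and f: "lp n f"
  have "U i f = (\<lambda>a. T i f a + (- (s - inverse s)) * f a)" by (simp add: Tinv_def fun_eq_iff algebra_simps)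
  then show ?thesis using i f
    by (simp only: T_add[OF i Top_lp[OF i f] lp_scale[OF f]] T_scale[OF i f] quadratic[OF i f]) (simp add: algebra_simps)
qed

lemma UT [simp]: "Suc i < n \<Longrightarrow> lp n f \<Longrightarrow> U i (T i f) = f"
  by (simp add: Tinv_def quadratic)

lemma T_far: "Suc i < j \<Longrightarrow> Suc j < n \<Longrightarrow> lp n f \<Longrightarrow> T i (T j f) = T j (T i f)"
proof (rule lp_eqI)
  fix z :: "'a list" assume z: "length z = n" "distinct z" "0 \<notin> set z"
    and ij: "Suc i < j" "Suc j < n" and f: "lp n f"
  have "lsw i (lsw j z) = lsw j (lsw i z)"
    using z ij by (intro nth_equalityI) (auto simp: nth_lsw)
  then show "lp_eval n (T i (T j f)) z = lp_eval n (T j (T i f)) z"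
    using z ij f by (simp add: ev_T nth_lsw set_lsw ne algebra_simps)
qed auto

lemma braid:
  assumes i: "Suc (Suc i) < n" and f: "lp n f"
  shows "T i (T (Suc i) (T i f)) = T (Suc i) (T i (T (Suc i) f))"
proof (rule lp_eqI)
  fix z :: "'a list" assume z: "length z = n" "distinct z" "0 \<notin> set z"
  define x y w where "x = z ! i" and "y = z ! Suc i" and "w = z ! Suc (Suc i)"
  have xy: "x \<noteq> y" "y \<noteq> w" "x \<noteq> w" "y \<noteq> x" "w \<noteq> y" "w \<noteq> x" using z i by (simp_all add: ne x_def y_def w_def)
  let ?j = "Suc i"
  define F where "F = lp_eval n f"
  have sw: "lsw ?j (lsw i (lsw ?j z)) = lsw i (lsw ?j (lsw i z))"
    using z i by (intro nth_equalityI) (auto simp: nth_lsw)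
  note d = x_def[symmetric] y_def[symmetric] w_def[symmetric] F_def[symmetric]
  have L: "lp_eval n (T i (T ?j (T i f))) z =
     ca x y * (ca x w * (ca y w * F (lsw i (lsw ?j (lsw i z))) + cb y w * F (lsw ?j (lsw i z)))
      + cb x w * (ca y x * F z + cb y x * F (lsw i z)))
     + cb x y * (ca y w * (ca x w * F (lsw i (lsw ?j z)) + cb x w * F (lsw ?j z))
      + cb y w * (ca x y * F (lsw i z) + cb x y * F z))"
    using i z f xy by (simp add: ev_T nth_lsw set_lsw d)
  have R: "lp_eval n (T ?j (T i (T ?j f))) z =
     ca y w * (ca x w * (ca x y * F (lsw i (lsw ?j (lsw i z))) + cb x y * F (lsw i (lsw ?j z)))
      + cb x w * (ca w y * F z + cb w y * F (lsw ?j z)))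
     + cb y w * (ca x y * (ca x w * F (lsw ?j (lsw i z)) + cb x w * F (lsw i z))
      + cb x y * (ca y w * F (lsw ?j z) + cb y w * F z))"
    using i z f xy by (simp add: ev_T nth_lsw set_lsw d sw)
  note b = braid_identity[OF xy(1-3), of s "inverse s", folded ca_def cb_def]
  have "lp_eval n (T i (T ?j (T i f))) z =
      ca x y * ca x w * ca y w * F (lsw i (lsw ?j (lsw i z)))
    + ca x y * ca x w * cb y w * F (lsw ?j (lsw i z)) + cb x y * ca y w * ca x w * F (lsw i (lsw ?j z))
    + (cb x y * cb y w * cb x y + ca x y * cb x w * ca y x) * F z
    + (cb x y * cb y w * ca x y + ca x y * cb x w * cb y x) * F (lsw i z)
    + cb x y * ca y w * cb x w * F (lsw ?j z)" unfolding L by algebra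
  also have "\<dots> = lp_eval n (T ?j (T i (T ?j f))) z" unfolding R b by algebra
  finally show "lp_eval n (T i (T ?j (T i f))) z = lp_eval n (T ?j (T i (T ?j f))) z" .
qed (use assms in auto)

lemma om_T:
  assumes i: "Suc (Suc i) < n" and f: "lp n f"
  shows "om (T (Suc i) f) = T i (om f)"
proof (rule lp_eqI)
  fix z :: "'a list" assume z: "length z = n" "distinct z" "0 \<notin> set z"
  have "lsw (Suc i) (zrot q z) = zrot q (lsw i z)"
    using z i by (intro nth_equalityI) (auto simp: nth_lsw nth_zrot)
  moreover have "0 \<notin> set (zrot q z)" using z n2 q0 by (intro zrot_nonzero) auto
  ultimately show "lp_eval n (om (T (Suc i) f)) z = lp_eval n (T i (om f)) z"
    using z i f q0 by (simp add: eval_omega ev_T nth_zrot ne set_lsw)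
qed (use assms in auto)

text \<open>A single \<open>om\<close> would carry T_0 to the affine generator, which is not among
  the T_i; two turns bring it round to T_(n-2). Both coordinates involved pick up a factor q, which
  cancels since \<open>ca\<close> and \<open>cb\<close> are homogeneous of degree zero.\<close>

lemma om2_T:
  assumes f: "lp n f"
  shows "om (om (T 0 f)) = T (n - 2) (om (om f))"
proof (rule lp_eqI)
  fix z :: "'a list" assume z: "length z = n" "distinct z" "0 \<notin> set z"
  have e: "Suc (n - 2) = n - 1" "Suc (n - 2) < n" using n2 by auto
  let ?z = "zrot q (zrot q z)"
  have "lsw 0 ?z = zrot q (zrot q (lsw (n - 2) z))"
    using z n2 by (intro nth_equalityI) (auto simp: nth_lsw nth_zrot numeral_2_eq_2)
  moreover have 1: "0 \<notin> set (zrot q z)" using z n2 q0 by (intro zrot_nonzero) auto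
  moreover have "0 \<notin> set ?z" using z n2 q0 1 by (intro zrot_nonzero) (auto simp: zrot_def)
  moreover have "?z ! 0 = q * z ! (n - 2)" "?z ! Suc 0 = q * z ! (n - 1)"
    using z n2 by (auto simp: nth_zrot numeral_2_eq_2)
  moreover have "z ! (n - 2) \<noteq> z ! (n - 1)" using z n2 by (intro ne) auto
  moreover have "0 \<notin> set (zrot q (lsw (n - 2) z))"
    using z n2 q0 e by (intro zrot_nonzero) (auto simp: set_lsw simp flip: length_0_conv)
  ultimately show "lp_eval n (om (om (T 0 f))) z = lp_eval n (T (n - 2) (om (om f))) z"
    using z f q0 e n2 by (simp add: eval_omega ev_T set_lsw ca_scale cb_scale)
qed (use assms n2 in auto)

lemma eval_X: "i < n \<Longrightarrow> lp n f \<Longrightarrow> length z = n \<Longrightarrow> 0 \<notin> set z \<Longrightarrow> lp_eval n (X i f) z = z ! i * lp_eval n f z"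
  by (simp add: eval_shift mval_unitv)

lemma TXT:
  assumes i: "Suc i < n" and f: "lp n f"
  shows "T i (X i (T i f)) = X (Suc i) f"
proof (rule lp_eqI)
  fix z :: "'a list" assume z: "length z = n" "distinct z" "0 \<notin> set z"
  define x y where "x = z ! i" and "y = z ! Suc i"
  have xy: "x \<noteq> y" using z i by (simp add: ne x_def y_def)
  have sw: "lsw i z ! i = y" "lsw i z ! Suc i = x" "0 \<notin> set (lsw i z)"
    using i z by (auto simp: nth_lsw set_lsw x_def y_def)
  have "lp_eval n (T i (X i (T i f))) z
     = (y * ca x y * cb y x + x * cb x y * ca x y) * lp_eval n f (lsw i z)
      + (y * ca x y * ca y x + x * cb x y * cb x y) * lp_eval n f z"
    using i z f xy sw by (simp add: ev_T eval_X x_def[symmetric] y_def[symmetric] algebra_simps)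
  moreover have "y * ca x y * cb y x + x * cb x y * ca x y = 0"
    using xy s0 by (simp add: ca_def cb_def divide_simps) (simp add: algebra_simps)
  moreover have "y * ca x y * ca y x + x * cb x y * cb x y = y"
    using xy s0 by (simp add: ca_def cb_def divide_simps) (simp add: algebra_simps)
  ultimately show "lp_eval n (T i (X i (T i f))) z = lp_eval n (X (Suc i) f) z"
    using i z f by (simp add: eval_X y_def)
qed (use i f in auto)

lemma TX_far: "Suc i < n \<Longrightarrow> j < n \<Longrightarrow> j \<noteq> i \<Longrightarrow> j \<noteq> Suc i \<Longrightarrow> lp n f \<Longrightarrow> T i (X j f) = X j (T i f)"
  by (rule lp_eqI) (auto simp: ev_T eval_X ne nth_lsw set_lsw algebra_simps)

lemma om_X:
  assumes i: "Suc i < n" and f: "lp n f"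
  shows "om (X (Suc i) f) = X i (om f)"
proof (rule lp_eqI)
  fix z :: "'a list" assume z: "length z = n" "distinct z" "0 \<notin> set z"
  moreover have "0 \<notin> set (zrot q z)" using z n2 q0 by (intro zrot_nonzero) auto
  ultimately show "lp_eval n (om (X (Suc i) f)) z = lp_eval n (X i (om f)) z"
    using i f q0 by (simp add: eval_omega eval_X nth_zrot)
qed (use assms in auto)

lemma om_X0:
  assumes f: "lp n f"
  shows "om (X 0 f) = (\<lambda>a. q * X (n - 1) (om f) a)"
proof (rule lp_eqI)
  fix z :: "'a list" assume z: "length z = n" "distinct z" "0 \<notin> set z"
  moreover have "0 \<notin> set (zrot q z)" using z n2 q0 by (intro zrot_nonzero) auto
  ultimately show "lp_eval n (om (X 0 f)) z = lp_eval n (\<lambda>a. q * X (n - 1) (om f) a) z"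
    using f q0 n2 by (simp add: eval_omega eval_X eval_scale nth_zrot)
qed (use assms in \<open>auto intro!: lp_scale\<close>)

end

section \<open>Commutation of the Cherednik operators\<close>

context daha
begin

abbreviation Y where "Y \<equiv> Yop n s q"
abbreviation Yi where "Yi \<equiv> Yinv n s q"

section \<open>Words in the operators, and their linearity\<close>

lemma foldr_lp:
  "(\<And>j f. j \<in> set ks \<Longrightarrow> lp n f \<Longrightarrow> lp n (B j f)) \<Longrightarrow> lp n f \<Longrightarrow> lp n (foldr B ks f)"
  by (induction ks) auto

lemma foldr_intertwine:
  assumes "\<And>j f. j \<in> set ks \<Longrightarrow> lp n f \<Longrightarrow> A (B j f) = B' j (A f)"
    and "\<And>j f. j \<in> set ks \<Longrightarrow> lp n f \<Longrightarrow> lp n (B j f)" and "lp n f"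
  shows "A (foldr B ks f) = foldr B' ks (A f)"
  using assms by (induction ks) (auto simp: foldr_lp)

lemma foldr_T_lp [simp]: "b \<le> n - 1 \<Longrightarrow> lp n f \<Longrightarrow> lp n (foldr T [a..<b] f)"
  and foldr_U_lp [simp]: "b \<le> n - 1 \<Longrightarrow> lp n f \<Longrightarrow> lp n (foldr U [a..<b] f)"
  and foldr_T_rev_lp [simp]: "b \<le> n - 1 \<Longrightarrow> lp n f \<Longrightarrow> lp n (foldr T (rev [a..<b]) f)"
  and foldr_U_rev_lp [simp]: "b \<le> n - 1 \<Longrightarrow> lp n f \<Longrightarrow> lp n (foldr U (rev [a..<b]) f)"
  by (rule foldr_lp; auto)+

lemma Y_lp [simp]: "i < n \<Longrightarrow> lp n f \<Longrightarrow> lp n (Y i f)"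
  and Yi_lp [simp]: "i < n \<Longrightarrow> lp n f \<Longrightarrow> lp n (Yi i f)"
  by (simp_all add: Yop_def Yinv_def)

lemma foldr_TU: "(\<And>j. j \<in> set ks \<Longrightarrow> Suc j < n) \<Longrightarrow> lp n f \<Longrightarrow> foldr T ks (foldr U (rev ks) f) = f"
  by (induction ks arbitrary: f) auto

lemma foldr_UT: "(\<And>j. j \<in> set ks \<Longrightarrow> Suc j < n) \<Longrightarrow> lp n f \<Longrightarrow> foldr U ks (foldr T (rev ks) f) = f"
  by (induction ks arbitrary: f) auto

lemma foldr_cancel [simp]:
  assumes "b \<le> n - 1" "lp n f"
  shows "foldr T [a..<b] (foldr U (rev [a..<b]) f) = f" "foldr U [a..<b] (foldr T (rev [a..<b]) f) = f"
    and "foldr T (rev [a..<b]) (foldr U [a..<b] f) = f" "foldr U (rev [a..<b]) (foldr T [a..<b] f) = f"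
proof -
  have c: "Suc j < n" if "j \<in> set [a..<b]" for j using assms that by auto
  show "foldr T [a..<b] (foldr U (rev [a..<b]) f) = f" "foldr U [a..<b] (foldr T (rev [a..<b]) f) = f"
    using c assms(2) by (auto intro!: foldr_TU foldr_UT)
  show "foldr T (rev [a..<b]) (foldr U [a..<b] f) = f" "foldr U (rev [a..<b]) (foldr T [a..<b] f) = f"
    using foldr_TU[of "rev [a..<b]" f] foldr_UT[of "rev [a..<b]" f] c assms(2) by auto
qed

lemma Y_Yi [simp]: "i < n \<Longrightarrow> lp n f \<Longrightarrow> Y i (Yi i f) = f"
  by (simp add: Yop_def Yinv_def)

lemma Yi_Y [simp]: "i < n \<Longrightarrow> lp n f \<Longrightarrow> Yi i (Y i f) = f"
  by (simp add: Yop_def Yinv_def)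

lemma foldr_add:
  assumes "\<And>j f g. j \<in> set ks \<Longrightarrow> lp n f \<Longrightarrow> lp n g \<Longrightarrow> B j (\<lambda>a. f a + g a) = (\<lambda>a. B j f a + B j g a)"
    and "\<And>j f. j \<in> set ks \<Longrightarrow> lp n f \<Longrightarrow> lp n (B j f)" and "lp n f" "lp n g"
  shows "foldr B ks (\<lambda>a. f a + g a) = (\<lambda>a. foldr B ks f a + foldr B ks g a)"
  using assms by (induction ks) (auto simp: foldr_lp)

lemma foldr_scale:
  assumes "\<And>j f. j \<in> set ks \<Longrightarrow> lp n f \<Longrightarrow> B j (\<lambda>a. c * f a) = (\<lambda>a. c * B j f a)"
    and "\<And>j f. j \<in> set ks \<Longrightarrow> lp n f \<Longrightarrow> lp n (B j f)" and "lp n f"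
  shows "foldr B ks (\<lambda>a. c * f a) = (\<lambda>a. c * foldr B ks f a)"
  using assms by (induction ks) (auto simp: foldr_lp)

lemma foldr_TU_add:
  assumes "b \<le> n - 1" "lp n f" "lp n g"
  shows "foldr T [a..<b] (\<lambda>a. f a + g a) = (\<lambda>x. foldr T [a..<b] f x + foldr T [a..<b] g x)"
    and "foldr U [a..<b] (\<lambda>a. f a + g a) = (\<lambda>x. foldr U [a..<b] f x + foldr U [a..<b] g x)"
  by (rule foldr_add; use assms in \<open>auto simp: T_add U_add\<close>)+

lemma foldr_TU_scale:
  assumes "b \<le> n - 1" "lp n f"
  shows "foldr T [a..<b] (\<lambda>a. c * f a) = (\<lambda>x. c * foldr T [a..<b] f x)"
    and "foldr U [a..<b] (\<lambda>a. c * f a) = (\<lambda>x. c * foldr U [a..<b] f x)"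
  by (rule foldr_scale; use assms in \<open>auto simp: T_scale U_scale\<close>)+

lemma Y_add: "i < n \<Longrightarrow> lp n f \<Longrightarrow> lp n g \<Longrightarrow> Y i (\<lambda>a. f a + g a) = (\<lambda>a. Y i f a + Y i g a)"
  by (simp add: Yop_def foldr_TU_add om_add)

lemma Y_scale: "i < n \<Longrightarrow> lp n f \<Longrightarrow> Y i (\<lambda>a. c * f a) = (\<lambda>a. c * Y i f a)"
  by (simp add: Yop_def foldr_TU_scale om_scale)

text \<open>The inverse of T_i is T_i minus a scalar, so a linear map that carries T_i to T_j does
  the same with the inverses.\<close>

lemma U_conj:
  assumes "\<And>f g. lp n f \<Longrightarrow> lp n g \<Longrightarrow> A (\<lambda>a. f a + g a) = (\<lambda>a. A f a + A g a)"
    and "\<And>c f. lp n f \<Longrightarrow> A (\<lambda>a. c * f a) = (\<lambda>a. c * A f a)"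
    and "A (T i f) = T j (A f)" and "Suc i < n" and "lp n f"
  shows "A (U i f) = U j (A f)"
proof -
  have "U i f = (\<lambda>a. T i f a + (- (s - inverse s)) * f a)" by (simp add: Tinv_def fun_eq_iff algebra_simps)
  then have "A (U i f) = (\<lambda>a. T j (A f) a + (- (s - inverse s)) * A f a)"
    using assms(4,5) by (simp only: assms(1)[OF Top_lp[OF assms(4,5)] lp_scale[OF assms(5)]] assms(2,3))
  then show ?thesis by (simp add: Tinv_def fun_eq_iff algebra_simps)
qed

lemma T_far_sym: "Suc i < j \<or> Suc j < i \<Longrightarrow> Suc i < n \<Longrightarrow> Suc j < n \<Longrightarrow> lp n f \<Longrightarrow> T i (T j f) = T j (T i f)"
  using T_far[of i j f] T_far[of j i f] by auto

lemma TU_far: "Suc i < j \<or> Suc j < i \<Longrightarrow> Suc i < n \<Longrightarrow> Suc j < n \<Longrightarrow> lp n f \<Longrightarrow> T i (U j f) = U j (T i f)"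
  by (rule U_conj) (auto simp: T_add T_scale T_far_sym)

lemma om_U: "Suc (Suc i) < n \<Longrightarrow> lp n f \<Longrightarrow> om (U (Suc i) f) = U i (om f)"
  by (rule U_conj) (auto simp: om_add om_scale om_T)

lemma om2_U: "lp n f \<Longrightarrow> om (om (U 0 f)) = U (n - 2) (om (om f))"
  using n2 by (intro U_conj[of "\<lambda>f. om (om f)"]) (auto simp: om_add om_scale om2_T)

lemma T_foldr_far: "Suc j < a \<or> b < j \<Longrightarrow> Suc j < n \<Longrightarrow> b \<le> n - 1 \<Longrightarrow> lp n f \<Longrightarrow>
    T j (foldr T [a..<b] f) = foldr T [a..<b] (T j f)"
  by (rule foldr_intertwine) (auto intro!: T_far_sym)

lemma upt_split2: "a \<le> j \<Longrightarrow> Suc j < b \<Longrightarrow> [a..<b] = [a..<j] @ [j, Suc j] @ [Suc (Suc j)..<b]"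
  using upt_add_eq_append[of a j "b - j"] by (simp add: upt_conv_Cons)

text \<open>Coming from the right, T_j commutes with all factors until it meets T_j T_(j+1); the
  braid relation there sends it on as T_(j+1), which commutes with the rest.\<close>

lemma T_foldr_shift:
  assumes "a \<le> j" "Suc j < b" "b \<le> n - 1" and f: "lp n f"
  shows "foldr T [a..<b] (T j f) = T (Suc j) (foldr T [a..<b] f)"
proof -
  let ?g = "foldr T [Suc (Suc j)..<b] f"
  have g: "lp n ?g" using assms by simp
  have "foldr T [a..<b] (T j f) = foldr T [a..<j] (T j (T (Suc j) (T j ?g)))"
    using assms by (simp add: upt_split2[of a j b] T_foldr_far)
  also have "\<dots> = foldr T [a..<j] (T (Suc j) (T j (T (Suc j) ?g)))"
    using assms g by (simp add: braid)
  also have "\<dots> = T (Suc j) (foldr T [a..<b] f)"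
    using assms g T_foldr_far[of "Suc j" a j "T j (T (Suc j) ?g)"] by (simp add: upt_split2[of a j b])
  finally show ?thesis .
qed

lemma UU_T:
  assumes j: "Suc (Suc j) < n" and f: "lp n f"
  shows "U j (U (Suc j) (T j f)) = T (Suc j) (U j (U (Suc j) f))"
proof -
  define g where "g = U j (U (Suc j) f)"
  have g: "lp n g" and e: "f = T (Suc j) (T j g)" unfolding g_def using j f by simp_all
  show ?thesis unfolding g_def[symmetric] using j g by (simp add: e braid)
qed

lemma T_foldrU_far: "b < j \<Longrightarrow> Suc j < n \<Longrightarrow> lp n f \<Longrightarrow>
    T j (foldr U [a..<b] f) = foldr U [a..<b] (T j f)"
  by (rule foldr_intertwine) (auto simp: TU_far)

lemma T_foldrU_shift:
  assumes "Suc j < i" "i < n" and f: "lp n f"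
  shows "foldr U [0..<i] (T j f) = T (Suc j) (foldr U [0..<i] f)"
proof -
  let ?g = "foldr U [Suc (Suc j)..<i] f"
  have g: "lp n ?g" using assms by simp
  have c: "foldr U [Suc (Suc j)..<i] (T j f) = T j ?g"
    by (rule foldr_intertwine[symmetric]) (use assms in \<open>auto simp: TU_far\<close>)
  have c': "T (Suc j) (foldr U [0..<j] h) = foldr U [0..<j] (T (Suc j) h)" if "lp n h" for h
    by (rule foldr_intertwine) (use assms that in \<open>auto simp: TU_far\<close>)
  have "foldr U [0..<i] (T j f) = foldr U [0..<j] (U j (U (Suc j) (T j ?g)))"
    using assms by (simp add: upt_split2[of 0 j i] c)
  also have "\<dots> = foldr U [0..<j] (T (Suc j) (U j (U (Suc j) ?g)))"
    using assms g by (simp add: UU_T)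
  also have "\<dots> = T (Suc j) (foldr U [0..<i] f)"
    using assms g by (simp add: upt_split2[of 0 j i] c')
  finally show ?thesis .
qed

text \<open>In Y_i = T_i ... T_(n-2) om T_0^-1 ... T_(i-1)^-1, one of the two words shifts the index
  of T_j and \<open>om\<close> shifts it back, while the other word commutes with it. For j > i the
  left word does the shifting, otherwise the right one.\<close>

lemma TY_far:
  assumes i: "i < n" and j: "Suc j < n" and ne: "j \<noteq> i" "Suc j \<noteq> i" and f: "lp n f"
  shows "T j (Y i f) = Y i (T j f)"
proof (cases "i < j")
  case True
  then obtain k where k: "j = Suc k" by (cases j) auto
  have "T j (foldr T [i..<n-1] (om (foldr U [0..<i] f))) = foldr T [i..<n-1] (T k (om (foldr U [0..<i] f)))"
    using True k j i f T_foldr_shift[of i k "n - 1" "om (foldr U [0..<i] f)"] by simp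
  also have "T k (om (foldr U [0..<i] f)) = om (foldr U [0..<i] (T j f))"
    using True k j i f by (simp add: om_T[symmetric] T_foldrU_far)
  finally show ?thesis by (simp add: Yop_def)
next
  case False
  then have ji: "Suc j < i" using ne by simp
  have "T j (foldr T [i..<n-1] (om (foldr U [0..<i] f))) = foldr T [i..<n-1] (T j (om (foldr U [0..<i] f)))"
    using ji i j f by (intro T_foldr_far) auto
  also have "T j (om (foldr U [0..<i] f)) = om (foldr U [0..<i] (T j f))"
    using ji i j f by (simp add: om_T[symmetric] T_foldrU_shift)
  finally show ?thesis by (simp add: Yop_def)
qed

lemma TYT: "Suc i < n \<Longrightarrow> lp n f \<Longrightarrow> T i (Y (Suc i) (T i f)) = Y i f"
  using upt_conv_Cons[of i "n - 1"] by (simp add: Yop_def)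

lemma Y_Suc: "Suc i < n \<Longrightarrow> lp n f \<Longrightarrow> Y (Suc i) f = U i (Y i (U i f))"
  using TYT[of i "U i f"] by (metis TU UT Suc_lessD Y_lp Tinv_lp)

lemma om_foldr_T: "b < n \<Longrightarrow> lp n f \<Longrightarrow> om (foldr T [Suc a..<b] f) = foldr T [a..<b - 1] (om f)"
proof -
  assume b: "b < n" and f: "lp n f"
  have e: "[Suc a..<b] = map Suc [a..<b - 1]" by (cases b) (auto simp: map_Suc_upt)
  have "om (foldr (\<lambda>j. T (Suc j)) [a..<b - 1] f) = foldr T [a..<b - 1] (om f)"
    by (rule foldr_intertwine) (use b f in \<open>auto simp: om_T\<close>)
  then show ?thesis unfolding e by (simp add: foldr_map o_def)
qed

lemma om_foldr_U: "b < n \<Longrightarrow> lp n f \<Longrightarrow> om (foldr U [Suc a..<b] f) = foldr U [a..<b - 1] (om f)"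
proof -
  assume b: "b < n" and f: "lp n f"
  have e: "[Suc a..<b] = map Suc [a..<b - 1]" by (cases b) (auto simp: map_Suc_upt)
  have "om (foldr (\<lambda>j. U (Suc j)) [a..<b - 1] f) = foldr U [a..<b - 1] (om f)"
    by (rule foldr_intertwine) (use b f in \<open>auto simp: om_U\<close>)
  then show ?thesis unfolding e by (simp add: foldr_map o_def)
qed

text \<open>With \<open>D = T\<^sub>0 \<cdots> T\<^sub>n\<^sub>-\<^sub>2\<close>, \<open>C = T\<^sub>1 \<cdots> T\<^sub>n\<^sub>-\<^sub>2\<close> and \<open>E = T\<^sub>0 \<cdots> T\<^sub>n\<^sub>-\<^sub>3\<close> the
  commutation of \<open>Y\<^sub>0\<close> and \<open>Y\<^sub>1\<close> reduces to \<open>D E = C D\<close>.\<close>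
lemma Y0_Y1:
  assumes f: "lp n f"
  shows "Y 0 (Y 1 f) = Y 1 (Y 0 f)"
proof -
  define g where "g = U 0 f"
  have g: "lp n g" and fg: "f = T 0 g" unfolding g_def using f n2 by simp_all
  define h where "h = om (om g)"
  have h: "lp n h" unfolding h_def using g by simp
  have S: "n - 1 = Suc (n - 2)" using n2 by simp
  have n1: "[0..<n - 1] = 0 # [1..<n - 1]" "[0..<n - 1] = [0..<n - 2] @ [n - 2]"
    using n2 by (simp add: upt_conv_Cons) (simp add: S del: One_nat_def)
  have Y1: "Y (Suc 0) k = foldr T [Suc 0..<n-1] (om (U 0 k))" for k by (simp add: Yop_def)
  have Y0: "Y 0 k = foldr T [0..<n-1] (om k)" for k by (simp add: Yop_def)
  have "Y 0 (Y 1 f) = foldr T [0..<n-1] (om (foldr T [Suc 0..<n-1] (om g)))"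
    using g n2 by (simp add: Y0 Y1 fg)
  also have "\<dots> = foldr T [0..<n-1] (foldr T [0..<n-2] h)"
    using g n2 by (simp add: om_foldr_T h_def numeral_2_eq_2)
  also have "\<dots> = foldr (\<lambda>j. T (Suc j)) [0..<n-2] (foldr T [0..<n-1] h)"
    by (rule foldr_intertwine) (use h in \<open>auto simp: T_foldr_shift\<close>)
  also have "\<dots> = foldr T (map Suc [0..<n-2]) (foldr T [0..<n-1] h)"
    by (simp add: foldr_map o_def)
  also have "map Suc [0..<n-2] = [1..<n-1]"
    unfolding map_Suc_upt S[symmetric] by simp
  also have "foldr T [0..<n-1] h = foldr T [0..<n-2] (T (n - 2) h)"
    by (simp only: n1(2) foldr_append) simp
  also have "T (n - 2) h = om (om (T 0 g))" unfolding h_def using g by (simp add: om2_T)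
  also have "foldr T [0..<n-2] (om (om (T 0 g))) = om (foldr T [Suc 0..<n-1] (om (T 0 g)))"
    using g n2 by (simp add: om_foldr_T numeral_2_eq_2)
  also have "foldr T [Suc 0..<n-1] (om (T 0 g)) = U 0 (Y 0 f)"
    unfolding Y0 fg[symmetric] n1(1) using f n2 by simp
  finally show ?thesis by (simp add: Y1)
qed

text \<open>The pair Y_0, Y_1 implies all others: Y_(i+1) = U_i Y_i U_i, and U_i commutes with every
  Y_j for j different from i and i + 1.\<close>

lemma Y_comm_less: "i < j \<Longrightarrow> j < n \<Longrightarrow> lp n f \<Longrightarrow> Y i (Y j f) = Y j (Y i f)"
proof (induction i arbitrary: j f)
  case 0
  have "Y 0 (Y (Suc k) f) = Y (Suc k) (Y 0 f)" if "Suc k < n" "lp n f" for k f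
    using that
  proof (induction k arbitrary: f)
    case 0 then show ?case using Y0_Y1 by simp
  next
    case (Suc k)
    have c: "Y 0 (U (Suc k) h) = U (Suc k) (Y 0 h)" if "lp n h" for h
      by (rule U_conj) (use Suc.prems that in \<open>auto simp: Y_add Y_scale TY_far\<close>)
    show ?case using Suc by (simp add: Y_Suc[of "Suc k"] c)
  qed
  then show ?case using 0 by (cases j) auto
next
  case (Suc i)
  have c: "Y j (U i h) = U i (Y j h)" if "lp n h" for h
    by (rule U_conj) (use Suc.prems that in \<open>auto simp: Y_add Y_scale TY_far\<close>)
  have "Y i (Y j (U i f)) = Y j (Y i (U i f))" using Suc.prems by (intro Suc.IH) auto
  then show ?case using Suc.prems by (simp add: Y_Suc[of i] c)
qed

lemma Y_comm: "i < n \<Longrightarrow> j < n \<Longrightarrow> lp n f \<Longrightarrow> Y i (Y j f) = Y j (Y i f)"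
  using Y_comm_less[of i j f] Y_comm_less[of j i f] by (cases i j rule: linorder_cases) auto

section \<open>Intertwiners\<close>

text \<open>The affine intertwiner, or raising operator, of Knop and Sahi. It is invertible, with
  inverse \<open>Phi'\<close>.\<close>

definition Ph where "Ph f = X (n - 1) (om f)"
definition Phi' where "Phi' f = omi (lp_shift n (map uminus (unitv n (n - 1))) f)"

lemma UX: "Suc i < n \<Longrightarrow> lp n f \<Longrightarrow> U i (X (Suc i) f) = X i (T i f)"
  by (simp add: TXT[symmetric])

lemma TX: "Suc i < n \<Longrightarrow> lp n f \<Longrightarrow> T i (X i f) = X (Suc i) (U i f)"
  using TXT[of i "U i f"] by simp

lemma X_add: "X i (\<lambda>a. f a + g a) = (\<lambda>a. X i f a + X i g a)"
  and X_scale: "X i (\<lambda>a. c * f a) = (\<lambda>a. c * X i f a)"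
  for f g :: "'a lpoly"
  by (auto simp: lp_shift_def fun_eq_iff)

lemma UX_far: "Suc i < n \<Longrightarrow> j < n \<Longrightarrow> j \<noteq> i \<Longrightarrow> j \<noteq> Suc i \<Longrightarrow> lp n f \<Longrightarrow> U i (X j f) = X j (U i f)"
  by (rule U_conj[symmetric]) (auto simp: X_add X_scale TX_far)

lemma Ph_lp [simp]: "lp n f \<Longrightarrow> lp n (Ph f)"
  and Phi'_lp [simp]: "lp n f \<Longrightarrow> lp n (Phi' f)"
  by (simp_all add: Ph_def Phi'_def)

lemma shift_uminus:
  assumes "length b = n" "lp n f"
  shows "lp_shift n b (lp_shift n (map uminus b) f) = f"
    and "lp_shift n (map uminus b) (lp_shift n b f) = f"
proof -
  have "map2 (+) b (map uminus b) = replicate n 0" "map2 (+) (map uminus b) b = replicate n 0"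
    using assms by (auto intro!: nth_equalityI)
  then show "lp_shift n b (lp_shift n (map uminus b) f) = f"
    and "lp_shift n (map uminus b) (lp_shift n b f) = f"
    using assms by (simp_all add: shift_shift shift_0)
qed

lemma Ph_Phi' [simp]: "lp n f \<Longrightarrow> Ph (Phi' f) = f" and Phi'_Ph [simp]: "lp n f \<Longrightarrow> Phi' (Ph f) = f"
  by (simp_all add: Ph_def Phi'_def shift_uminus)

lemma Ph_add: "Ph (\<lambda>a. f a + g a) = (\<lambda>a. Ph f a + Ph g a)"
  and Ph_scale: "Ph (\<lambda>a. c * f a) = (\<lambda>a. c * Ph f a)"
  by (auto simp: Ph_def om_add om_scale X_add X_scale)

text \<open>The factor x_(n-1) moves through T_0^-1 ... T_(n-2)^-1, becoming x_0 and turning the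
  inverses into the word of Y_0; then \<open>om\<close> takes x_0 to q x_(n-1), which is where the
  factor q comes from.\<close>

lemma Y_last_Ph:
  assumes f: "lp n f"
  shows "Y (n - 1) (Ph f) = (\<lambda>a. q * Ph (Y 0 f) a)"
proof -
  have "foldr U [0..<m] (X m g) = X 0 (foldr T [0..<m] g)" if "m \<le> n - 1" "lp n g" for m g
    using that by (induction m arbitrary: g) (auto simp: UX)
  from this[of "n - 1" "om f"] show ?thesis
    using f by (simp add: Yop_def Ph_def om_X0)
qed

text \<open>The factor x_(n-1) drops to x_(n-2) under \<open>om\<close>. The last letter T_(n-2)
  lifts it again and turns into its inverse, which \<open>om2_U\<close> carries through both turns
  to the factor T_0^-1 that Y_(i+1) has in addition.\<close>

lemma Y_Ph:
  assumes i: "Suc i < n" and f: "lp n f"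
  shows "Y i (Ph f) = Ph (Y (Suc i) f)"
proof -
  have e: "Suc (n - 2) = n - 1" "Suc (n - 2) < n" using n2 by auto
  have e1: "[i..<n - 1] = [i..<n - 2] @ [n - 2]" unfolding e(1)[symmetric] using i by simp
  define h where "h = om (foldr U [0..<i] (om f))"
  have h: "lp n h" unfolding h_def using i f by simp
  have "foldr U [0..<i] (X (n - 1) (om f)) = X (n - 1) (foldr U [0..<i] (om f))"
    by (rule foldr_intertwine[symmetric]) (use i f in \<open>auto simp: UX_far\<close>)
  then have "om (foldr U [0..<i] (Ph f)) = X (n - 2) h"
    using i f om_X[of "n - 2"] e unfolding Ph_def h_def by simp
  then have "Y i (Ph f) = foldr T [i..<n-2] (T (n - 2) (X (n - 2) h))"
    unfolding Yop_def e1 by simp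
  also have "\<dots> = foldr T [i..<n-2] (X (n - 1) (U (n - 2) h))"
    using TX[of "n - 2" h] h e by simp
  also have "\<dots> = X (n - 1) (foldr T [i..<n-2] (U (n - 2) h))"
    by (rule foldr_intertwine[symmetric]) (use i h e in \<open>auto simp: TX_far\<close>)
  also have "U (n - 2) h = om (om (foldr U [0..<Suc i] f))"
  proof -
    have 1: "om (foldr U [Suc 0..<Suc i] f) = foldr U [0..<i] (om f)"
      using om_foldr_U[of "Suc i" f 0] i f by simp
    have 2: "[0..<Suc i] = 0 # [Suc 0..<Suc i]" by (simp add: upt_conv_Cons del: upt_Suc)
    show ?thesis unfolding h_def 1[symmetric] 2 using om2_U[of "foldr U [Suc 0..<Suc i] f"] i f by simp
  qed
  also have "foldr T [i..<n-2] (om (om (foldr U [0..<Suc i] f))) = om (Y (Suc i) f)"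
    unfolding Yop_def using om_foldr_T[of "n - 1" "om (foldr U [0..<Suc i] f)" i] i f n2
    by (simp add: numeral_2_eq_2)
  finally show ?thesis by (simp add: Ph_def)
qed

definition wt where
  "wt f w \<longleftrightarrow> lp n f \<and> (\<forall>i<n. Y i f = (\<lambda>a. w i * f a))"

lemma wt_lp: "wt f w \<Longrightarrow> lp n f" by (simp add: wt_def)

lemma wt_Ph: "wt f w \<Longrightarrow> wt (Ph f) (\<lambda>i. if Suc i < n then w (Suc i) else q * w 0)"
  unfolding wt_def
proof (intro conjI allI impI)
  fix i assume w: "lp n f \<and> (\<forall>i<n. Y i f = (\<lambda>a. w i * f a))" and i: "i < n"
  show "Y i (Ph f) = (\<lambda>a. (if Suc i < n then w (Suc i) else q * w 0) * Ph f a)"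
  proof (cases "Suc i < n")
    case True then show ?thesis using w by (simp add: Y_Ph Ph_scale)
  next
    case False
    then have "i = n - 1" using i by simp
    then show ?thesis using w Y_last_Ph[of f] False by (simp add: Ph_scale mult.assoc)
  qed
qed auto

text \<open>The constant for which T_i + cw interchanges the eigenvalues x of Y_i and y of Y_(i+1):
  the solution c of c (y - x) = (s - s^-1) x.\<close>

definition cw where "cw x y = (s - inverse s) * x / (y - x)"

lemma wt_T:
  assumes f: "wt f w" and i: "Suc i < n" and ne: "w i \<noteq> w (Suc i)"
  shows "wt (\<lambda>a. T i f a + cw (w i) (w (Suc i)) * f a)
    (\<lambda>j. if j = i then w (Suc i) else if j = Suc i then w i else w j)"
proof -
  let ?c = "cw (w i) (w (Suc i))"
  have c: "?c * w (Suc i) = (s - inverse s) * w i + ?c * w i"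
    using ne by (simp add: cw_def divide_simps) (simp add: algebra_simps)
  have l: "lp n f" "lp n (T i f)" "lp n (Y i f)" using f i by (auto dest: wt_lp)
  have w: "Y j f = (\<lambda>a. w j * f a)" if "j < n" for j using f that by (auto simp: wt_def)
  have Yi: "Y i (T i f) = (\<lambda>a. (s - inverse s) * w i * f a + w (Suc i) * T i f a)"
  proof -
    have "Y i (T i f) = T i (Y (Suc i) (T i (T i f)))" using TYT[of i "T i f"] i l by simp
    also have "T i (T i f) = (\<lambda>a. (s - inverse s) * T i f a + f a)" using i l by (simp add: quadratic)
    also have "T i (Y (Suc i) \<dots>) = (\<lambda>a. (s - inverse s) * T i (Y (Suc i) (T i f)) a + T i (Y (Suc i) f) a)"
      using i l by (simp add: Y_add Y_scale T_add T_scale lp_scale)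
    also have "T i (Y (Suc i) (T i f)) = Y i f" using TYT i l by simp
    finally show ?thesis using i l w[of i] w[of "Suc i"] by (simp add: T_scale mult.assoc)
  qed
  have YS: "Y (Suc i) (T i f) = (\<lambda>a. w i * T i f a - (s - inverse s) * w i * f a)"
  proof -
    have "Y (Suc i) (T i f) = U i (T i (Y (Suc i) (T i f)))" using i l by simp
    also have "\<dots> = U i (Y i f)" using TYT i l by simp
    finally show ?thesis using i l w[of i] by (simp add: U_scale) (simp add: Tinv_def algebra_simps)
  qed
  have Yj: "Y j (T i f) = (\<lambda>a. w j * T i f a)" if "j < n" "j \<noteq> i" "j \<noteq> Suc i" for j
    using TY_far[of j i f] that i l w[of j] by (simp add: T_scale)
  show ?thesis unfolding wt_def
  proof (intro conjI allI impI)
    show "lp n (\<lambda>a. T i f a + ?c * f a)" using l by (intro lp_add lp_scale)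
    fix j assume j: "j < n"
    have e: "Y j (\<lambda>a. T i f a + ?c * f a) = (\<lambda>a. Y j (T i f) a + ?c * (w j * f a))"
      using j l w[of j] by (simp add: Y_add Y_scale lp_scale)
    consider "j = i" | "j = Suc i" | "j \<noteq> i" "j \<noteq> Suc i" by blast
    then show "Y j (\<lambda>a. T i f a + ?c * f a)
       = (\<lambda>a. (if j = i then w (Suc i) else if j = Suc i then w i else w j) * (T i f a + ?c * f a))"
    proof cases
      case 1
      have k: "(s - inverse s) * w i * x + ?c * (w i * x) = w (Suc i) * (?c * x)" for x
        using arg_cong[OF c, of "\<lambda>u. u * x"] by (simp add: algebra_simps)
      show ?thesis unfolding e unfolding 1 Yi
      proof (rule ext)
        fix x
        show "(s - inverse s) * w i * f x + w (Suc i) * T i f x + ?c * (w i * f x)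
          = (if i = i then w (Suc i) else if i = Suc i then w i else w i) * (T i f x + ?c * f x)"
          using k[of "f x"] by (simp add: algebra_simps)
      qed
    next
      case 2
      have k: "?c * (w (Suc i) * x) = (s - inverse s) * w i * x + w i * (?c * x)" for x
        using arg_cong[OF c, of "\<lambda>u. u * x"] by (simp add: algebra_simps)
      show ?thesis unfolding e unfolding 2 YS
      proof (rule ext)
        fix x
        show "w i * T i f x - (s - inverse s) * w i * f x + ?c * (w (Suc i) * f x)
          = (if Suc i = i then w (Suc i) else if Suc i = Suc i then w i else w (Suc i)) * (T i f x + ?c * f x)"
          using k[of "f x"] by (simp add: algebra_simps)
      qed
    qed (use j e Yj in \<open>auto simp: fun_eq_iff algebra_simps\<close>)
  qed
qed

text \<open>The two constants add up to s^-1 - s, so the term with T_i from the quadratic relation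
  cancels and a scalar remains.\<close>

lemma intertwiner_square:
  assumes f: "lp n f" and i: "Suc i < n" and ne: "x \<noteq> y"
  shows "(\<lambda>a. T i (\<lambda>a. T i f a + cw x y * f a) a + cw y x * (T i f a + cw x y * f a))
    = (\<lambda>a. (1 + cw x y * cw y x) * f a)"
proof -
  have "cw x y + cw y x = - (s - inverse s)"
    using ne by (simp add: cw_def divide_simps) (simp add: algebra_simps)
  then have c: "cw y x = - (s - inverse s) - cw x y" by (simp add: algebra_simps)
  show ?thesis using f i by (simp add: T_add T_scale lp_scale quadratic c) (simp add: algebra_simps)
qed

text \<open>Up to a nonzero factor the scalar is (x - t y)(t x - y) with t = s^2. The intertwiner is
  thus invertible unless the eigenvalues differ by a factor t or t^-1.\<close>

lemma one_plus_cw: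
  assumes ne: "x \<noteq> y"
  shows "1 + cw x y * cw y x = 0 \<longleftrightarrow> x = s\<^sup>2 * y \<or> s\<^sup>2 * x = y"
proof -
  have "1 + cw x y * cw y x = - ((x - s\<^sup>2 * y) * (s\<^sup>2 * x - y)) / (s\<^sup>2 * ((y - x) * (x - y)))"
    using ne s0 by (simp add: cw_def divide_simps power2_eq_square) (simp add: algebra_simps)
  then show ?thesis using ne s0 by auto
qed

end

section \<open>The order on exponents\<close>

lemma dom_le_refl: "dom_le x x"
  by (simp add: dom_le_def)

lemma dom_le_trans: "dom_le x y \<Longrightarrow> dom_le y z \<Longrightarrow> dom_le x z"
  unfolding dom_le_def by (metis order_trans)

lemma dom_le_antisym:
  assumes "dom_le x y" "dom_le y x" shows "x = y"
proof (rule nth_equalityI)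
  show l: "length x = length y" using assms by (simp add: dom_le_def)
  fix i assume i: "i < length x"
  have e: "sum_list (take m x) = sum_list (take m y)" if "m \<le> length x" for m
    using assms that l unfolding dom_le_def by (metis order_antisym)
  show "x ! i = y ! i" using e[of i] e[of "Suc i"] i l by (simp add: take_Suc_conv_app_nth)
qed

lemma dom_lt_trans: "dom_lt x y \<Longrightarrow> dom_lt y z \<Longrightarrow> dom_lt x z"
  unfolding dom_lt_def using dom_le_trans dom_le_antisym by blast

lemma prec_trans: "prec x y \<Longrightarrow> prec y z \<Longrightarrow> prec x z"
  unfolding prec_def using dom_lt_trans by metis

lemma prec_irrefl [simp]: "\<not> prec x x"
  by (simp add: prec_def dom_lt_def)

lemma length_dplus [simp]: "length (dplus x) = length x"
  by (simp add: dplus_def)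

lemma mset_dplus [simp]: "mset (dplus x) = mset x"
  by (simp add: dplus_def)

lemma dplus_cong: "mset x = mset y \<Longrightarrow> dplus x = dplus y"
  unfolding dplus_def by (metis mset_sort properties_for_sort sorted_sort)

lemma prec_dom_le: "prec x y \<Longrightarrow> dom_le (dplus x) (dplus y)"
  by (auto simp: prec_def dom_lt_def dom_le_refl)

lemma prec_length: "prec x y \<Longrightarrow> length x = length y"
  by (auto dest!: prec_dom_le simp: dom_le_def)

text \<open>The initial segments of a decreasing list have the largest sums among sub-multisets of
  their size. This lets dominance be compared on multisets, without tracking positions.\<close>

lemma sum_take_ge:
  fixes y :: "int list"
  assumes "sorted_wrt (\<ge>) y" "M \<subseteq># mset y"
  shows "sum_mset M \<le> sum_list (take (size M) y)"
  using assms
proof (induction y arbitrary: M)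
  case (Cons h t)
  show ?case
  proof (cases "M = {#}")
    case False
    have "\<exists>e. e \<in># M \<and> e \<le> h \<and> M - {#e#} \<subseteq># mset t"
    proof (cases "h \<in># M")
      case True
      then show ?thesis using Cons.prems(2) by (intro exI[of _ h]) (auto simp: subset_eq_diff_conv)
    next
      case False
      obtain e where e: "e \<in># M" using \<open>M \<noteq> {#}\<close> by blast
      have "M \<subseteq># mset t" using Cons.prems(2) False
        by (metis diff_single_trivial mset.simps(2) subset_eq_diff_conv add_mset_add_single)
      moreover have "e \<le> h" using e Cons.prems mset_subset_eqD[OF Cons.prems(2) e] by auto
      ultimately show ?thesis using e by (meson diff_subset_eq_self subset_mset.order_trans)
    qed
    then obtain e where e: "e \<in># M" "e \<le> h" "M - {#e#} \<subseteq># mset t" by blast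
    then have M: "M = add_mset e (M - {#e#})" by simp
    have "sum_mset (M - {#e#}) \<le> sum_list (take (size (M - {#e#})) t)"
      using Cons.IH[OF _ e(3)] Cons.prems(1) by simp
    then show ?thesis using e(2) by (subst (1 2) M) simp
  qed simp
qed simp

lemma sorted_dplus: "sorted_wrt (\<ge>) (dplus x)"
  by (simp add: dplus_def sorted_wrt_rev)

lemma sum_list_mset: "sum_list x = sum_mset (mset x)" for x :: "int list"
  by (simp add: sum_mset_sum_list)

lemma submset_add_mset:
  assumes "M \<subseteq># add_mset u K"
  shows "M \<subseteq># K \<or> (\<exists>N. M = add_mset u N \<and> N \<subseteq># K)"
proof (cases "u \<in># M")
  case True
  then obtain N where "M = add_mset u N" by (rule multi_member_split[THEN exE])
  then show ?thesis using assms by auto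
next
  case False
  then show ?thesis using assms by (metis diff_single_trivial subset_eq_diff_conv add_mset_add_single)
qed

lemma submset_pair: "M \<subseteq># {#u, v#} \<Longrightarrow> M \<in> {{#}, {#u#}, {#v#}, {#u, v#}}"
  by (auto dest!: submset_add_mset)

text \<open>Each choice of entries of \<open>x\<close> is outweighed by an equally large choice from
  \<open>y\<close>: entries of the common part \<open>R\<close> are kept, a single one of u', v' is
  replaced by u, and both together by u and v.\<close>

lemma dom_lt_transfer:
  assumes y: "mset y = {#u, v#} + R" and x: "mset x = {#u', v'#} + R"
    and e: "u + v = u' + v'" and m: "u' < u" "v' < u"
  shows "dom_lt (dplus x) (dplus y)"
proof -
  have ly: "length x = length y" using x y by (metis size_mset size_union size_add_mset)
  have ne: "dplus x \<noteq> dplus y"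
  proof
    assume "dplus x = dplus y"
    then have "mset x = mset y" by (metis mset_dplus)
    then have "{#u, v#} + R = {#u', v'#} + R" unfolding x y ..
    then have "{#u, v#} = {#u', v'#}" by (metis add_right_cancel)
    then have "u \<in># {#u', v'#}" by (metis union_single_eq_member)
    then show False using m by auto
  qed
  have "sum_list (take k (dplus x)) \<le> sum_list (take k (dplus y))" if k: "k \<le> length y" for k
  proof -
    define M where "M = mset (take k (dplus x))"
    have sM: "size M = k" using k ly by (simp add: M_def)
    have "M \<subseteq># mset (dplus x)" unfolding M_def by (metis append_take_drop_id mset_append mset_subset_eq_add_left)
    then have M: "M \<subseteq># {#u', v'#} + R" using x by simp
    define N where "N = M \<inter># R"
    have N: "N \<subseteq># R" by (simp add: N_def)
    have MN: "M = (M - R) + N" unfolding N_def by (rule multiset_eqI) (simp add: min_def)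
    have "M - R \<subseteq># {#u', v'#}" using M by (simp add: subset_eq_diff_conv)
    then have c: "M - R \<in> {{#}, {#u'#}, {#v'#}, {#u', v'#}}" by (rule submset_pair)
    have "\<exists>L. L \<subseteq># {#u, v#} \<and> size L = size (M - R) \<and> sum_mset (M - R) \<le> sum_mset L"
    proof -
      consider "M - R = {#}" | "M - R = {#u'#}" | "M - R = {#v'#}" | "M - R = {#u', v'#}" using c by blast
      then show ?thesis
      proof cases
        case 1 then show ?thesis by (intro exI[of _ "{#}"]) simp
      next
        case 2 then show ?thesis using m by (intro exI[of _ "{#u#}"]) simp
      next
        case 3 then show ?thesis using m by (intro exI[of _ "{#u#}"]) simp
      next
        case 4 then show ?thesis using e by (intro exI[of _ "{#u, v#}"]) simp
      qed
    qed
    then obtain L where L: "L \<subseteq># {#u, v#}" "size L = size (M - R)" "sum_mset (M - R) \<le> sum_mset L" by blast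
    have "size (L + N) = k" using L(2) sM MN by (metis size_union)
    moreover have "L + N \<subseteq># mset (dplus y)" unfolding mset_dplus y using L(1) N by (rule subset_mset.add_mono)
    ultimately have "sum_mset (L + N) \<le> sum_list (take k (dplus y))"
      using sum_take_ge[OF sorted_dplus, of "L + N" y] by simp
    moreover have "sum_list (take k (dplus x)) = sum_mset M" by (simp add: M_def sum_list_mset)
    moreover have "sum_mset M = sum_mset (M - R) + sum_mset N" by (subst MN) (simp only: sum_mset.union)
    ultimately show ?thesis using L(3) by simp
  qed
  moreover have "sum_list (dplus x) = sum_list (dplus y)" by (simp add: sum_list_mset x y e)
  ultimately show ?thesis using ne ly by (auto simp: dom_lt_def dom_le_def)
qed

lemma mset_two_updates:
  assumes "i < length a" "j < length a" "i \<noteq> j"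
  obtains R where "\<And>u v. mset (a[i := u, j := v]) = {#u, v#} + R"
proof
  let ?I = "{0..<length a} - {i, j}"
  fix u v
  let ?b = "a[i := u, j := v]"
  have I: "{0..<length a} = insert i (insert j ?I)" using assms by auto
  have "mset ?b = image_mset ((!) ?b) (mset_set {0..<length a})"
    by (metis map_nth length_list_update mset_map mset_upt)
  also have "mset_set {0..<length a} = add_mset i (add_mset j (mset_set ?I))"
    by (subst I) (use assms in simp)
  also have "image_mset ((!) ?b) \<dots> = {#u, v#} + image_mset ((!) ?b) (mset_set ?I)"
    using assms by simp
  also have "image_mset ((!) ?b) (mset_set ?I) = image_mset ((!) a) (mset_set ?I)"
    by (rule image_mset_cong) auto
  finally show "mset ?b = {#u, v#} + image_mset ((!) a) (mset_set ?I)" .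
qed

text \<open>For such k the new pair has the same sum, but both its members lie strictly outside the
  interval spanned by the old pair, so the dominant rearrangement goes up.\<close>

lemma prec_transfer:
  assumes "i < length a" "m < length a" "i \<noteq> m"
    and "k < min 0 (a ! m - a ! i) \<or> k > max 0 (a ! m - a ! i)"
  shows "prec a (a[i := a ! m - k, m := a ! i + k])"
proof -
  obtain R where R: "\<And>u v. mset (a[i := u, m := v]) = {#u, v#} + R"
    using mset_two_updates[OF assms(1-3)] by blast
  have a: "mset a = {#a ! i, a ! m#} + R" using R[of "a ! i" "a ! m"] by simp
  have "dom_lt (dplus a) (dplus (a[i := a ! m - k, m := a ! i + k]))"
  proof (cases "k < 0")
    case True
    then show ?thesis using assms(4) by (intro dom_lt_transfer[OF R a]) auto
  next
    case False
    have R': "mset (a[i := a ! m - k, m := a ! i + k]) = {#a ! i + k, a ! m - k#} + R"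
      by (simp add: R add_mset_commute)
    show ?thesis using False assms(4) by (intro dom_lt_transfer[OF R' a]) auto
  qed
  then show ?thesis by (simp add: prec_def)
qed

lemma sum_list_take: "k \<le> length a \<Longrightarrow> sum_list (take k a) = (\<Sum>j<k. a ! j)" for a :: "int list"
  by (simp add: sum_list_sum_nth min_def atLeast0LessThan)

text \<open>The dominant rearrangement is unchanged, and the only partial sums affected, those
  ending between the two positions, grow.\<close>

lemma prec_swap:
  assumes im: "i < m" "m < length a" and lt: "a ! i < a ! m"
  shows "prec a (a[i := a ! m, m := a ! i])"
proof -
  let ?b = "a[i := a ! m, m := a ! i]"
  obtain R where R: "\<And>u v. mset (a[i := u, m := v]) = {#u, v#} + R"
    using mset_two_updates[of i a m] im by auto
  have ms: "mset ?b = mset a" using R[of "a ! i" "a ! m"] by (simp add: R add_mset_commute)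
  have "sum_list (take k a) \<le> sum_list (take k ?b)" if k: "k \<le> length a" for k
  proof -
    define d where "d = a ! m - a ! i"
    have d: "d > 0" using lt by (simp add: d_def)
    have "(\<Sum>j<k. ?b ! j) = (\<Sum>j<k. a ! j + (if j = i then d else 0) - (if j = m then d else 0))"
      using im k by (intro sum.cong) (auto simp: nth_list_update d_def)
    also have "\<dots> = (\<Sum>j<k. a ! j) + (if i < k then d else 0) - (if m < k then d else 0)"
      by (simp add: sum.distrib sum_subtractf)
    finally show ?thesis using k im d by (simp add: sum_list_take split: if_splits)
  qed
  moreover have "sum_list ?b = sum_list a" by (simp only: sum_list_mset ms)
  moreover have "?b \<noteq> a" using im lt by (metis length_list_update nth_list_update_eq order_less_irrefl)
  ultimately have "dom_lt a ?b" by (auto simp: dom_lt_def dom_le_def)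
  then show ?thesis using dplus_cong[OF ms] by (simp add: prec_def)
qed

text \<open>Dominance bounds the largest entry from above, and also the sum of the n - 1 largest;
  the total being fixed, the latter bounds the smallest entry from below.\<close>

lemma finite_prec: "finite {mu. prec mu lam}"
proof -
  define H G where "H = sum_list (take 1 (dplus lam))"
    and "G = sum_list lam - sum_list (take (length lam - 1) (dplus lam))"
  have "length mu = length lam \<and> set mu \<subseteq> {G..H}" if p: "prec mu lam" for mu
  proof (intro conjI subsetI)
    show l: "length mu = length lam" using p by (rule prec_length)
    have d: "dom_le (dplus mu) (dplus lam)" using p by (rule prec_dom_le)
    then have s: "sum_list mu = sum_list lam" by (simp add: dom_le_def sum_list_mset)
    fix x assume x: "x \<in> set mu"
    then have l1: "1 \<le> length lam" using l by (cases mu) auto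
    have "sum_mset {#x#} \<le> sum_list (take (size {#x#}) (dplus mu))"
      by (rule sum_take_ge[OF sorted_dplus]) (use x in simp)
    then have "x \<le> sum_list (take 1 (dplus mu))" by simp
    also have "\<dots> \<le> H" using d l l1 unfolding dom_le_def H_def by simp
    finally have xH: "x \<le> H" .
    have sz: "size (mset mu - {#x#}) = length lam - 1" using x l by (simp add: size_Diff_singleton)
    have "sum_mset (mset mu - {#x#}) \<le> sum_list (take (length lam - 1) (dplus mu))"
      using sum_take_ge[OF sorted_dplus, of "mset mu - {#x#}" mu] by (simp add: sz)
    also have "\<dots> \<le> sum_list (take (length lam - 1) (dplus lam))" using d l unfolding dom_le_def by simp
    finally have "sum_mset (mset mu - {#x#}) \<le> sum_list lam - G" by (simp add: G_def)
    moreover have "sum_mset (mset mu) = x + sum_mset (mset mu - {#x#})"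
    proof -
      have "sum_mset (mset mu) = sum_mset (add_mset x (mset mu - {#x#}))" using x by simp
      then show ?thesis unfolding sum_mset.add_mset .
    qed
    ultimately show "x \<in> {G..H}" using xH s by (simp add: sum_list_mset)
  qed
  then show ?thesis by (intro finite_subset[OF _ finite_lists_between[of "length lam" G H]]) auto
qed

section \<open>Triangularity of the Cherednik operators\<close>

text \<open>The list \<open>a\<close> with its entry \<open>a ! i\<close> moved to position \<open>j\<close>.\<close>
definition fr :: "nat \<Rightarrow> nat \<Rightarrow> int list \<Rightarrow> int list" where
  "fr i j a = map (\<lambda>p. if p = j then a ! i else
     (let p' = (if p < j then p else p - 1) in a ! (if p' < i then p' else Suc p'))) [0..<length a]"

lemma length_fr [simp]: "length (fr i j a) = length a"
  by (simp add: fr_def)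

lemma nth_fr: "p < length a \<Longrightarrow> fr i j a ! p = (if p = j then a ! i else
     (let p' = (if p < j then p else p - 1) in a ! (if p' < i then p' else Suc p')))"
  by (simp add: fr_def)

lemma fr_self: "fr i i a = a"
  by (rule nth_equalityI) (auto simp: nth_fr Let_def)

text \<open>A transfer between positions j and j + 1 of the moved list is a transfer between the
  travelling entry i and the entry \<open>m\<close> that it passes. The case distinction for
  \<open>m\<close> accounts for the gap that entry i leaves behind.\<close>

lemma lmv_fr:
  assumes "i < length a" "Suc j < length a"
  defines "m \<equiv> (if j < i then j else Suc j)"
  shows "lmv j k (fr i j a) = fr i (Suc j) (a[i := a ! m - k, m := a ! i + k])"
  by (rule nth_equalityI) (use assms in \<open>auto simp: nth_fr nth_lmv nth_list_update Let_def\<close>)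

lemma fr_last:
  assumes "length a = n" "n > 0" "i < n" shows "last (fr i (n - 1) a) = a ! i"
proof -
  have "fr i (n - 1) a \<noteq> []" using assms by (metis length_fr length_greater_0_conv)
  then show ?thesis using assms by (simp add: last_conv_nth nth_fr)
qed

lemma fr_rotate: "length a = n \<Longrightarrow> n > 0 \<Longrightarrow> i < n \<Longrightarrow>
    last (fr i (n - 1) a) # butlast (fr i (n - 1) a) = fr i 0 a"
  by (rule nth_equalityI) (auto simp: fr_last[unfolded One_nat_def, OF refl] nth_Cons nth_fr nth_butlast Let_def split: nat.splits)

lemma prod_if_powi:
  fixes s :: "'a::field"
  assumes "s \<noteq> 0" "finite A"
  shows "(\<Prod>p\<in>A. if P p then inverse s else s) = s powi (int (card A) - 2 * int (card {p \<in> A. P p}))"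
  using assms(2)
proof (induction A)
  case (insert x A)
  have "{p \<in> insert x A. P p} = (if P x then insert x {p \<in> A. P p} else {p \<in> A. P p})" by auto
  then have c: "card {p \<in> insert x A. P p} = (if P x then Suc (card {p \<in> A. P p}) else card {p \<in> A. P p})"
    using insert by simp
  have "s powi (int (card (insert x A)) - 2 * int (card {p \<in> insert x A. P p}))
    = s powi ((if P x then - 1 else 1) + (int (card A) - 2 * int (card {p \<in> A. P p})))"
    using insert c by (intro arg_cong[of _ _ "\<lambda>k. s powi k"]) auto
  also have "\<dots> = s powi (if P x then - 1 else 1) * s powi (int (card A) - 2 * int (card {p \<in> A. P p}))"
    by (rule power_int_add) (use assms in auto)
  finally show ?case using insert by (simp add: power_int_minus)
qed simp

context daha
begin

definition ev where "ev a i = s powi rho2 a i * q powi (a ! i)"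

text \<open>When the support on the line is confined to the segment from the exponent to its
  exchange, the interior terms occur in both half-line sums and cancel, and only the end values
  survive.\<close>

lemma T_local:
  assumes j: "Suc j < n" and f: "lp n f" and b: "length b = n"
    and d: "d = b ! Suc j - b ! j"
    and z: "\<And>k. k < min 0 d \<or> k > max 0 d \<Longrightarrow> f (lmv j k b) = 0"
  shows "T j f b = s * f (lmv j d b) + (if d > 0 then (s - inverse s) * (f b - f (lmv j d b)) else 0)"
proof -
  define F where "F = (\<lambda>k. f (lmv j k b))"
  have T: "T j f b = s * F d + (s - inverse s) * (fsum F {..<d} - fsum F {0<..})"
    unfolding F_def d by (rule Top_coeff[OF j f b])
  show ?thesis
  proof (cases "d > 0")
    case True
    have sup: "{k. F k \<noteq> 0} \<subseteq> {0..d}" using z True by (force simp: F_def)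
    have "fsum F {..<d} = sum F ({0..d} \<inter> {..<d})" "fsum F {0<..} = sum F ({0..d} \<inter> {0<..})"
      by (rule fsum_eq[OF _ sup]; simp)+
    moreover have "{0..d} \<inter> {..<d} = insert 0 {0<..<d}" "{0..d} \<inter> {0<..} = insert d {0<..<d}"
      using True by auto
    ultimately have "fsum F {..<d} - fsum F {0<..} = F 0 - F d" by simp
    then show ?thesis using True T by (simp add: F_def)
  next
    case False
    then have "fsum F {..<d} = 0" "fsum F {0<..} = 0"
      by (auto intro!: fsum_zero simp: F_def z)
    then show ?thesis using False T by (simp add: F_def)
  qed
qed

text \<open>Everything beyond the segment comes from exponents above \<open>a\<close> and
  contributes zero. If the passed entry is larger, the unexchanged end is above \<open>a\<close> as
  well by \<open>prec_swap\<close>, and the factor becomes s - (s - s^-1) = s^-1.\<close>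

lemma T_frame:
  assumes ij: "i \<le> j" "Suc j < n" and f: "lp n f" and a: "length a = n"
    and z: "\<And>\<nu>. prec a \<nu> \<Longrightarrow> f (fr i (Suc j) \<nu>) = 0"
  shows "T j f (fr i j a) = (if a ! Suc j > a ! i then inverse s else s) * f (fr i (Suc j) a)"
proof -
  define d where "d = a ! Suc j - a ! i"
  have mv: "lmv j k (fr i j a) = fr i (Suc j) (a[i := a ! Suc j - k, Suc j := a ! i + k])" for k
    using lmv_fr[of i a j k] ij a by simp
  have md: "lmv j d (fr i j a) = fr i (Suc j) a" unfolding mv by (simp add: d_def)
  have T: "T j f (fr i j a) = s * f (lmv j d (fr i j a))
    + (if d > 0 then (s - inverse s) * (f (fr i j a) - f (lmv j d (fr i j a))) else 0)"
  proof (rule T_local[OF ij(2) f])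
    show "d = fr i j a ! Suc j - fr i j a ! j" using ij a by (simp add: nth_fr d_def)
    fix k assume "k < min 0 d \<or> max 0 d < k"
    then show "f (lmv j k (fr i j a)) = 0"
      unfolding mv using ij a by (intro z prec_transfer) (auto simp: d_def)
  qed (use a in simp)
  show ?thesis
  proof (cases "d > 0")
    case True
    have "f (lmv j 0 (fr i j a)) = 0"
      unfolding mv using True ij a prec_swap[of i "Suc j" a] by (intro z) (auto simp: d_def)
    then show ?thesis using True by (simp add: T md) (simp add: d_def algebra_simps)
  next
    case False
    then show ?thesis by (simp add: T md) (simp add: d_def)
  qed
qed

text \<open>Compared with \<open>T_frame\<close>, the subtracted multiple of f changes the factor
  for equal entries from s to s^-1. This produces the tie rule of rho for entries standing to the
  left.\<close>

lemma U_frame: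
  assumes ij: "j < i" "i < n" and f: "lp n f" and a: "length a = n"
    and z: "\<And>\<nu>. prec a \<nu> \<Longrightarrow> f (fr i (Suc j) \<nu>) = 0"
  shows "U j f (fr i j a) = (if a ! j \<ge> a ! i then inverse s else s) * f (fr i (Suc j) a)"
proof -
  define d where "d = a ! j - a ! i"
  have j: "Suc j < n" using ij by simp
  have mv: "lmv j k (fr i j a) = fr i (Suc j) (a[i := a ! j - k, j := a ! i + k])" for k
    using lmv_fr[of i a j k] ij a by simp
  have md: "lmv j d (fr i j a) = fr i (Suc j) a" unfolding mv by (simp add: d_def)
  have T: "T j f (fr i j a) = s * f (lmv j d (fr i j a))
    + (if d > 0 then (s - inverse s) * (f (fr i j a) - f (lmv j d (fr i j a))) else 0)"
  proof (rule T_local[OF j f])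
    show "d = fr i j a ! Suc j - fr i j a ! j" using ij a by (simp add: nth_fr d_def)
    fix k assume "k < min 0 d \<or> max 0 d < k"
    then show "f (lmv j k (fr i j a)) = 0"
      unfolding mv using ij a by (intro z prec_transfer) (auto simp: d_def)
  qed (use a in simp)
  consider "d > 0" | "d = 0" | "d < 0" by linarith
  then show ?thesis
  proof cases
    case 3
    have "f (lmv j 0 (fr i j a)) = 0"
      unfolding mv using 3 ij a prec_swap[of j i a]
      by (intro z) (auto simp: d_def list_update_swap)
    then show ?thesis using 3 by (simp add: Tinv_def T md) (simp add: d_def)
  next
    case 2
    then have "fr i (Suc j) a = fr i j a" using md by simp
    then show ?thesis using 2 by (simp add: Tinv_def T) (simp add: d_def algebra_simps)
  next
    case 1
    then show ?thesis by (simp add: Tinv_def T md) (simp add: d_def algebra_simps)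
  qed
qed

text \<open>The word of Y_i carries entry i of the exponent to the right end, through
  \<open>om\<close> to the front and back to its place, so that it passes every other entry once.
  Each passage contributes s or s^-1 and \<open>om\<close> contributes the power of q; the signs
  count to 2 rho(a)_i.\<close>

theorem Y_triangular:
  assumes i: "i < n" and f: "lp n f" and a: "length a = n" and z: "\<And>\<nu>. prec a \<nu> \<Longrightarrow> f \<nu> = 0"
  shows "Y i f a = ev a i * f a"
proof -
  define uc where "uc = (\<lambda>a p. if (a::int list) ! p \<ge> a ! i then inverse s else s)"
  define tc where "tc = (\<lambda>a p. if (a::int list) ! p > a ! i then inverse s else s)"
  \<comment> \<open>The property is inherited by all higher exponents. The inductions therefore run
    over all \<open>a\<close> with it, and at exponents above \<open>a\<close> they yield zero, as
    the two frame lemmas require.\<close>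
  define van where "van = (\<lambda>a. \<forall>\<nu>. prec a \<nu> \<longrightarrow> f \<nu> = 0)"
  have van_up: "van \<nu>" "f \<nu> = 0" if "van a" "prec a \<nu>" for a \<nu>
    using that prec_trans unfolding van_def by blast+
  have p1: "foldr U [j..<i] f (fr i j a) = (\<Prod>p\<in>{j..<i}. uc a p) * f a"
    if "j \<le> i" "length a = n" "van a" for j a
    using that
  proof (induction j arbitrary: a rule: inc_induct)
    case base then show ?case by (simp add: fr_self)
  next
    case (step j)
    have l: "lp n (foldr U [Suc j..<i] f)" using i f by simp
    have "U j (foldr U [Suc j..<i] f) (fr i j a) = uc a j * foldr U [Suc j..<i] f (fr i (Suc j) a)"
      unfolding uc_def using step i
      by (intro U_frame l) (auto simp: van_up step.IH prec_length[symmetric])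
    then show ?case using step
      by (simp add: upt_conv_Cons prod.atLeast_Suc_lessThan mult.assoc)
  qed
  define g where "g = om (foldr U [0..<i] f)"
  have g: "lp n g" unfolding g_def using i f by simp
  have g0: "g (fr i (n - 1) a) = q powi (a ! i) * (\<Prod>p\<in>{0..<i}. uc a p) * f a"
    if "length a = n" "van a" for a
  proof -
    have "fr i (n - 1) a \<noteq> []" using that n0 by (metis length_fr length_0_conv less_numeral_extra(3))
    then have "g (fr i (n - 1) a) = foldr U [0..<i] f (fr i 0 a) * q powi (a ! i)"
      unfolding g_def omega_def unfolding fr_rotate[OF that(1) n0 i]
      by (simp only: if_False fr_last[OF that(1) n0 i])
    then show ?thesis using that i p1[of 0 a] by simp
  qed
  have p2: "foldr T [j..<n-1] g (fr i j a)
      = (\<Prod>p\<in>{Suc j..<n}. tc a p) * (q powi (a ! i) * (\<Prod>p\<in>{0..<i}. uc a p) * f a)"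
    if "i \<le> j" "j \<le> n - 1" "length a = n" "van a" for j a
    using that(2,1,3,4)
  proof (induction j arbitrary: a rule: inc_induct)
    case base
    then show ?case using g0 n0 by (simp del: One_nat_def)
  next
    case (step j)
    have l: "lp n (foldr T [Suc j..<n-1] g)" using g by simp
    have "T j (foldr T [Suc j..<n-1] g) (fr i j a) = tc a (Suc j) * foldr T [Suc j..<n-1] g (fr i (Suc j) a)"
      unfolding tc_def using step i
      by (intro T_frame l) (auto simp: van_up step.IH prec_length[symmetric])
    then show ?case using step
      by (simp add: upt_conv_Cons prod.atLeast_Suc_lessThan[of "Suc j"] mult.assoc del: One_nat_def)
  qed
  have "van a" using z by (simp add: van_def)
  then have "Y i f a = (\<Prod>p\<in>{Suc i..<n}. tc a p) * (q powi (a ! i) * (\<Prod>p\<in>{0..<i}. uc a p) * f a)"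
    unfolding Yop_def g_def[symmetric] using p2[of i a] i a by (simp add: fr_self)
  moreover have "(\<Prod>p\<in>{Suc i..<n}. tc a p) * (\<Prod>p\<in>{0..<i}. uc a p) = s powi rho2 a i"
  proof -
    let ?P = "\<lambda>p. a ! p > a ! i \<or> (a ! p = a ! i \<and> p < i)"
    let ?c = "\<lambda>p. if ?P p then inverse s else s"
    have "(\<Prod>p\<in>{Suc i..<n}. tc a p) = prod ?c {Suc i..<n}" "(\<Prod>p\<in>{0..<i}. uc a p) = prod ?c {0..<i}"
      by (intro prod.cong; auto simp: tc_def uc_def)+
    then have "(\<Prod>p\<in>{Suc i..<n}. tc a p) * (\<Prod>p\<in>{0..<i}. uc a p) = prod ?c ({Suc i..<n} \<union> {0..<i})"
      by (subst prod.union_disjoint) auto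
    also have "{Suc i..<n} \<union> {0..<i} = {..<n} - {i}" using i by auto
    also have "prod ?c ({..<n} - {i}) = s powi (int (card ({..<n} - {i})) - 2 * int (card {p \<in> {..<n} - {i}. ?P p}))"
      by (rule prod_if_powi) (use s0 in auto)
    also have "{p \<in> {..<n} - {i}. ?P p} = {p. p < length a \<and> ?P p}" using a by auto
    also have "int (card ({..<n} - {i})) = int (length a) - 1" using i a by simp
    finally show ?thesis by (simp add: rho2_def)
  qed
  ultimately show ?thesis by (simp add: ev_def mult_ac)
qed

end

section \<open>Change of coefficients\<close>

text \<open>\<open>h\<close> is a ring homomorphism only on the subring \<open>R\<close>, since
  \<open>spec\<close> is meaningful only at regular elements. With the identity as \<open>h\<close>
  the locale just says that \<open>R\<close> is a subring.\<close>

locale coeff_hom =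
  fixes R :: "'a::field set" and h :: "'a \<Rightarrow> 'b::field"
  assumes R0: "0 \<in> R" and R1: "1 \<in> R"
    and Radd: "x \<in> R \<Longrightarrow> y \<in> R \<Longrightarrow> x + y \<in> R"
    and Rmult: "x \<in> R \<Longrightarrow> y \<in> R \<Longrightarrow> x * y \<in> R"
    and Rminus: "x \<in> R \<Longrightarrow> - x \<in> R"
    and h1: "h 1 = 1"
    and hadd: "x \<in> R \<Longrightarrow> y \<in> R \<Longrightarrow> h (x + y) = h x + h y"
    and hmult: "x \<in> R \<Longrightarrow> y \<in> R \<Longrightarrow> h (x * y) = h x * h y"
begin

lemma h0: "h 0 = 0"
proof -
  have "h 0 + h 0 = h 0 + 0" using hadd[OF R0 R0, symmetric] unfolding add_0_right .
  then show ?thesis by (rule add_left_imp_eq)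
qed

lemma hminus: "x \<in> R \<Longrightarrow> h (- x) = - h x"
  using hadd[of x "- x"] Rminus[of x] by (simp add: h0 eq_neg_iff_add_eq_0 add.commute)

lemma Rdiff: "x \<in> R \<Longrightarrow> y \<in> R \<Longrightarrow> x - y \<in> R"
  using Radd[of x "- y"] Rminus[of y] by simp

lemma hdiff: "x \<in> R \<Longrightarrow> y \<in> R \<Longrightarrow> h (x - y) = h x - h y"
  using hadd[of x "- y"] Rminus[of y] hminus[of y] by simp

lemma Rsum: "(\<And>k. k \<in> A \<Longrightarrow> F k \<in> R) \<Longrightarrow> sum F A \<in> R"
  by (induction A rule: infinite_finite_induct) (auto simp: R0 Radd)

lemma hsum: "(\<And>k. k \<in> A \<Longrightarrow> F k \<in> R) \<Longrightarrow> h (sum F A) = sum (\<lambda>k. h (F k)) A"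
  by (induction A rule: infinite_finite_induct) (auto simp: h0 hadd Rsum)

lemma Rpower: "x \<in> R \<Longrightarrow> x ^ m \<in> R"
  and hpower: "x \<in> R \<Longrightarrow> h (x ^ m) = h x ^ m"
proof -
  have "x ^ m \<in> R \<and> h (x ^ m) = h x ^ m" if "x \<in> R"
    by (induction m) (auto simp: R1 h1 Rmult hmult that)
  then show "x \<in> R \<Longrightarrow> x ^ m \<in> R" "x \<in> R \<Longrightarrow> h (x ^ m) = h x ^ m" by auto
qed

lemma hinverse: "x \<in> R \<Longrightarrow> inverse x \<in> R \<Longrightarrow> h (inverse x) = inverse (h x)"
proof (cases "x = 0")
  case False
  assume "x \<in> R" "inverse x \<in> R"
  then have "h x * h (inverse x) = 1" using False hmult[of x "inverse x"] by (simp add: h1)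
  then show ?thesis by (simp add: inverse_unique)
qed (simp add: h0)

lemma Rpowi: "x \<in> R \<Longrightarrow> inverse x \<in> R \<Longrightarrow> x powi m \<in> R"
  and hpowi: "x \<in> R \<Longrightarrow> inverse x \<in> R \<Longrightarrow> h (x powi m) = h x powi m"
  by (auto simp: power_int_def Rpower hpower hinverse)

lemma fsum_hom:
  assumes "\<And>k. F k \<in> R" "finite {k. F k \<noteq> 0}"
  shows "fsum F B \<in> R" "h (fsum F B) = fsum (\<lambda>k. h (F k)) B"
proof -
  have e: "fsum F B = sum F ({k. F k \<noteq> 0} \<inter> B)" by (rule fsum_eq) (use assms in auto)
  have e': "fsum (\<lambda>k. h (F k)) B = sum (\<lambda>k. h (F k)) ({k. F k \<noteq> 0} \<inter> B)"
    by (rule fsum_eq) (use assms h0 in auto)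
  show "fsum F B \<in> R" "h (fsum F B) = fsum (\<lambda>k. h (F k)) B"
    unfolding e e' by (simp_all add: Rsum hsum assms)
qed

lemma lp_hom: "lp n f \<Longrightarrow> lp n (\<lambda>a. h (f a))"
  by (rule lpI[of "{a. f a \<noteq> 0}"]) (auto simp: lp_fin h0, metis h0 lp_len)

context
  fixes s q :: 'a
  assumes s: "s \<in> R" "inverse s \<in> R" and q: "q \<in> R" "inverse q \<in> R"
begin

lemma Top_hom:
  assumes i: "Suc i < n" and f: "lp n f" and R: "\<And>a. f a \<in> R"
  shows "Top n s i f a \<in> R" "h (Top n s i f a) = Top n (h s) i (\<lambda>a. h (f a)) a"
proof -
  have "Top n s i f a \<in> R \<and> h (Top n s i f a) = Top n (h s) i (\<lambda>a. h (f a)) a"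
  proof (cases "length a = n")
    case True
    have fin: "finite {k. f (lmv i k a) \<noteq> 0}" using finite_line[of i a n f] i f True by simp
    note F = fsum_hom[of "\<lambda>k. f (lmv i k a)", OF R fin]
    show ?thesis
      unfolding Top_coeff[OF i f True] Top_coeff[OF i lp_hom[OF f] True] F(2)[symmetric]
      by (simp add: s R F(1) Radd Rmult Rdiff hadd hmult hdiff hinverse)
  next
    case False
    then show ?thesis using i f by (simp add: lp_zero[OF Top_lp] lp_hom h0 R0)
  qed
  then show "Top n s i f a \<in> R" "h (Top n s i f a) = Top n (h s) i (\<lambda>a. h (f a)) a" by auto
qed

lemma Tinv_hom:
  assumes i: "Suc i < n" and f: "lp n f" and R: "\<And>a. f a \<in> R"
  shows "Tinv n s i f a \<in> R" "h (Tinv n s i f a) = Tinv n (h s) i (\<lambda>a. h (f a)) a"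
  using Top_hom[OF i f R] by (auto simp: Tinv_def Rdiff Rmult R s hdiff hmult hinverse)

lemma omega_hom:
  assumes R: "\<And>a. f a \<in> R"
  shows "omega q f a \<in> R" "h (omega q f a) = omega (h q) (\<lambda>a. h (f a)) a"
    and "omega_inv q f a \<in> R" "h (omega_inv q f a) = omega_inv (h q) (\<lambda>a. h (f a)) a"
  by (auto simp: omega_def omega_inv_def R Rmult Rpowi hmult hpowi q)

lemma foldr_hom:
  assumes "\<And>j f a. j \<in> set ks \<Longrightarrow> lp n f \<Longrightarrow> (\<And>a. f a \<in> R) \<Longrightarrow> B j f a \<in> R \<and> h (B j f a) = B' j (\<lambda>a. h (f a)) a"
    and "\<And>j f. j \<in> set ks \<Longrightarrow> lp n f \<Longrightarrow> lp n (B j f)" and f: "lp n f" and R: "\<And>a. f a \<in> R"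
  shows "lp n (foldr B ks f) \<and> (\<forall>a. foldr B ks f a \<in> R) \<and>
    (\<lambda>a. h (foldr B ks f a)) = foldr B' ks (\<lambda>a. h (f a))"
  using assms(1,2)
proof (induction ks)
  case (Cons k ks)
  then have "lp n (foldr B ks f) \<and> (\<forall>a. foldr B ks f a \<in> R) \<and>
    (\<lambda>a. h (foldr B ks f a)) = foldr B' ks (\<lambda>a. h (f a))" by auto
  then show ?case using Cons.prems by simp
qed (use f R in auto)

lemma Yop_hom:
  assumes i: "i < n" and q0: "q \<noteq> 0" and f: "lp n f" and R: "\<And>a. f a \<in> R"
  shows "Yop n s q i f a \<in> R" "h (Yop n s q i f a) = Yop n (h s) (h q) i (\<lambda>a. h (f a)) a"
proof -
  have 1: "lp n (foldr (Tinv n s) [0..<i] f) \<and> (\<forall>a. foldr (Tinv n s) [0..<i] f a \<in> R) \<and>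
    (\<lambda>a. h (foldr (Tinv n s) [0..<i] f a)) = foldr (Tinv n (h s)) [0..<i] (\<lambda>a. h (f a))"
    by (rule foldr_hom) (use i f R Tinv_hom in auto)
  let ?g = "omega q (foldr (Tinv n s) [0..<i] f)"
  have g: "lp n ?g" using 1 i q0 by simp
  have gR: "?g a \<in> R" for a using 1 omega_hom by blast
  have 2: "lp n (foldr (Top n s) [i..<n-1] ?g) \<and> (\<forall>a. foldr (Top n s) [i..<n-1] ?g a \<in> R) \<and>
    (\<lambda>a. h (foldr (Top n s) [i..<n-1] ?g a)) = foldr (Top n (h s)) [i..<n-1] (\<lambda>a. h (?g a))"
    by (rule foldr_hom) (use g gR Top_hom in auto)
  have 3: "(\<lambda>a. h (?g a)) = omega (h q) (foldr (Tinv n (h s)) [0..<i] (\<lambda>a. h (f a)))"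
    using 1 omega_hom(2)[of "foldr (Tinv n s) [0..<i] f"] by auto
  show "Yop n s q i f a \<in> R" "h (Yop n s q i f a) = Yop n (h s) (h q) i (\<lambda>a. h (f a)) a"
    unfolding Yop_def using 2 3 by (auto simp: fun_eq_iff)
qed

lemma Yinv_hom:
  assumes i: "i < n" and q0: "q \<noteq> 0" and f: "lp n f" and R: "\<And>a. f a \<in> R"
  shows "Yinv n s q i f a \<in> R"
proof -
  let ?ks = "rev [i..<n-1]" and ?ls = "rev [0..<i]"
  have 1: "lp n (foldr (Tinv n s) ?ks f) \<and> (\<forall>a. foldr (Tinv n s) ?ks f a \<in> R) \<and>
    (\<lambda>a. h (foldr (Tinv n s) ?ks f a)) = foldr (Tinv n (h s)) ?ks (\<lambda>a. h (f a))"
    by (rule foldr_hom) (use i f R Tinv_hom in auto)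
  let ?g = "omega_inv q (foldr (Tinv n s) ?ks f)"
  have g: "lp n ?g" using 1 i q0 by simp
  have gR: "?g a \<in> R" for a using 1 omega_hom by blast
  have "lp n (foldr (Top n s) ?ls ?g) \<and> (\<forall>a. foldr (Top n s) ?ls ?g a \<in> R) \<and>
    (\<lambda>a. h (foldr (Top n s) ?ls ?g a)) = foldr (Top n (h s)) ?ls (\<lambda>a. h (?g a))"
    by (rule foldr_hom) (use g gR Top_hom i in auto)
  then show ?thesis unfolding Yinv_def by blast
qed

end

end

section \<open>Nonsymmetric Macdonald polynomials\<close>

lemma prec_maximal:
  assumes "finite D" "D \<noteq> {}"
  obtains m where "m \<in> D" "\<And>x. x \<in> D \<Longrightarrow> \<not> prec m x"
proof -
  have "\<exists>m\<in>D. \<forall>x\<in>D. x \<noteq> m \<longrightarrow> \<not> prec m x"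
    by (rule Finite_Set.bex_max_element[OF assms(1)])
      (use assms prec_trans prec_irrefl in \<open>auto simp: asymp_on_def transp_on_def, blast+\<close>)
  then show thesis using that prec_irrefl by metis
qed

lemma rho2_bound:
  assumes "i < length a"
  obtains c where "rho2 a i = int (length a) - 1 - 2 * int c" "c < length a"
proof
  let ?A = "{j. j < length a \<and> (a ! j > a ! i \<or> (a ! j = a ! i \<and> j < i))}"
  have "card ?A < card {..<length a}" by (rule psubset_card_mono) (use assms in auto)
  then show "card ?A < length a" by simp
qed (simp add: rho2_def)

lemma lp_mono_lp: "length a = n \<Longrightarrow> lp n (lp_mono a c)"
  by (rule lpI[of "{a}"]) (auto simp: lp_mono_def split: if_splits)

context daha
begin

lemma Y_diff: "i < n \<Longrightarrow> lp n f \<Longrightarrow> lp n g \<Longrightarrow> Y i (\<lambda>a. f a - g a) = (\<lambda>a. Y i f a - Y i g a)"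
  using Y_add[of i f "\<lambda>a. (-1) * g a"] Y_scale[of i g "-1"] lp_scale[of n g "-1"] by simp

text \<open>For \<open>D = {mu. prec mu lam}\<close> such an operator sends the monomial of exponent \<open>lam\<close> to \<open>E lam\<close>.\<close>
definition annih where
  "annih lam R D A \<longleftrightarrow> (\<forall>f. lp n f \<longrightarrow> lp n (A f)) \<and>
    (\<forall>i f. i < n \<longrightarrow> lp n f \<longrightarrow> A (\<lambda>a. Y i f a - ev lam i * f a) = (\<lambda>a. Y i (A f) a - ev lam i * A f a)) \<and>
    (\<forall>f. lp n f \<longrightarrow> (\<forall>nu. f nu \<noteq> 0 \<longrightarrow> nu \<in> D) \<longrightarrow> A f = (\<lambda>a. 0)) \<and>
    (\<forall>f. lp n f \<longrightarrow> (\<forall>nu. f nu \<noteq> 0 \<longrightarrow> nu = lam \<or> prec nu lam) \<longrightarrow>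
      (\<forall>nu. A f nu \<noteq> 0 \<longrightarrow> nu = lam \<or> prec nu lam) \<and> A f lam = f lam) \<and>
    (\<forall>f. lp n f \<longrightarrow> (\<forall>a. f a \<in> R) \<longrightarrow> (\<forall>a. A f a \<in> R))"

lemma annihD:
  assumes "annih lam R D A" "lp n f"
  shows "lp n (A f)"
    and "i < n \<Longrightarrow> A (\<lambda>a. Y i f a - ev lam i * f a) = (\<lambda>a. Y i (A f) a - ev lam i * A f a)"
    and "(\<And>nu. f nu \<noteq> 0 \<Longrightarrow> nu \<in> D) \<Longrightarrow> A f = (\<lambda>a. 0)"
    and "\<forall>nu. f nu \<noteq> 0 \<longrightarrow> nu = lam \<or> prec nu lam \<Longrightarrow> A f nu \<noteq> 0 \<Longrightarrow> nu = lam \<or> prec nu lam"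
    and "\<forall>nu. f nu \<noteq> 0 \<longrightarrow> nu = lam \<or> prec nu lam \<Longrightarrow> A f lam = f lam"
    and "\<forall>a. f a \<in> R \<Longrightarrow> A f a \<in> R"
  using assms unfolding annih_def by blast+

text \<open>The factor belonging to a maximal \<open>mu\<close> in \<open>D\<close> is applied
  first: by triangularity it removes the coefficient at \<open>mu\<close> and creates nothing
  outside \<open>D\<close>, and \<open>D - {mu}\<close> is again closed downwards. Division by the
  eigenvalue differences preserves the coefficient at \<open>lam\<close> and stays in
  \<open>R\<close> by \<open>sep\<close>.\<close>

lemma kill_below:
  assumes lam: "length lam = n" and D: "finite D" "D \<subseteq> {mu. prec mu lam}"
    and down: "\<And>mu nu. mu \<in> D \<Longrightarrow> prec nu mu \<Longrightarrow> nu \<in> D"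
    and R: "coeff_hom R (\<lambda>x. x)" "s \<in> R" "inverse s \<in> R" "q \<in> R" "inverse q \<in> R"
    and sep: "\<And>mu. prec mu lam \<Longrightarrow> \<exists>i<n. ev lam i \<noteq> ev mu i \<and> inverse (ev lam i - ev mu i) \<in> R"
  shows "\<exists>A. annih lam R D A"
  using D down
proof (induction "card D" arbitrary: D)
  case 0
  then have "D = {}" by simp
  then have "annih lam R D (\<lambda>f. f)" unfolding annih_def by auto
  then show ?case by blast
next
  case (Suc m)
  then have "D \<noteq> {}" by auto
  then obtain mu where mu: "mu \<in> D" "\<And>x. x \<in> D \<Longrightarrow> \<not> prec mu x" using prec_maximal[OF Suc.prems(1)] by blast
  obtain i where i: "i < n" "ev lam i \<noteq> ev mu i" "inverse (ev lam i - ev mu i) \<in> R"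
    using sep[of mu] mu Suc.prems by blast
  define c where "c = inverse (ev lam i - ev mu i)"
  have c: "c * (ev lam i - ev mu i) = 1" using i by (simp add: c_def)
  have "\<exists>A. annih lam R (D - {mu}) A"
  proof (rule Suc.hyps(1))
    show "m = card (D - {mu})" using Suc mu by simp
    fix mu' nu assume "mu' \<in> D - {mu}" "prec nu mu'"
    then show "nu \<in> D - {mu}" using Suc.prems(3) mu(2) by blast
  qed (use Suc.prems in auto)
  then obtain A where A: "annih lam R (D - {mu}) A" by blast
  define G where "G = (\<lambda>f a. c * (Y i f a - ev mu i * f a))"
  have G1: "lp n (G f)" if "lp n f" for f
    unfolding G_def using that i by (intro lp_scale lp_diff Y_lp)
  have G2: "G (\<lambda>a. Y j f a - ev lam j * f a) = (\<lambda>a. Y j (G f) a - ev lam j * G f a)" if "j < n" "lp n f" for j f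
    unfolding G_def using that i
    by (simp add: Y_diff Y_scale lp_scale lp_diff Y_comm[of j i]) (simp add: algebra_simps)
  have mulen: "length mu = n" using mu Suc.prems lam prec_length by fastforce
  have Gv: "G f nu = c * (ev nu i - ev mu i) * f nu" if "lp n f" "length nu = n" "\<And>rho. prec nu rho \<Longrightarrow> f rho = 0" for f nu
  proof -
    have "Y i f nu = ev nu i * f nu" by (rule Y_triangular[OF i(1) that(1,2)]) (rule that(3))
    then show ?thesis by (simp add: G_def algebra_simps)
  qed
  have G0: "G f nu = 0" if "lp n f" "length nu \<noteq> n" for f nu
    using lp_zero[OF G1] that by blast
  have G3: "G f nu \<noteq> 0 \<Longrightarrow> nu \<in> D - {mu}" if f: "lp n f" and s: "\<forall>nu. f nu \<noteq> 0 \<longrightarrow> nu \<in> D" for f nu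
  proof (rule ccontr)
    assume nz: "G f nu \<noteq> 0" and nu: "nu \<notin> D - {mu}"
    have l: "length nu = n" using nz G0[OF f] by blast
    have "f rho = 0" if "prec nu rho" for rho
    proof (rule ccontr)
      assume "f rho \<noteq> 0"
      then have "rho \<in> D" using s by blast
      then have "nu \<in> D" using that Suc.prems(3) by blast
      then show False using nu mu(2) \<open>rho \<in> D\<close> that by blast
    qed
    then have "G f nu = c * (ev nu i - ev mu i) * f nu" using Gv[OF f l] by blast
    then show False using nz nu s by auto
  qed
  have G4: "(\<forall>nu. G f nu \<noteq> 0 \<longrightarrow> nu = lam \<or> prec nu lam) \<and> G f lam = f lam"
    if f: "lp n f" and s: "\<forall>nu. f nu \<noteq> 0 \<longrightarrow> nu = lam \<or> prec nu lam" for f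
  proof (intro conjI allI impI)
    fix nu assume nz: "G f nu \<noteq> 0"
    show "nu = lam \<or> prec nu lam"
    proof (rule ccontr)
      assume nu: "\<not> (nu = lam \<or> prec nu lam)"
      have l: "length nu = n" using nz G0[OF f] by blast
      have "f rho = 0" if "prec nu rho" for rho using s nu that prec_trans by blast
      then have "G f nu = c * (ev nu i - ev mu i) * f nu" using Gv[OF f l] by blast
      then show False using nz nu s by auto
    qed
  next
    have "f rho = 0" if "prec lam rho" for rho using s that prec_trans prec_irrefl by blast
    then have "G f lam = c * (ev lam i - ev mu i) * f lam" using Gv[OF f lam] by blast
    then show "G f lam = f lam" using c by simp
  qed
  have G5: "\<forall>a. G f a \<in> R" if f: "lp n f" and fR: "\<forall>a. f a \<in> R" for f
  proof -
    interpret coeff_hom R "\<lambda>x. x" by fact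
    have "ev mu i \<in> R" unfolding ev_def by (intro Rmult Rpowi R)
    moreover have "Y i f a \<in> R" for a using Yop_hom(1)[OF R(2-5) i(1) q0 f] fR by blast
    ultimately show ?thesis unfolding G_def c_def using i fR by (auto intro!: Rmult Rdiff)
  qed
  have "annih lam R D (\<lambda>f. A (G f))" unfolding annih_def
  proof (intro conjI allI impI)
    fix j and f :: "'a lpoly" assume "j < n" "lp n f"
    then show "A (G (\<lambda>a. Y j f a - ev lam j * f a)) = (\<lambda>a. Y j (A (G f)) a - ev lam j * A (G f) a)"
      by (simp add: G2 annihD(2)[OF A G1])
  next
    fix f :: "'a lpoly" assume f: "lp n f" "\<forall>nu. f nu \<noteq> 0 \<longrightarrow> nu \<in> D"
    show "A (G f) = (\<lambda>a. 0)" by (rule annihD(3)[OF A G1[OF f(1)]]) (rule G3[OF f])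
  next
    fix f :: "'a lpoly" and nu assume f: "lp n f" "\<forall>nu. f nu \<noteq> 0 \<longrightarrow> nu = lam \<or> prec nu lam" and nz: "A (G f) nu \<noteq> 0"
    show "nu = lam \<or> prec nu lam" by (rule annihD(4)[OF A G1[OF f(1)] _ nz]) (use G4[OF f] in blast)
  next
    fix f :: "'a lpoly" assume f: "lp n f" "\<forall>nu. f nu \<noteq> 0 \<longrightarrow> nu = lam \<or> prec nu lam"
    have "A (G f) lam = G f lam" by (rule annihD(5)[OF A G1[OF f(1)]]) (use G4[OF f] in blast)
    then show "A (G f) lam = f lam" using G4[OF f] by simp
  next
    fix f :: "'a lpoly" and a assume f: "lp n f" "\<forall>a. f a \<in> R"
    show "A (G f) a \<in> R" by (rule annihD(6)[OF A G1[OF f(1)] G5[OF f]])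
  qed (simp add: annihD(1)[OF A] G1)
  then show ?case by blast
qed

text \<open>The support of (Y_i - ev lam i) x^lam lies strictly below \<open>lam\<close>, so the
  annihilator kills it; commuting with Y_i - ev lam i, it sends x^lam to an eigenfunction.\<close>

lemma E_exists:
  assumes lam: "length lam = n"
    and R: "coeff_hom R (\<lambda>x. x)" "s \<in> R" "inverse s \<in> R" "q \<in> R" "inverse q \<in> R"
    and sep: "\<And>mu. prec mu lam \<Longrightarrow> \<exists>i<n. ev lam i \<noteq> ev mu i \<and> inverse (ev lam i - ev mu i) \<in> R"
  shows "\<exists>f. wt f (ev lam) \<and> f lam = 1 \<and> (\<forall>mu. f mu \<noteq> 0 \<longrightarrow> mu = lam \<or> prec mu lam) \<and> (\<forall>a. f a \<in> R)"
proof -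
  let ?D = "{mu. prec mu lam}"
  have "\<exists>A. annih lam R ?D A"
  proof (rule kill_below[where R = R])
    fix mu nu assume "mu \<in> ?D" "prec nu mu"
    then show "nu \<in> ?D" using prec_trans by blast
  qed (use lam finite_prec R sep in blast)+
  then obtain A where A: "annih lam R ?D A" by blast
  let ?m = "lp_mono lam (1::'a)"
  have m: "lp n ?m" using lam by (rule lp_mono_lp)
  have ms: "\<forall>nu. ?m nu \<noteq> 0 \<longrightarrow> nu = lam \<or> prec nu lam" by (simp add: lp_mono_def)
  have "Y i (A ?m) = (\<lambda>a. ev lam i * A ?m a)" if i: "i < n" for i
  proof -
    let ?g = "\<lambda>a. Y i ?m a - ev lam i * ?m a"
    have g: "lp n ?g" using i m by (intro lp_diff lp_scale Y_lp)
    have "?g nu = 0" if nu: "\<not> prec nu lam" for nu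
    proof (cases "length nu = n")
      case True
      have "?m rho = 0" if "prec nu rho" for rho using nu that by (auto simp: lp_mono_def)
      then show ?thesis using Y_triangular[OF i m True] by (auto simp: lp_mono_def)
    qed (use lp_zero[OF g] in blast)
    then have "A ?g = (\<lambda>a. 0)" by (intro annihD(3)[OF A g]) blast
    then show ?thesis unfolding annihD(2)[OF A m i] by (simp add: fun_eq_iff)
  qed
  then have "wt (A ?m) (ev lam)" unfolding wt_def using annihD(1)[OF A m] by blast
  moreover have "A ?m lam = 1" using annihD(5)[OF A m ms] by (simp add: lp_mono_def)
  moreover have mR: "\<forall>a. ?m a \<in> R"
    using coeff_hom.R0[OF R(1)] coeff_hom.R1[OF R(1)] by (simp add: lp_mono_def)
  ultimately show ?thesis using annihD(4)[OF A m ms] annihD(6)[OF A m mR] by blast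
qed

lemma wt_diff: "wt f w \<Longrightarrow> wt g w \<Longrightarrow> wt (\<lambda>a. f a - g a) w"
  unfolding wt_def by (auto simp: lp_diff Y_diff algebra_simps)

lemma wt_scale: "wt f w \<Longrightarrow> wt (\<lambda>a. c * f a) w"
  unfolding wt_def by (auto simp: lp_scale Y_scale algebra_simps)

text \<open>At an exponent maximal in the support, triangularity leaves no choice for the
  eigenvalues.\<close>

lemma wt_top:
  assumes f: "wt f w" and a: "f a \<noteq> 0"
  shows "\<exists>mu. f mu \<noteq> 0 \<and> length mu = n \<and> (\<forall>i<n. w i = ev mu i) \<and> (a = mu \<or> prec a mu)"
proof -
  have l: "lp n f" using f by (rule wt_lp)
  let ?D = "{mu. f mu \<noteq> 0 \<and> (a = mu \<or> prec a mu)}"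
  have "finite ?D" by (rule finite_subset[OF _ lp_fin[OF l]]) auto
  moreover have "?D \<noteq> {}" using a by auto
  ultimately obtain mu where mu: "mu \<in> ?D" "\<And>x. x \<in> ?D \<Longrightarrow> \<not> prec mu x" using prec_maximal by blast
  have z: "f nu = 0" if "prec mu nu" for nu using mu that prec_trans by blast
  have len: "length mu = n" using mu l lp_len by blast
  have "w i = ev mu i" if i: "i < n" for i
  proof -
    have "w i * f mu = ev mu i * f mu" using Y_triangular[OF i l len z] f i by (simp add: wt_def)
    then show ?thesis using mu by simp
  qed
  then show ?thesis using mu len by blast
qed

end

text \<open>Two entries of rho differ by an integer of absolute value at most n - 1, so excluding
  these relations makes the spectral vectors of distinct exponents distinct.\<close>

locale daha_simple = daha +
  assumes star: "\<And>h m. \<bar>h\<bar> < int n \<Longrightarrow> s powi (2 * h) * q powi m = 1 \<Longrightarrow> h = 0 \<and> m = 0"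
begin

lemma ev_nonzero [simp]: "ev a i \<noteq> 0"
  using s0 q0 by (simp add: ev_def)

lemma ev_eqD:
  assumes "length a = n" "length b = n" "i < n" "j < n" "ev a i = ev b j"
  shows "rho2 a i = rho2 b j \<and> a ! i = b ! j"
proof -
  obtain c where c: "rho2 a i = int n - 1 - 2 * int c" "c < n" using rho2_bound[of i a] assms by metis
  obtain d where d: "rho2 b j = int n - 1 - 2 * int d" "d < n" using rho2_bound[of j b] assms by metis
  have "s powi (rho2 a i - rho2 b j) * q powi (a ! i - b ! j) = ev a i / ev b j"
    using s0 q0 by (simp add: ev_def power_int_diff)
  also have "\<dots> = 1" using assms by simp
  also have "rho2 a i - rho2 b j = 2 * (int d - int c)" using c d by simp
  finally have "int d - int c = 0 \<and> a ! i - b ! j = 0" using c d by (intro star) auto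
  then show ?thesis using c d by simp
qed

lemma ev_inj: "length a = n \<Longrightarrow> length b = n \<Longrightarrow> (\<And>i. i < n \<Longrightarrow> ev a i = ev b i) \<Longrightarrow> a = b"
proof (rule nth_equalityI)
  fix i assume "length a = n" "length b = n" "\<And>i. i < n \<Longrightarrow> ev a i = ev b i" "i < length a"
  then show "a ! i = b ! i" using ev_eqD[of a b i i] by simp
qed simp

abbreviation E where "E \<equiv> Emac n s q"

text \<open>A nonzero difference would have a maximal exponent with the eigenvalues of
  \<open>lam\<close>; by simplicity this is \<open>lam\<close> itself, where the difference is
  zero.\<close>

lemma wt_unique':
  assumes "wt f (ev lam)" "wt g (ev lam)" "f lam = g lam" "length lam = n"
  shows "f = g"
proof (rule ccontr)
  assume "f \<noteq> g"
  then obtain a where a: "f a - g a \<noteq> 0" by (auto simp: fun_eq_iff)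
  from wt_top[OF wt_diff[OF assms(1,2)] a]
  obtain mu where mu: "f mu - g mu \<noteq> 0" "length mu = n" "\<forall>i<n. ev lam i = ev mu i" by blast
  then have "lam = mu" using ev_inj assms(4) by metis
  then show False using mu assms(3) by simp
qed

lemma E_eqI:
  assumes "length lam = n" "wt f (ev lam)" "f lam = 1"
    "\<forall>mu. f mu \<noteq> 0 \<longrightarrow> mu = lam \<or> prec mu lam"
  shows "E lam = f"
  unfolding Emac_def
proof (rule the_equality)
  show "lp n f \<and> f lam = 1 \<and> (\<forall>mu. f mu \<noteq> 0 \<longrightarrow> mu = lam \<or> prec mu lam) \<and>
    (\<forall>i<n. Y i f = (\<lambda>a. s powi rho2 lam i * q powi (lam ! i) * f a))"
    using assms by (simp add: wt_def ev_def)
  fix g assume "lp n g \<and> g lam = 1 \<and> (\<forall>mu. g mu \<noteq> 0 \<longrightarrow> mu = lam \<or> prec mu lam) \<and>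
    (\<forall>i<n. Y i g = (\<lambda>a. s powi rho2 lam i * q powi (lam ! i) * g a))"
  then have "wt g (ev lam)" "g lam = f lam" using assms by (simp_all add: wt_def ev_def)
  then show "g = f" using assms wt_unique' by blast
qed

lemma E_wt: "length lam = n \<Longrightarrow> wt (E lam) (ev lam)"
  and E_one: "length lam = n \<Longrightarrow> E lam lam = 1"
  and E_supp: "length lam = n \<Longrightarrow> E lam mu \<noteq> 0 \<Longrightarrow> mu = lam \<or> prec mu lam"
proof -
  have "\<exists>f. wt f (ev lam) \<and> f lam = 1 \<and> (\<forall>mu. f mu \<noteq> 0 \<longrightarrow> mu = lam \<or> prec mu lam) \<and> (\<forall>a. f a \<in> UNIV)"
    if l: "length lam = n"
  proof (rule E_exists[OF l])
    show "coeff_hom UNIV (\<lambda>x::'a. x)" by unfold_locales auto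
    fix mu assume p: "prec mu lam"
    then have "lam \<noteq> mu" "length mu = n" using l prec_length by auto
    then show "\<exists>i<n. ev lam i \<noteq> ev mu i \<and> inverse (ev lam i - ev mu i) \<in> UNIV" using ev_inj l by blast
  qed auto
  then show "length lam = n \<Longrightarrow> wt (E lam) (ev lam)" "length lam = n \<Longrightarrow> E lam lam = 1"
    "length lam = n \<Longrightarrow> E lam mu \<noteq> 0 \<Longrightarrow> mu = lam \<or> prec mu lam"
    using E_eqI by blast+
qed

lemma E_lp [simp]: "length lam = n \<Longrightarrow> lp n (E lam)"
  using E_wt wt_lp by blast

lemma wt_unique: "length lam = n \<Longrightarrow> wt f (ev lam) \<Longrightarrow> f = (\<lambda>a. f lam * E lam a)"
  by (rule wt_unique'[of f lam "\<lambda>a. f lam * E lam a"]) (simp_all add: wt_scale E_wt E_one)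

lemma wt_spectrum:
  assumes "wt f w" "f \<noteq> (\<lambda>a. 0)"
  obtains mu where "length mu = n" "\<And>i. i < n \<Longrightarrow> w i = ev mu i"
  using wt_top[OF assms(1)] assms(2) by (auto simp: fun_eq_iff)

text \<open>Leading terms are subtracted at maximal exponents, inside the finite downward closure of
  the support.\<close>

lemma E_expansion:
  assumes K: "coeff_hom K (\<lambda>x. x)" and EK: "\<And>mu a. length mu = n \<Longrightarrow> E mu a \<in> K"
    and f: "lp n f" "\<And>a. f a \<in> K"
  obtains D c where "finite D" "\<And>mu. mu \<in> D \<Longrightarrow> length mu = n" "\<And>mu. c mu \<in> K"
    "f = (\<lambda>a. \<Sum>mu\<in>D. c mu * E mu a)"
proof -
  interpret K: coeff_hom K "\<lambda>x. x" by fact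
  have "\<exists>c. (\<forall>mu. c mu \<in> K) \<and> f = (\<lambda>a. \<Sum>mu\<in>D. c mu * E mu a)"
    if "finite D" "\<And>mu. mu \<in> D \<Longrightarrow> length mu = n" "\<And>mu nu. mu \<in> D \<Longrightarrow> prec nu mu \<Longrightarrow> nu \<in> D"
      "\<And>a. f a \<in> K" "\<And>mu. f mu \<noteq> 0 \<Longrightarrow> mu \<in> D" for D and f :: "'a lpoly"
    using that
  proof (induction "card D" arbitrary: D f)
    case 0
    then have "f = (\<lambda>a. 0)" by (auto simp: fun_eq_iff)
    then show ?case using 0 K.R0 by (intro exI[of _ "\<lambda>_. 0"]) auto
  next
    case (Suc m)
    then have "D \<noteq> {}" by auto
    then obtain mu where mu: "mu \<in> D" "\<And>x. x \<in> D \<Longrightarrow> \<not> prec mu x"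
      using prec_maximal[OF Suc.prems(1)] by blast
    have len: "length mu = n" using mu Suc.prems by blast
    define g where "g = (\<lambda>a. f a - f mu * E mu a)"
    have "\<exists>c. (\<forall>mu. c mu \<in> K) \<and> g = (\<lambda>a. \<Sum>mu\<in>D - {mu}. c mu * E mu a)"
    proof (rule Suc.hyps(1))
      show "m = card (D - {mu})" using Suc mu by simp
      fix nu show "g nu \<in> K" unfolding g_def using Suc.prems(4) EK len by (intro K.Rdiff K.Rmult) auto
      assume nz: "g nu \<noteq> 0"
      then have "nu \<noteq> mu" using E_one[OF len] by (auto simp: g_def)
      moreover have "f nu \<noteq> 0 \<or> E mu nu \<noteq> 0" using nz by (auto simp: g_def)
      then have "nu \<in> D" using E_supp[OF len, of nu] Suc.prems(3,5) mu(1) by blast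
      ultimately show "nu \<in> D - {mu}" by blast
    qed (use Suc.prems mu in blast)+
    then obtain c where c: "\<And>mu. c mu \<in> K" "g = (\<lambda>a. \<Sum>mu\<in>D - {mu}. c mu * E mu a)" by blast
    let ?c = "c(mu := f mu)"
    have fe: "f a = (\<Sum>mu\<in>D. ?c mu * E mu a)" for a
    proof -
      have "f a = f mu * E mu a + g a" by (simp add: g_def)
      also have "g a = (\<Sum>mu\<in>D - {mu}. ?c mu * E mu a)" unfolding c(2) by (intro sum.cong) auto
      finally show ?thesis using sum.remove[OF Suc.prems(1) mu(1), of "\<lambda>mu. ?c mu * E mu a"] by simp
    qed
    have "\<forall>nu. ?c nu \<in> K" using c(1) Suc.prems(4) by simp
    moreover have "f = (\<lambda>a. \<Sum>mu\<in>D. ?c mu * E mu a)" by (rule ext) (rule fe)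
    ultimately show ?case by blast
  qed
  note * = this
  let ?D = "{mu. f mu \<noteq> 0} \<union> (\<Union>nu\<in>{mu. f mu \<noteq> 0}. {mu. prec mu nu})"
  have "finite ?D" using f(1) finite_prec by (auto simp: lp_fin)
  moreover have "length mu = n" if mu: "mu \<in> ?D" for mu
  proof -
    obtain nu where nu: "f nu \<noteq> 0" "mu = nu \<or> prec mu nu" using mu by auto
    then show ?thesis using lp_len[OF f(1) nu(1)] prec_length[of mu nu] by auto
  qed
  moreover have "nu \<in> ?D" if mu: "mu \<in> ?D" and p: "prec nu mu" for mu nu
  proof -
    obtain rho where "f rho \<noteq> 0" "mu = rho \<or> prec mu rho" using mu by auto
    then have "f rho \<noteq> 0" "prec nu rho" using p prec_trans by auto
    then show ?thesis by auto
  qed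
  ultimately have "\<exists>c. (\<forall>mu. c mu \<in> K) \<and> f = (\<lambda>a. \<Sum>mu\<in>?D. c mu * E mu a)"
    by (intro *) (use f(2) in auto)
  then obtain c where "\<And>mu. c mu \<in> K" "f = (\<lambda>a. \<Sum>mu\<in>?D. c mu * E mu a)" by blast
  then show thesis using that \<open>finite ?D\<close> \<open>\<And>mu. mu \<in> ?D \<Longrightarrow> length mu = n\<close> by blast
qed

end

section \<open>Combinatorics of the index set\<close>

definition beats :: "int list \<Rightarrow> nat \<Rightarrow> nat \<Rightarrow> bool" where
  "beats a j i \<longleftrightarrow> a ! j > a ! i \<or> (a ! j = a ! i \<and> j < i)"

text \<open>Counted from 0 at the largest entry, so that rho_i = (n - 1)/2 - rank.\<close>

definition rank :: "int list \<Rightarrow> nat \<Rightarrow> nat" where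
  "rank a i = card {j. j < length a \<and> beats a j i}"

lemma rho2_rank: "rho2 a i = int (length a) - 1 - 2 * int (rank a i)"
  by (simp add: rho2_def rank_def beats_def)

lemma beats_trans: "beats a i j \<Longrightarrow> beats a j k \<Longrightarrow> beats a i k"
  and beats_irrefl [simp]: "\<not> beats a i i"
  and beats_total: "i \<noteq> j \<Longrightarrow> beats a i j \<or> beats a j i"
  by (auto simp: beats_def)

lemma rank_less:
  assumes "beats a j i" "j < length a" shows "rank a j < rank a i"
  unfolding rank_def
proof (rule psubset_card_mono)
  have "j \<in> {l. l < length a \<and> beats a l i}" "j \<notin> {l. l < length a \<and> beats a l j}" using assms by auto
  moreover have "{l. l < length a \<and> beats a l j} \<subseteq> {l. l < length a \<and> beats a l i}"
    using beats_trans[OF _ assms(1)] by blast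
  ultimately show "{l. l < length a \<and> beats a l j} \<subset> {l. l < length a \<and> beats a l i}" by blast
qed simp

lemma rank_less_iff:
  assumes "i < length a" "j < length a"
  shows "rank a j < rank a i \<longleftrightarrow> beats a j i"
proof (cases "i = j")
  case False
  then show ?thesis using rank_less[of a j i] rank_less[of a i j] beats_total[of i j a] assms by auto
qed simp

lemma rank_inj: "i < length a \<Longrightarrow> j < length a \<Longrightarrow> rank a i = rank a j \<Longrightarrow> i = j"
  using rank_less[of a j i] rank_less[of a i j] beats_total[of i j a] by auto

lemma rank_bound:
  assumes "i < length a" shows "rank a i < length a"
proof -
  have "card {j. j < length a \<and> beats a j i} < card {..<length a}"
  proof (rule psubset_card_mono)
    have "i \<in> {..<length a}" "i \<notin> {j. j < length a \<and> beats a j i}" using assms by auto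
    then show "{j. j < length a \<and> beats a j i} \<subset> {..<length a}" by blast
  qed simp
  then show ?thesis by (simp add: rank_def)
qed

lemma rank_bij: "bij_betw (rank a) {..<length a} {..<length a}"
proof -
  have inj: "inj_on (rank a) {..<length a}" by (rule inj_onI) (simp add: rank_inj)
  have "rank a ` {..<length a} \<subseteq> {..<length a}" using rank_bound by blast
  then show ?thesis unfolding bij_betw_def using inj endo_inj_surj[of "{..<length a}" "rank a"] by blast
qed

lemma rank_reindex:
  assumes "bij_betw p {..<n} {..<n}" "length a = n" "length b = n"
    and "\<And>j. j < n \<Longrightarrow> beats b j i \<longleftrightarrow> beats a (p j) (p i)"
  shows "rank b i = rank a (p i)"
proof -
  have "inj_on p {j. j < n \<and> beats b j i}"
    by (rule inj_on_subset[OF bij_betw_imp_inj_on[OF assms(1)]]) auto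
  moreover have "p ` {j. j < n \<and> beats b j i} = {j. j < n \<and> beats a j (p i)}"
  proof (intro equalityI subsetI)
    fix j assume j: "j \<in> {j. j < n \<and> beats a j (p i)}"
    then have "j \<in> p ` {..<n}" using assms(1) by (simp add: bij_betw_def)
    then obtain m where "m < n" "j = p m" by blast
    then show "j \<in> p ` {j. j < n \<and> beats b j i}" using j assms(4) by auto
  qed (use assms bij_betwE[OF assms(1)] in auto)
  ultimately show ?thesis unfolding rank_def assms(2,3) using card_image by metis
qed

section \<open>Exchange of neighbours and affine rotation of exponents\<close>

definition tsw :: "nat \<Rightarrow> nat \<Rightarrow> nat" where
  "tsw i j = (if j = i then Suc i else if j = Suc i then i else j)"

text \<open>The exponent to which \<open>Ph\<close> raises \<open>a\<close>, see
  \<open>Ph_link\<close>.\<close>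

definition rotp :: "int list \<Rightarrow> int list" where
  "rotp a = tl a @ [hd a + 1]"

definition rsh :: "nat \<Rightarrow> nat \<Rightarrow> nat" where
  "rsh n j = (if Suc j < n then Suc j else 0)"

lemma length_rotp: "length a = n \<Longrightarrow> n > 0 \<Longrightarrow> length (rotp a) = n"
  by (simp add: rotp_def)

lemma nth_rotp: "length a = n \<Longrightarrow> j < n \<Longrightarrow> rotp a ! j = (if Suc j < n then a ! Suc j else a ! 0 + 1)"
  by (cases a) (auto simp: rotp_def nth_append)

lemma nth_lsw_tsw: "Suc i < length a \<Longrightarrow> j < length a \<Longrightarrow> lsw i a ! j = a ! tsw i j"
  by (simp add: nth_lsw tsw_def)

lemma tsw_bij: "Suc i < n \<Longrightarrow> bij_betw (tsw i) {..<n} {..<n}"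
  by (rule bij_betw_byWitness[where f' = "tsw i"]) (auto simp: tsw_def)

lemma rsh_bij: "n > 0 \<Longrightarrow> bij_betw (rsh n) {..<n} {..<n}"
  by (rule bij_betw_byWitness[where f' = "\<lambda>j. if j = 0 then n - 1 else j - 1"]) (auto simp: rsh_def)

lemma rank_lsw:
  assumes "length a = n" "Suc i < n" "j < n" "a ! i \<noteq> a ! Suc i"
  shows "rank (lsw i a) j = rank a (tsw i j)"
proof (rule rank_reindex[OF tsw_bij[OF assms(2)] assms(1)])
  fix l assume "l < n"
  then show "beats (lsw i a) l j \<longleftrightarrow> beats a (tsw i l) (tsw i j)"
    using assms unfolding beats_def
    by (subst (1 2 3 4) nth_lsw_tsw) (auto simp: tsw_def split: if_splits)
qed (use assms in simp)

lemma rank_rotp: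
  assumes "length a = n" "j < n"
  shows "rank (rotp a) j = rank a (rsh n j)"
proof (rule rank_reindex[OF rsh_bij assms(1)])
  show "n > 0" using assms by simp
  then show "length (rotp a) = n" by (rule length_rotp[OF assms(1)])
  fix l assume "l < n"
  then show "beats (rotp a) l j \<longleftrightarrow> beats a (rsh n l) (rsh n j)"
    using assms unfolding beats_def
    by (subst (1 2 3 4) nth_rotp[of _ n]) (auto simp: rsh_def)
qed

definition alc :: "nat \<Rightarrow> nat \<Rightarrow> int list set" where
  "alc n r = {a. length a = n \<and> (\<forall>i<n. \<forall>j<n. a ! i - a ! j \<le> int r - 1 \<and>
     (a ! i - a ! j = int r - 1 \<longrightarrow> j < i))}"

lemma alcD:
  assumes "a \<in> alc n r"
  shows "length a = n" and "i < n \<Longrightarrow> j < n \<Longrightarrow> a ! i - a ! j \<le> int r - 1"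
    and "i < n \<Longrightarrow> j < n \<Longrightarrow> a ! i - a ! j = int r - 1 \<Longrightarrow> j < i"
  using assms by (auto simp: alc_def)

text \<open>A neighborhood of type (n, r - 1) can only join the positions of ranks 0 and n - 1, that
  is the extreme entries, and their inequality implies the one for every other pair. The symmetric
  form is easily transported along exchanges and rotations.\<close>

lemma Sset_eq_alc:
  assumes n: "n \<ge> 2"
  shows "Sset n (n - 1) r = alc n r"
proof (intro equalityI subsetI)
  fix a assume "a \<in> Sset n (n - 1) r"
  then obtain i j where l: "length a = n" and nb: "nbhd a (int (n - 1) + 1) (int r - 1) i j"
    by (auto simp: Sset_def)
  then have ij: "i < n" "j < n" "rho2 a i - rho2 a j = 2 * (int n - 1)"
    "a ! i - a ! j \<le> int r - 1 - 1 \<or> (a ! i - a ! j = int r - 1 \<and> j < i)"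
    using n by (auto simp: nbhd_def)
  have rk: "rank a i = 0" "rank a j = n - 1"
    using ij rank_bound[of j a] l n by (auto simp: rho2_rank)
  have mx: "p = i \<or> beats a i p" if "p < n" for p
    using rank_less_iff[of i a p] beats_total[of i p a] rk that l ij by auto
  have mn: "p = j \<or> beats a p j" if "p < n" for p
    using rank_less_iff[of p a j] beats_total[of p j a] rank_bound[of p a] rk that l ij by auto
  have "a ! p - a ! m \<le> int r - 1 \<and> (a ! p - a ! m = int r - 1 \<longrightarrow> m < p)" if "p < n" "m < n" for p m
    using mx[OF that(1)] mn[OF that(2)] ij(4) unfolding beats_def by auto
  then show "a \<in> alc n r" using l by (simp add: alc_def)
next
  fix a assume a: "a \<in> alc n r"
  then have l: "length a = n" by (rule alcD)
  have "0 \<in> rank a ` {..<n}" "n - 1 \<in> rank a ` {..<n}"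
    using rank_bij[of a] l n by (auto simp: bij_betw_def)
  then obtain i j where ij: "i < n" "rank a i = 0" "j < n" "rank a j = n - 1" by auto
  have "nbhd a (int (n - 1) + 1) (int r - 1) i j"
    using ij l n alcD(2)[OF a, of i j] alcD(3)[OF a, of i j] by (auto simp: nbhd_def rho2_rank)
  then show "a \<in> Sset n (n - 1) r" using l by (auto simp: Sset_def)
qed

text \<open>Of two entries at distance r - 1 the larger has to stand on the right; moving a larger
  entry to the right respects this.\<close>

lemma alc_lsw:
  assumes a: "a \<in> alc n r" and r: "r \<ge> 2" and i: "Suc i < n" and gt: "a ! i > a ! Suc i"
  shows "lsw i a \<in> alc n r"
proof -
  note l = alcD(1)[OF a]
  have "lsw i a ! p - lsw i a ! m \<le> int r - 1 \<and> (lsw i a ! p - lsw i a ! m = int r - 1 \<longrightarrow> m < p)"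
    if "p < n" "m < n" for p m
    using alcD(2,3)[OF a, of "tsw i p" "tsw i m"] that i l gt r
    by (auto simp: nth_lsw_tsw) (auto simp: tsw_def split: if_splits)
  then show ?thesis using l by (simp add: alc_def)
qed

lemma alc_rotp_iff:
  assumes l: "length a = n" and n: "n > 0" and r: "r \<ge> 2"
  shows "rotp a \<in> alc n r \<longleftrightarrow> a \<in> alc n r"
proof -
  let ?Q = "\<lambda>a p m. a ! p - a ! m \<le> int r - 1 \<and> (a ! p - a ! m = int r - 1 \<longrightarrow> m < p)"
  have step: "?Q (rotp a) p m \<longleftrightarrow> ?Q a (rsh n p) (rsh n m)" if "p < n" "m < n" for p m
    using that l r by (auto simp: nth_rotp rsh_def)
  have "(\<forall>p<n. \<forall>m<n. ?Q (rotp a) p m) \<longleftrightarrow> (\<forall>p<n. \<forall>m<n. ?Q a (rsh n p) (rsh n m))"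
    using step by blast
  also have "\<dots> \<longleftrightarrow> (\<forall>p\<in>rsh n ` {..<n}. \<forall>m\<in>rsh n ` {..<n}. ?Q a p m)" by auto
  also have "rsh n ` {..<n} = {..<n}" using rsh_bij[OF n] by (simp add: bij_betw_def)
  finally show ?thesis using l n length_rotp by (auto simp: alc_def)
qed

text \<open>Sorting by exchanges and lowering the last, largest entry connects every element of \<open>alc\<close>
  with a constant vector.\<close>
lemma alc_connected:
  assumes n: "n > 0" and r: "r \<ge> 2"
    and sw: "\<And>a i. a \<in> alc n r \<Longrightarrow> lsw i a \<in> alc n r \<Longrightarrow> Suc i < n \<Longrightarrow> a ! i > a ! Suc i \<Longrightarrow> P a \<longleftrightarrow> P (lsw i a)"
    and rot: "\<And>a. a \<in> alc n r \<Longrightarrow> rotp a \<in> alc n r \<Longrightarrow> P a \<longleftrightarrow> P (rotp a)"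
    and a: "a \<in> alc n r"
  shows "\<exists>c. P a \<longleftrightarrow> P (replicate n c)"
proof -
  obtain L where L: "\<And>i. i < n \<Longrightarrow> a ! i \<ge> L"
    using alcD(2)[OF a, of 0] n by (metis diff_le_eq add.commute diff_le_eq)
  \<comment> \<open>\<open>L\<close> is a floor that persists, because an entry is lowered only if
    it exceeds the first one. Lowering decreases \<open>M1\<close>; an exchange keeps
    \<open>M1\<close> and decreases \<open>M2\<close>, whose weights fall from left to
    right.\<close>
  define M1 where "M1 = (\<lambda>a. \<Sum>i<n. nat (a ! i - L))"
  define M2 where "M2 = (\<lambda>a. \<Sum>i<n. (n - i) * nat (a ! i - L))"
  have "wf (inv_image (less_than <*lex*> less_than) (\<lambda>a. (M1 a, M2 a)))"
    by (intro wf_inv_image wf_lex_prod wf_less_than)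
  then show ?thesis using a L
  proof (induction a rule: wf_induct_rule)
    case (less a)
    note l = alcD(1)[OF less.prems(1)]
    show ?case
    proof (cases "\<exists>i. Suc i < n \<and> a ! i > a ! Suc i")
      case True
      then obtain i where i: "Suc i < n" "a ! i > a ! Suc i" by blast
      let ?b = "lsw i a"
      have b: "?b \<in> alc n r" by (rule alc_lsw) (use less i r in auto)
      have bn: "?b ! j = a ! tsw i j" if "j < n" for j using i l that by (simp add: nth_lsw_tsw)
      have inj: "inj_on (tsw i) {..<n}" and im: "tsw i ` {..<n} = {..<n}"
        using tsw_bij[OF i(1)] by (auto simp: bij_betw_def)
      have "M1 ?b = (\<Sum>j\<in>tsw i ` {..<n}. nat (a ! j - L))"
        unfolding M1_def sum.reindex[OF inj] by (intro sum.cong) (auto simp: bn)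
      then have m1: "M1 ?b = M1 a" by (simp add: im M1_def)
      have split: "(\<Sum>j<n. g j) = g i + g (Suc i) + (\<Sum>j\<in>{..<n} - {i, Suc i}. g j)" for g :: "nat \<Rightarrow> nat"
      proof -
        have "{..<n} = insert i (insert (Suc i) ({..<n} - {i, Suc i}))" using i by auto
        then have "(\<Sum>j<n. g j) = (\<Sum>j\<in>insert i (insert (Suc i) ({..<n} - {i, Suc i})). g j)" by simp
        then show ?thesis by simp
      qed
      have rest: "(\<Sum>j\<in>{..<n} - {i, Suc i}. (n - j) * nat (?b ! j - L))
          = (\<Sum>j\<in>{..<n} - {i, Suc i}. (n - j) * nat (a ! j - L))"
        by (intro sum.cong) (auto simp: bn tsw_def)
      have "(n - i) * nat (a ! Suc i - L) + (n - Suc i) * nat (a ! i - L)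
          < (n - i) * nat (a ! i - L) + (n - Suc i) * nat (a ! Suc i - L)"
      proof -
        have e: "n - i = Suc (n - Suc i)" using i by simp
        have "nat (a ! Suc i - L) < nat (a ! i - L)" using less.prems(2)[of "Suc i"] i by simp
        then show ?thesis unfolding e by simp
      qed
      then have "M2 ?b < M2 a"
        unfolding M2_def split[of "\<lambda>j. (n - j) * nat (?b ! j - L)"] split[of "\<lambda>j. (n - j) * nat (a ! j - L)"] rest
        using i l by (simp add: nth_lsw)
      moreover have "?b ! j \<ge> L" if "j < n" for j
        using less.prems(2) bn[OF that] bij_betwE[OF tsw_bij[OF i(1)]] that by simp
      ultimately obtain c where "P ?b \<longleftrightarrow> P (replicate n c)"
        using less.IH[of ?b] b m1 by auto
      then show ?thesis using sw[OF less.prems(1) b i] by auto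
    next
      case False
      have srt: "sorted a" unfolding sorted_iff_nth_Suc
      proof (intro allI impI)
        fix i assume "Suc i < length a"
        then show "a ! i \<le> a ! Suc i" using False l by (meson not_less)
      qed
      then have mono: "a ! i \<le> a ! j" if "i \<le> j" "j < n" for i j using that l by (simp add: sorted_nth_mono)
      show ?thesis
      proof (cases "a ! 0 = a ! (n - 1)")
        case True
        have "a = replicate n (a ! 0)"
        proof (rule nth_equalityI)
          fix i assume "i < length a"
          then show "a ! i = replicate n (a ! 0) ! i"
            using mono[of 0 i] mono[of i "n - 1"] True l by simp
        qed (simp add: l)
        then show ?thesis by metis
      next
        case ne: False
        let ?b = "(last a - 1) # butlast a"
        have ane: "a \<noteq> []" using l n by auto
        have lb: "length ?b = n" using l n by simp
        have rb: "rotp ?b = a" using ane by (simp add: rotp_def)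
        have b: "?b \<in> alc n r" using alc_rotp_iff[OF lb n r] rb less.prems(1) by simp
        have gt: "last a > a ! 0" using ne mono[of 0 "n - 1"] n l ane by (simp add: last_conv_nth)
        have bL: "?b ! j \<ge> L" if "j < n" for j
          using that gt less.prems(2)[of 0] less.prems(2)[of "j - 1"] l n
          by (cases j) (auto simp: nth_butlast)
        obtain m where m: "n = Suc m" using n by (cases n) auto
        have "M1 ?b = nat (last a - 1 - L) + (\<Sum>j<m. nat (a ! j - L))"
          unfolding M1_def m sum.lessThan_Suc_shift using l m by (simp add: nth_butlast)
        moreover have "M1 a = nat (last a - L) + (\<Sum>j<m. nat (a ! j - L))"
          unfolding M1_def m sum.lessThan_Suc using l m ane by (simp add: last_conv_nth)
        moreover have "nat (last a - 1 - L) < nat (last a - L)" using gt less.prems(2)[of 0] n by simp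
        ultimately have "M1 ?b < M1 a" by simp
        then obtain c where "P ?b \<longleftrightarrow> P (replicate n c)" using less.IH[of ?b] b bL by auto
        then show ?thesis using rot[OF b] rb less.prems(1) by auto
      qed
    qed
  qed
qed

text \<open>\<open>wrap\<close> reads t^n q^(r-1) = 1. Together with \<open>star\<close> it accounts
  for all relations t^h q^m = 1 with |h| \<le> n, see \<open>star_wrap\<close>.\<close>

locale daha_spec = daha_simple +
  fixes r :: nat
  assumes r2: "r \<ge> 2" and wrap: "s powi (2 * int n) * q powi (int r - 1) = 1"
begin

lemma sq_mult: "(s powi a * q powi b) * (s powi c * q powi d) = s powi (a + c) * q powi (b + d)"
  and sq_divide: "(s powi a * q powi b) / (s powi c * q powi d) = s powi (a - c) * q powi (b - d)"
  using s0 q0 by (simp_all add: power_int_add power_int_diff mult_ac)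

lemma ev_rank: "length a = n \<Longrightarrow> ev a i = s powi (int n - 1 - 2 * int (rank a i)) * q powi (a ! i)"
  by (simp add: ev_def rho2_rank)

lemma ev_lsw: "length a = n \<Longrightarrow> Suc i < n \<Longrightarrow> j < n \<Longrightarrow> a ! i \<noteq> a ! Suc i \<Longrightarrow> ev (lsw i a) j = ev a (tsw i j)"
  by (simp add: ev_rank rank_lsw nth_lsw_tsw)

lemma ev_rotp: "length a = n \<Longrightarrow> j < n \<Longrightarrow> ev (rotp a) j = (if Suc j < n then ev a (Suc j) else q * ev a 0)"
  using q0 length_rotp[of a n]
  by (auto simp: ev_rank rank_rotp nth_rotp[of a n] rsh_def power_int_add)

lemma ev_ne: "length a = n \<Longrightarrow> i < n \<Longrightarrow> j < n \<Longrightarrow> i \<noteq> j \<Longrightarrow> ev a i \<noteq> ev a j"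
  using ev_eqD[of a a i j] rank_inj[of i a j] by (auto simp: rho2_rank)

lemma star_wrap:
  assumes "\<bar>h\<bar> \<le> int n" "s powi (2 * h) * q powi m = 1"
  shows "(h = 0 \<and> m = 0) \<or> (h = int n \<and> m = int r - 1) \<or> (h = - int n \<and> m = - (int r - 1))"
proof -
  consider "\<bar>h\<bar> < int n" | "h = int n" | "h = - int n" using assms by linarith
  then show ?thesis
  proof cases
    case 1 then show ?thesis using star assms by blast
  next
    case 2
    have "s powi (2 * 0) * q powi (m - (int r - 1))
      = (s powi (2 * h) * q powi m) / (s powi (2 * int n) * q powi (int r - 1))"
      using s0 q0 2 by (simp add: power_int_diff)
    then have "m - (int r - 1) = 0" using star[of 0 "m - (int r - 1)"] n2 assms wrap by simp
    then show ?thesis using 2 by simp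
  next
    case 3
    have "s powi (2 * 0) * q powi (m + (int r - 1))
      = (s powi (2 * h) * q powi m) * (s powi (2 * int n) * q powi (int r - 1))"
      using s0 q0 3 by (simp add: power_int_add power_int_minus)
    then have "m + (int r - 1) = 0" using star[of 0 "m + (int r - 1)"] n2 assms wrap by simp
    then show ?thesis using 3 by simp
  qed
qed

lemma ev_ratio:
  assumes "length a = n" "i < n" "j < n" "ev a i = s powi (2 * k) * ev a j"
  shows "s powi (2 * (int (rank a j) - int (rank a i) - k)) * q powi (a ! i - a ! j) = 1"
proof -
  have e: "2 * (int (rank a j) - int (rank a i) - k)
      = (int n - 1 - 2 * int (rank a i)) - (2 * k + (int n - 1 - 2 * int (rank a j)))" by simp
  have "s powi (2 * k) * ev a j = s powi (2 * k + (int n - 1 - 2 * int (rank a j))) * q powi (a ! j)"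
    unfolding ev_rank[OF assms(1)] using s0 by (simp only: power_int_add mult.assoc simp_thms)
  then have "s powi (2 * (int (rank a j) - int (rank a i) - k)) * q powi (a ! i - a ! j)
      = ev a i / (s powi (2 * k) * ev a j)"
    unfolding e sq_divide[symmetric] ev_rank[OF assms(1), of i] by simp
  then show ?thesis using assms(4) s0 by simp
qed

text \<open>The entries differ by a positive amount, so a ratio t or t^-1 of the eigenvalues could
  only come from the wrap relation. Ranks below n exclude the ratio t; the ratio t^-1 would require
  a difference r - 1 with the larger entry on the left, which \<open>alc\<close> forbids.\<close>

lemma alc_edge:
  assumes a: "a \<in> alc n r" and i: "Suc i < n" and gt: "a ! i > a ! Suc i"
  shows "ev a i \<noteq> s\<^sup>2 * ev a (Suc i)" "s\<^sup>2 * ev a i \<noteq> ev a (Suc i)"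
proof -
  note l = alcD(1)[OF a]
  have rk: "rank a i < n" "rank a (Suc i) < n" using rank_bound[of _ a] l i by auto
  show "ev a i \<noteq> s\<^sup>2 * ev a (Suc i)"
  proof
    assume "ev a i = s\<^sup>2 * ev a (Suc i)"
    then have "s powi (2 * (int (rank a (Suc i)) - int (rank a i) - 1)) * q powi (a ! i - a ! Suc i) = 1"
      using ev_ratio[of a i "Suc i" 1] l i by simp
    moreover have "\<bar>int (rank a (Suc i)) - int (rank a i) - 1\<bar> \<le> int n" using rk by linarith
    ultimately show False using star_wrap rk gt r2 by fastforce
  qed
  show "s\<^sup>2 * ev a i \<noteq> ev a (Suc i)"
  proof
    assume "s\<^sup>2 * ev a i = ev a (Suc i)"
    then have "ev a i = s powi (2 * (- 1)) * ev a (Suc i)"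
      using s0 by (simp add: power_int_minus field_simps)
    then have "s powi (2 * (int (rank a (Suc i)) - int (rank a i) - (- 1))) * q powi (a ! i - a ! Suc i) = 1"
      using ev_ratio[of a i "Suc i" "- 1"] l i by simp
    moreover have "\<bar>int (rank a (Suc i)) - int (rank a i) - (- 1)\<bar> \<le> int n" using rk by linarith
    ultimately have "a ! i - a ! Suc i = int r - 1" using star_wrap rk gt r2 by fastforce
    then show False using alcD(3)[OF a, of i "Suc i"] i by simp
  qed
qed

text \<open>Equal neighbours have consecutive ranks. If the exchange leaves \<open>alc\<close>, the
  right entry exceeds the left one by r - 1, their ranks are 0 and n - 1, and the wrap relation
  turns t^(n-1) q^(r-1) into t^-1.\<close>

lemma alc_block:
  assumes a: "a \<in> alc n r" and i: "Suc i < n" and blk: "a ! i = a ! Suc i \<or> lsw i a \<notin> alc n r"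
  shows "ev a i = s\<^sup>2 * ev a (Suc i)"
proof (cases "a ! i = a ! Suc i")
  case True
  note l = alcD(1)[OF a]
  have "{j. j < length a \<and> beats a j (Suc i)} = insert i {j. j < length a \<and> beats a j i}"
    using True i l by (auto simp: beats_def less_Suc_eq)
  then have "rank a (Suc i) = Suc (rank a i)" by (simp add: rank_def)
  then have e: "int n - 1 - 2 * int (rank a i) = (int n - 1 - 2 * int (rank a (Suc i))) + 2" by simp
  have "s powi ((int n - 1 - 2 * int (rank a (Suc i))) + 2)
      = s powi (int n - 1 - 2 * int (rank a (Suc i))) * s powi 2"
    by (rule power_int_add) (use s0 in simp)
  then show ?thesis unfolding ev_rank[OF l] e True by simp
next
  case False
  note l = alcD(1)[OF a]
  have lt: "a ! i < a ! Suc i" using False blk alc_lsw[OF a r2 i] by linarith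
  have d: "a ! Suc i - a ! i = int r - 1"
  proof (rule ccontr)
    assume nd: "a ! Suc i - a ! i \<noteq> int r - 1"
    have "lsw i a ! p - lsw i a ! m \<le> int r - 1 \<and> (lsw i a ! p - lsw i a ! m = int r - 1 \<longrightarrow> m < p)"
      if "p < n" "m < n" for p m
      using alcD(2,3)[OF a, of "tsw i p" "tsw i m"] alcD(2)[OF a, of "Suc i" i] that i l lt nd
      by (auto simp: nth_lsw_tsw) (auto simp: tsw_def split: if_splits)
    then have "lsw i a \<in> alc n r" using l by (simp add: alc_def)
    then show False using blk False by simp
  qed
  have "{j. j < length a \<and> beats a j (Suc i)} = {}"
  proof (intro equals0I)
    fix p assume p: "p \<in> {j. j < length a \<and> beats a j (Suc i)}"
    then have pn: "p < n" using l by simp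
    have "a ! p - a ! i \<le> int r - 1" using alcD(2)[OF a pn, of i] i by simp
    then have e: "a ! p = a ! Suc i" "p < Suc i" using p d by (auto simp: beats_def)
    then have "i < p" using alcD(3)[OF a pn, of i] d i by simp
    then show False using e by simp
  qed
  then have r1: "rank a (Suc i) = 0" by (simp add: rank_def)
  have "{j. j < length a \<and> beats a j i} = {..<n} - {i}"
  proof (intro equalityI subsetI)
    fix p assume p: "p \<in> {..<n} - {i}"
    have le: "a ! Suc i - a ! p \<le> int r - 1" using alcD(2)[OF a i, of p] p by simp
    have "p < i" if "a ! p = a ! i" using alcD(3)[OF a i, of p] d p that by simp
    then have "beats a p i" using le d by (auto simp: beats_def)
    then show "p \<in> {j. j < length a \<and> beats a j i}" using p l by simp
  qed (use l in auto)
  then have r2: "rank a i = n - 1" using i by (simp add: rank_def)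
  have "ev a i = s powi (- (int n - 1)) * q powi (a ! i)"
    unfolding ev_rank[OF l] r2 using i by (simp add: of_nat_diff)
  also have "\<dots> = (s powi (- (int n - 1)) * q powi (a ! i)) * (s powi (2 * int n) * q powi (int r - 1))"
    using wrap by simp
  also have "\<dots> = s powi (- (int n - 1) + 2 * int n) * q powi (a ! i + (int r - 1))"
    by (rule sq_mult)
  also have "\<dots> = s powi (2 + (int n - 1)) * q powi (a ! Suc i)"
    using d by (intro arg_cong2[of _ _ _ _ "\<lambda>x y. s powi x * q powi y"]) auto
  also have "s powi (2 + (int n - 1)) = s\<^sup>2 * s powi (int n - 1)"
    using power_int_add[of s 2 "int n - 1"] s0 unfolding power_int_numeral by blast
  also have "s\<^sup>2 * s powi (int n - 1) * q powi (a ! Suc i) = s\<^sup>2 * ev a (Suc i)"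
    unfolding ev_rank[OF l, of "Suc i"] r1 of_nat_0 mult_zero_right diff_zero mult.assoc ..
  finally show ?thesis .
qed

end

section \<open>The points of the variety\<close>

text \<open>\<open>K\<close> stands for the field of specialized values, which may be smaller than
  the ambient field.\<close>

locale daha_field = daha_spec +
  fixes K :: "'a set"
  assumes Khom: "coeff_hom K (\<lambda>x. x)" and Kinv: "\<And>x. x \<in> K \<Longrightarrow> inverse x \<in> K"
    and sK: "s \<in> K" and qK: "q \<in> K"
begin

sublocale KK: coeff_hom K "\<lambda>x. x" by (rule Khom)

lemma Kdivide: "x \<in> K \<Longrightarrow> y \<in> K \<Longrightarrow> x / y \<in> K"
  by (simp add: divide_inverse KK.Rmult Kinv)

lemma K_powi: "x \<in> K \<Longrightarrow> x powi m \<in> K"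
  by (simp add: KK.Rpowi Kinv)

lemma evK: "ev a i \<in> K"
  unfolding ev_def by (intro KK.Rmult K_powi sK qK)

definition chain_idx where
  "chain_idx z idx ss \<longleftrightarrow> length idx = n \<and> distinct idx \<and> set idx \<subseteq> {..<n} \<and>
     length ss = n - 1 \<and> sum_list ss \<le> r - 2 \<and>
     (\<forall>a<n - 1. z ! (idx ! (a + 1)) = z ! (idx ! a) * s\<^sup>2 * q ^ (ss ! a) \<and>
       (ss ! a = 0 \<longrightarrow> idx ! a < idx ! (a + 1)))"

definition Zg :: "'a list set" where
  "Zg = {z. length z = n \<and> (\<forall>i<n. z ! i \<in> K \<and> z ! i \<noteq> 0) \<and> (\<exists>idx ss. chain_idx z idx ss)}"

definition zp where "zp a c = map (\<lambda>i. c / ev a i) [0..<n]"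

lemma length_zp [simp]: "length (zp a c) = n"
  and nth_zp [simp]: "i < n \<Longrightarrow> zp a c ! i = c / ev a i"
  by (simp_all add: zp_def)

lemma zp_nonzero: "c \<noteq> 0 \<Longrightarrow> 0 \<notin> set (zp a c)"
  by (auto simp: zp_def)

text \<open>Along the chain z_(idx m) = z_(idx 0) t^m q^(A m), so an exponent with entry -A m and
  rank m at position idx m has inverse eigenvalues proportional to z. The demand on indices at zero
  steps is exactly the tie rule that makes the rank equal to m.\<close>

lemma chain_to_alc:
  assumes z: "z \<in> Zg"
  shows "\<exists>a\<in>alc n r. \<exists>c\<in>K. c \<noteq> 0 \<and> z = zp a c"
proof -
  obtain idx ss where ch: "chain_idx z idx ss" using z by (auto simp: Zg_def)
  then have li: "length idx = n" and di: "distinct idx" and si: "set idx \<subseteq> {..<n}"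
    and ls: "length ss = n - 1" and sm: "sum_list ss \<le> r - 2"
    and st: "\<And>a. a < n - 1 \<Longrightarrow> z ! (idx ! Suc a) = z ! (idx ! a) * s\<^sup>2 * q ^ (ss ! a)"
    and ord: "\<And>a. a < n - 1 \<Longrightarrow> ss ! a = 0 \<Longrightarrow> idx ! a < idx ! Suc a"
    unfolding chain_idx_def by auto
  have lz: "length z = n" and zK: "\<And>i. i < n \<Longrightarrow> z ! i \<in> K \<and> z ! i \<noteq> 0" using z by (auto simp: Zg_def)
  have idxn: "idx ! m < n" if "m < n" for m using si li that by (metis lessThan_iff nth_mem subset_iff)
  have inj: "idx ! m = idx ! p \<longleftrightarrow> m = p" if "m < n" "p < n" for m p
    using di li that by (simp add: nth_eq_iff_index_eq)
  have im: "(!) idx ` {..<n} = {..<n}"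
    by (rule endo_inj_surj) (use idxn inj in \<open>auto simp: inj_on_def\<close>)
  have "\<exists>m<n. idx ! m = i" if "i < n" for i using im that by (metis imageE lessThan_iff)
  then obtain pos where pos: "\<And>i. i < n \<Longrightarrow> pos i < n \<and> idx ! pos i = i" by metis
  have pos_idx: "pos (idx ! m) = m" if "m < n" for m using pos[OF idxn[OF that]] inj that by blast
  define A where "A m = (\<Sum>l<m. ss ! l)" for m
  have A_mono: "A m \<le> A p" if "m \<le> p" for m p
    unfolding A_def by (rule sum_mono2) (use that in auto)
  have A_top: "A m \<le> r - 2" if "m < n" for m
  proof -
    have "A m \<le> A (n - 1)" using that by (intro A_mono) simp
    also have "A (n - 1) = sum_list ss" unfolding A_def ls[symmetric] by (simp add: sum_list_sum_nth atLeast0LessThan)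
    finally show ?thesis using sm by simp
  qed
  have A_eq: "idx ! m < idx ! p" if "m < p" "p < n" "A m = A p" for m p
    using that
  proof (induction p)
    case (Suc p)
    have s0: "ss ! p = 0" and e: "A p = A m"
      using A_mono[of m p] Suc.prems by (auto simp: A_def)
    have lt: "idx ! p < idx ! Suc p" using ord[of p] s0 Suc.prems by simp
    show ?case
    proof (cases "m = p")
      case False
      then have "idx ! m < idx ! p" using Suc e by simp
      then show ?thesis using lt by simp
    qed (use lt in simp)
  qed simp
  define a where "a = map (\<lambda>i. - int (A (pos i))) [0..<n]"
  have la: "length a = n" by (simp add: a_def)
  have an: "a ! (idx ! m) = - int (A m)" if "m < n" for m using that idxn pos_idx by (simp add: a_def)
  have rk: "rank a (idx ! m) = m" if m: "m < n" for m
  proof -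
    have b: "beats a (idx ! p) (idx ! m) \<longleftrightarrow> p < m" if "p < n" for p
      using A_mono[of p m] A_mono[of m p] A_eq[of p m] A_eq[of m p] that m
      by (auto simp: beats_def an) (metis le_antisym less_asym linorder_neqE_nat nat_less_le)+
    have "{j. j < length a \<and> beats a j (idx ! m)} = (!) idx ` {..<m}"
    proof (intro equalityI subsetI)
      fix j assume j: "j \<in> {j. j < length a \<and> beats a j (idx ! m)}"
      then have "j < n" "idx ! pos j = j" "pos j < n" using pos[of j] la by auto
      then show "j \<in> (!) idx ` {..<m}" using b[of "pos j"] j by (metis (mono_tags, lifting) imageI lessThan_iff mem_Collect_eq)
    qed (use b m idxn la in auto)
    moreover have "inj_on ((!) idx) {..<m}" using inj m by (auto simp: inj_on_def)
    ultimately show ?thesis by (simp add: rank_def card_image)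
  qed
  have aA: "a \<in> alc n r"
  proof -
    have "a ! i - a ! j \<le> int r - 2" if "i < n" "j < n" for i j
      using A_top[of "pos j"] pos[OF that(2)] that r2 by (simp add: a_def)
    then show ?thesis using la unfolding alc_def by fastforce
  qed
  \<comment> \<open>Compensates the eigenvalue s^(n-1) at the position of rank 0, where the entry is
    0.\<close>
  define c where "c = z ! (idx ! 0) * s powi (int n - 1)"
  have zm: "z ! (idx ! m) = z ! (idx ! 0) * s ^ (2 * m) * q ^ A m" if "m < n" for m
    using that
  proof (induction m)
    case (Suc m)
    then have "z ! (idx ! Suc m) = z ! (idx ! 0) * s ^ (2 * m) * q ^ A m * s\<^sup>2 * q ^ (ss ! m)"
      using st[of m] by simp
    also have "q ^ A (Suc m) = q ^ A m * q ^ (ss ! m)" by (simp add: A_def power_add)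
    ultimately show ?case by (simp add: power2_eq_square mult_ac)
  qed (simp add: A_def)
  have "z = zp a c"
  proof (rule nth_equalityI)
    fix i assume "i < length z"
    then have i: "i < n" using lz by simp
    define m where "m = pos i"
    have m: "m < n" "idx ! m = i" using pos[OF i] by (auto simp: m_def)
    have "ev a i = s powi (int n - 1 - int (2 * m)) * q powi (- int (A m))"
      using rk[OF m(1)] an[OF m(1)] m la by (simp add: ev_rank)
    also have "\<dots> = s powi (int n - 1) / s ^ (2 * m) / q ^ A m"
    proof -
      have "s powi (int n - 1 - int (2 * m)) = s powi (int n - 1) / s ^ (2 * m)"
        using power_int_diff[of s "int n - 1" "int (2 * m)"] s0 unfolding power_int_of_nat by blast
      then show ?thesis by (simp add: power_int_minus divide_inverse)
    qed
    finally show "z ! i = zp a c ! i"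
      using zm[OF m(1)] m s0 q0 i by (simp add: c_def field_simps)
  qed (simp add: lz)
  moreover have "c \<in> K" "c \<noteq> 0"
    using zK[OF idxn[of 0]] n0 s0 sK unfolding c_def by (auto intro!: KK.Rmult K_powi)
  ultimately show ?thesis using aA by blast
qed

text \<open>List the positions by rank. The steps are the successive differences of the entries,
  which telescope to the spread, and a zero step is a tie, broken by position.\<close>

lemma zp_chain:
  assumes la: "length a = n" and sp: "\<And>i j. i < n \<Longrightarrow> j < n \<Longrightarrow> a ! i - a ! j \<le> int r - 2"
    and c: "c \<in> K" "c \<noteq> 0"
  shows "zp a c \<in> Zg"
proof -
  have "\<exists>i<n. rank a i = m" if "m < n" for m
    using rank_bij[of a] la that unfolding bij_betw_def by (metis imageE lessThan_iff)
  then obtain ix where ix: "\<And>m. m < n \<Longrightarrow> ix m < n \<and> rank a (ix m) = m" by metis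
  define idx where "idx = map ix [0..<n]"
  define ss where "ss = map (\<lambda>m. nat (a ! ix m - a ! ix (Suc m))) [0..<n - 1]"
  have bt: "beats a (ix m) (ix (Suc m))" if "m < n - 1" for m
    using rank_less_iff[of "ix (Suc m)" a "ix m"] ix[of m] ix[of "Suc m"] that la by simp
  then have ge: "a ! ix m \<ge> a ! ix (Suc m)" if "m < n - 1" for m using that by (force simp: beats_def)
  have "int (sum_list ss) = (\<Sum>m<n - 1. a ! ix m - a ! ix (Suc m))"
    using ge by (simp add: ss_def sum_list_sum_nth atLeast0LessThan)
  also have "\<dots> = a ! ix 0 - a ! ix (n - 1)" by (rule sum_lessThan_telescope')
  also have "\<dots> \<le> int r - 2" using ix[of 0] ix[of "n - 1"] n0 by (intro sp) auto
  finally have sm: "sum_list ss \<le> r - 2" using r2 by simp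
  have "chain_idx (zp a c) idx ss"
    unfolding chain_idx_def
  proof (intro conjI allI impI)
    show "distinct idx" unfolding idx_def distinct_map using ix by (auto intro!: inj_onI) metis
    show "set idx \<subseteq> {..<n}" using ix by (auto simp: idx_def)
    fix m assume m: "m < n - 1"
    have e: "ev a (ix m) = ev a (ix (m + 1)) * (s\<^sup>2 * q ^ (ss ! m))"
    proof -
      have "ev a (ix m) = s powi ((int n - 1 - 2 * int (m + 1)) + 2) * q powi (a ! ix (m + 1) + int (ss ! m))"
      proof -
        have e1: "(int n - 1 - 2 * int (m + 1)) + 2 = int n - 1 - 2 * int m" by simp
        show ?thesis unfolding e1 using ix[of m] m la ge[OF m] by (simp add: ev_rank ss_def)
      qed
      also have "\<dots> = (s powi (int n - 1 - 2 * int (m + 1)) * q powi (a ! ix (m + 1))) * (s powi 2 * q powi (int (ss ! m)))"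
        by (rule sq_mult[symmetric])
      also have "s powi (int n - 1 - 2 * int (m + 1)) * q powi (a ! ix (m + 1)) = ev a (ix (m + 1))"
        using ix[of "m + 1"] m la by (simp add: ev_rank)
      finally show ?thesis by simp
    qed
    show "zp a c ! (idx ! (m + 1)) = zp a c ! (idx ! m) * s\<^sup>2 * q ^ (ss ! m)"
      using ix[of m] ix[of "m + 1"] m s0 q0 by (simp add: idx_def e)
    assume "ss ! m = 0"
    then have "a ! ix m = a ! ix (Suc m)" using m ge[OF m] by (simp add: ss_def)
    then show "idx ! m < idx ! (m + 1)" using bt[OF m] m by (simp add: idx_def beats_def)
  qed (use sm in \<open>simp_all add: idx_def ss_def\<close>)
  then show ?thesis unfolding Zg_def using c by (auto intro: Kdivide evK)
qed

text \<open>An element of \<open>alc\<close> of maximal spread defines the same points as the vector obtained by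
  lowering all its maximal entries by \<open>r - 1\<close>.\<close>
lemma alc_to_chain:
  assumes a: "a \<in> alc n r" and c: "c \<in> K" "c \<noteq> 0"
  shows "zp a c \<in> Zg"
proof (cases "\<exists>i j. i < n \<and> j < n \<and> a ! i - a ! j = int r - 1")
  case False
  note l = alcD(1)[OF a]
  have "a ! i - a ! j \<le> int r - 2" if "i < n" "j < n" for i j
    using alcD(2)[OF a that] False that by fastforce
  then show ?thesis using zp_chain l c by blast
next
  case True
  note l = alcD(1)[OF a]
  obtain p0 q0' where pq: "p0 < n" "q0' < n" "a ! p0 - a ! q0' = int r - 1" using True by blast
  define Mx mn where "Mx = a ! p0" and "mn = a ! q0'"
  have Mm: "Mx - mn = int r - 1" using pq by (simp add: Mx_def mn_def)
  have up: "a ! i \<le> Mx" and lo: "a ! i \<ge> mn" if "i < n" for i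
    using alcD(2)[OF a that pq(2)] alcD(2)[OF a pq(1) that] Mm by (auto simp: Mx_def mn_def)
  have sep: "j < i" if "i < n" "j < n" "a ! i = Mx" "a ! j = mn" for i j
    using alcD(3)[OF a that(1,2)] that Mm by simp
  \<comment> \<open>In \<open>alc\<close> the maximal entries stand to the right of the minimal
    ones, so after lowering they rank last. Their ranks grow by n - k, with k their number, and all
    other ranks drop by k.\<close>
  define b where "b = map (\<lambda>x. if x = Mx then mn else x) a"
  have lb: "length b = n" by (simp add: b_def l)
  have bn: "b ! i = (if a ! i = Mx then mn else a ! i)" if "i < n" for i using that l by (simp add: b_def)
  have mM: "mn < Mx" using Mm r2 by simp
  let ?MX = "{j. j < n \<and> a ! j = Mx}" and ?NM = "{j. j < n \<and> a ! j \<noteq> Mx}"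
  define k where "k = card ?MX"
  have kn: "card ?NM + k = n"
  proof -
    have "card (?NM \<union> ?MX) = card ?NM + card ?MX" by (rule card_Un_disjoint) auto
    moreover have "?NM \<union> ?MX = {..<n}" by auto
    ultimately show ?thesis by (simp add: k_def)
  qed
  have rk1: "rank a i = rank b i + k" if i: "i < n" "a ! i \<noteq> Mx" for i
  proof -
    have "{j. j < n \<and> beats a j i} = {j. j < n \<and> beats b j i} \<union> ?MX"
      using i up[of i] lo[of i] sep[of _ i] mM by (auto simp: beats_def bn split: if_splits)
    moreover have "{j. j < n \<and> beats b j i} \<inter> ?MX = {}"
      using i lo[of i] sep[of _ i] by (fastforce simp: beats_def bn)
    ultimately show ?thesis unfolding rank_def l lb k_def by (simp add: card_Un_disjoint)
  qed
  have rk2: "rank b i = rank a i + card ?NM" if i: "i < n" "a ! i = Mx" for i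
  proof -
    have "{j. j < n \<and> beats b j i} = {j. j < n \<and> beats a j i} \<union> ?NM"
    proof (intro equalityI subsetI)
      fix j assume "j \<in> {j. j < n \<and> beats a j i} \<union> ?NM"
      then show "j \<in> {j. j < n \<and> beats b j i}"
        using i up[of j] lo[of j] sep[OF i(1), of j] mM by (auto simp: beats_def bn)
    next
      fix j assume "j \<in> {j. j < n \<and> beats b j i}"
      then show "j \<in> {j. j < n \<and> beats a j i} \<union> ?NM"
        using i mM by (auto simp: beats_def bn split: if_splits)
    qed
    moreover have "{j. j < n \<and> beats a j i} \<inter> ?NM = {}"
      using i up by (fastforce simp: beats_def)
    ultimately show ?thesis unfolding rank_def l lb by (simp add: card_Un_disjoint)
  qed
  \<comment> \<open>Both rank changes amount to the same factor t^k, for the lowered entries by the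
    wrap relation; the factor is absorbed in the scalar of the point.\<close>
  have evb: "ev b i = s powi (2 * int k) * ev a i" if i: "i < n" for i
  proof (cases "a ! i = Mx")
    case False
    have e: "int n - 1 - 2 * int (rank b i) = 2 * int k + (int n - 1 - 2 * int (rank a i))"
      using rk1[OF i False] by simp
    show ?thesis unfolding ev_rank[OF lb] ev_rank[OF l] e using bn[OF i] False s0
      by (simp add: power_int_add mult.assoc)
  next
    case True
    have e: "2 * int k + (int n - 1 - 2 * int (rank a i)) = (int n - 1 - 2 * int (rank b i)) + 2 * int n"
      using rk2[OF i True] kn by simp
    have e': "a ! i = b ! i + (int r - 1)" using bn[OF i] True Mm by simp
    have "s powi (2 * int k) * ev a i = s powi (2 * int k + (int n - 1 - 2 * int (rank a i))) * q powi (a ! i)"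
      unfolding ev_rank[OF l] using s0 by (subst power_int_add) (auto simp: mult.assoc)
    also have "\<dots> = (s powi (int n - 1 - 2 * int (rank b i)) * q powi (b ! i)) * (s powi (2 * int n) * q powi (int r - 1))"
      unfolding e unfolding e' by (rule sq_mult[symmetric])
    finally show ?thesis using wrap by (simp add: ev_rank[OF lb])
  qed
  have "zp a c = zp b (c * s powi (2 * int k))"
    by (rule nth_equalityI) (use s0 evb in auto)
  moreover have "zp b (c * s powi (2 * int k)) \<in> Zg"
  proof (rule zp_chain[OF lb])
    fix i j assume ij: "i < n" "j < n"
    have "b ! i \<le> Mx - 1" using up[OF ij(1)] bn[OF ij(1)] mM by (auto split: if_splits)
    moreover have "b ! j \<ge> mn" using lo[OF ij(2)] bn[OF ij(2)] by (auto split: if_splits)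
    ultimately show "b ! i - b ! j \<le> int r - 2" using Mm by simp
  qed (use c s0 sK in \<open>auto intro!: KK.Rmult K_powi\<close>)
  ultimately show ?thesis by simp
qed

lemma Zg_eq: "Zg = {zp a c | a c. a \<in> alc n r \<and> c \<in> K \<and> c \<noteq> 0}"
  using chain_to_alc alc_to_chain by blast

lemma zp_lsw: "length a = n \<Longrightarrow> Suc i < n \<Longrightarrow> a ! i \<noteq> a ! Suc i \<Longrightarrow> zp (lsw i a) c = lsw i (zp a c)"
  by (rule nth_equalityI) (auto simp: ev_lsw nth_lsw tsw_def)

lemma zp_rotp: "length a = n \<Longrightarrow> zrot q (zp (rotp a) c) = zp a c"
  by (rule nth_equalityI) (use q0 in \<open>auto simp: nth_zrot ev_rotp\<close>)

section \<open>The vanishing ideal is a subrepresentation\<close>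

text \<open>In contrast to \<open>IK\<close>, coefficients outside \<open>K\<close> are allowed, so
  that linear combinations with arbitrary scalars can be formed.\<close>

definition van where "van f \<longleftrightarrow> lp n f \<and> (\<forall>z\<in>Zg. lp_eval n f z = 0)"

lemma van_iff: "van f \<longleftrightarrow> lp n f \<and> (\<forall>a\<in>alc n r. \<forall>c\<in>K. c \<noteq> 0 \<longrightarrow> lp_eval n f (zp a c) = 0)"
  unfolding van_def Zg_eq by blast

lemma van_lp: "van f \<Longrightarrow> lp n f" by (simp add: van_def)

lemma van_add: "van f \<Longrightarrow> van g \<Longrightarrow> van (\<lambda>a. f a + g a)"
  by (simp add: van_def lp_add eval_add)

lemma van_scale: "van f \<Longrightarrow> van (\<lambda>a. c * f a)"
  by (simp add: van_def lp_scale eval_scale)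

lemma van_diff: "van f \<Longrightarrow> van g \<Longrightarrow> van (\<lambda>a. f a - g a)"
  by (simp add: van_def lp_diff eval_diff)

lemma van_shift: "length b = n \<Longrightarrow> van f \<Longrightarrow> van (lp_shift n b f)"
  unfolding van_iff by (simp add: eval_shift zp_nonzero)

lemma ev_T_zp:
  assumes a: "a \<in> alc n r" and i: "Suc i < n" and f: "lp n f" and c: "c \<noteq> 0"
  shows "lp_eval n (T i f) (zp a c) = ca (zp a c ! i) (zp a c ! Suc i) * lp_eval n f (lsw i (zp a c))
    + cb (zp a c ! i) (zp a c ! Suc i) * lp_eval n f (zp a c)"
  by (rule ev_T[OF i f]) (use c i zp_nonzero ev_ne[of a i "Suc i"] alcD(1)[OF a] in auto)

lemma ca_zero_iff:
  assumes a: "a \<in> alc n r" and i: "Suc i < n" and c: "c \<noteq> 0"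
  shows "ca (zp a c ! i) (zp a c ! Suc i) = 0 \<longleftrightarrow> ev a i = s\<^sup>2 * ev a (Suc i)"
proof -
  have "zp a c ! i - zp a c ! Suc i \<noteq> 0" using ev_ne[of a i "Suc i"] alcD(1)[OF a] i c by auto
  then have "ca (zp a c ! i) (zp a c ! Suc i) = 0 \<longleftrightarrow> s * (c / ev a i) = inverse s * (c / ev a (Suc i))"
    using i by (simp add: ca_def)
  also have "\<dots> \<longleftrightarrow> ev a i = s\<^sup>2 * ev a (Suc i)"
    using c s0 by (auto simp: field_simps power2_eq_square)
  finally show ?thesis .
qed

text \<open>The value of T_i f at z involves f at z and at s_i z. Either s_i z is again a point of
  the variety, or its coefficient \<open>ca\<close> is zero by \<open>alc_block\<close>.\<close>

lemma van_T:
  assumes i: "Suc i < n" and f: "van f" shows "van (T i f)"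
proof -
  have "lp_eval n (T i f) (zp a c) = 0" if a: "a \<in> alc n r" and c: "c \<in> K" "c \<noteq> 0" for a c
  proof (cases "a ! i = a ! Suc i \<or> lsw i a \<notin> alc n r")
    case True
    then have "ca (zp a c ! i) (zp a c ! Suc i) = 0"
      using alc_block[OF a i] ca_zero_iff[OF a i] c by blast
    then show ?thesis using ev_T_zp[OF a i van_lp[OF f]] f a c by (simp add: van_iff)
  next
    case False
    then have "lp_eval n f (lsw i (zp a c)) = 0"
      using zp_lsw[of a i c] alcD(1)[OF a] i f c unfolding van_iff by metis
    then show ?thesis using ev_T_zp[OF a i van_lp[OF f]] f a c by (simp add: van_iff)
  qed
  then show ?thesis using f i by (simp add: van_iff)
qed

lemma van_U: "Suc i < n \<Longrightarrow> van f \<Longrightarrow> van (U i f)"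
  unfolding Tinv_def by (intro van_diff van_scale van_T)

lemma eval_om_zp: "length a = n \<Longrightarrow> lp n f \<Longrightarrow> c \<noteq> 0 \<Longrightarrow>
    lp_eval n (om f) (zp (rotp a) c) = lp_eval n f (zp a c)"
  using q0 by (simp add: eval_omega zp_nonzero zp_rotp)

lemma alc_rotp: "length a = n \<Longrightarrow> rotp a \<in> alc n r \<longleftrightarrow> a \<in> alc n r"
  by (rule alc_rotp_iff) (use r2 in auto)

lemma rotp_surj:
  assumes "length a = n" obtains b where "length b = n" "rotp b = a"
proof
  show "length ((last a - 1) # butlast a) = n" using assms by (simp add: n0 del: n0) (use n0 in linarith)
  show "rotp ((last a - 1) # butlast a) = a" using assms n0 by (cases a) (auto simp: rotp_def)
qed

lemma van_om: "van f \<Longrightarrow> van (om f)"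
proof -
  assume f: "van f"
  have "lp_eval n (om f) (zp a c) = 0" if a: "a \<in> alc n r" and c: "c \<in> K" "c \<noteq> 0" for a c
  proof -
    obtain b where b: "length b = n" "rotp b = a" using rotp_surj alcD(1)[OF a] by metis
    then show ?thesis using eval_om_zp[OF b(1) van_lp[OF f] c(2)] alc_rotp[OF b(1)] f a c
      by (simp add: van_iff)
  qed
  then show ?thesis using f by (simp add: van_iff)
qed

lemma van_omi: "van f \<Longrightarrow> van (omi f)"
proof -
  assume f: "van f"
  have "lp_eval n (omi f) (zp a c) = 0" if a: "a \<in> alc n r" and c: "c \<in> K" "c \<noteq> 0" for a c
    using eval_om_zp[OF alcD(1)[OF a] lp_omi[OF van_lp[OF f]] c(2)] alc_rotp[OF alcD(1)[OF a]] a f c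
    by (simp add: van_iff)
  then show ?thesis using f by (simp add: van_iff)
qed

lemma foldr_pres: "(\<And>j f. j \<in> set ks \<Longrightarrow> Q f \<Longrightarrow> Q (B j f)) \<Longrightarrow> Q f \<Longrightarrow> Q (foldr B ks f)"
  by (induction ks) auto

lemma van_Y: "i < n \<Longrightarrow> van f \<Longrightarrow> van (Y i f)"
  unfolding Yop_def by (intro foldr_pres[where Q = van] van_om) (auto intro: van_T van_U)

lemma van_Ph: "van f \<Longrightarrow> van (Ph f)"
  unfolding Ph_def by (intro van_shift van_om) auto

lemma van_Phi': "van f \<Longrightarrow> van (Phi' f)"
  unfolding Phi'_def by (intro van_shift van_omi) auto

end

section \<open>Spectral decomposition of invariant subspaces\<close>

text \<open>Apply A_i - w_i(l) with i separating j from l: the l-th component disappears and the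
  j-th is multiplied by a nonzero scalar of \<open>K\<close>. Used for homogeneous components under
  the n-th power of \<open>om\<close>, and for the Macdonald polynomials under the Y_i.\<close>

lemma eigen_split:
  fixes F :: "'j \<Rightarrow> 'x \<Rightarrow> 'a::field"
  assumes K: "coeff_hom K (\<lambda>x. x)" "\<And>x. x \<in> K \<Longrightarrow> inverse x \<in> K"
    and N: "\<And>f g. f \<in> N \<Longrightarrow> g \<in> N \<Longrightarrow> (\<lambda>a. f a + g a) \<in> N"
      "\<And>c f. c \<in> K \<Longrightarrow> f \<in> N \<Longrightarrow> (\<lambda>a. c * f a) \<in> N"
    and A: "\<And>i f. i \<in> Ix \<Longrightarrow> f \<in> N \<Longrightarrow> A i f \<in> N"
    and lin: "\<And>i D c. i \<in> Ix \<Longrightarrow> finite D \<Longrightarrow> D \<subseteq> B \<Longrightarrow>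
      A i (\<lambda>a. \<Sum>j\<in>D. c j * F j a) = (\<lambda>a. \<Sum>j\<in>D. c j * w i j * F j a)"
    and wK: "\<And>i j. i \<in> Ix \<Longrightarrow> w i j \<in> K"
    and sep: "\<And>j l. j \<in> B \<Longrightarrow> l \<in> B \<Longrightarrow> j \<noteq> l \<Longrightarrow> \<exists>i\<in>Ix. w i j \<noteq> w i l"
  shows "finite D \<Longrightarrow> D \<subseteq> B \<Longrightarrow> (\<lambda>a. \<Sum>j\<in>D. c j * F j a) \<in> N \<Longrightarrow> j \<in> D \<Longrightarrow> (\<lambda>a. c j * F j a) \<in> N"
proof (induction "card D" arbitrary: D c)
  case 0
  then have "D = {}" by (metis card_0_eq)
  then show ?case using 0 by (metis empty_iff)
next
  case (Suc m)
  interpret K: coeff_hom K "\<lambda>x. x" by (rule K(1))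
  show ?case
  proof (cases "\<exists>l\<in>D. l \<noteq> j")
    case False
    then have D: "D = {j}" using Suc.prems(4) by blast
    then show ?thesis using Suc.prems(3) by simp
  next
    case True
    then obtain l where l: "l \<in> D" "l \<noteq> j" by blast
    then obtain i where i: "i \<in> Ix" "w i j \<noteq> w i l" using sep[of j l] Suc.prems(2,4) by blast
    let ?f = "\<lambda>a. \<Sum>j\<in>D. c j * F j a"
    let ?c = "\<lambda>j. (w i j - w i l) * c j"
    have 1: "(\<lambda>a. A i ?f a + (- w i l) * ?f a) \<in> N"
      by (intro N(1) N(2) A i(1) K.Rminus wK Suc.prems(3))
    have 2: "A i ?f a + (- w i l) * ?f a = (\<Sum>j\<in>D - {l}. ?c j * F j a)" for a
    proof -
      have "A i ?f a + (- w i l) * ?f a = (\<Sum>j\<in>D. c j * w i j * F j a + (- w i l) * (c j * F j a))"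
        unfolding lin[OF i(1) Suc.prems(1,2)] sum.distrib sum_distrib_left ..
      also have "\<dots> = (\<Sum>j\<in>D. ?c j * F j a)" by (intro sum.cong refl) (simp add: algebra_simps)
      also have "\<dots> = ?c l * F l a + (\<Sum>j\<in>D - {l}. ?c j * F j a)"
        by (rule sum.remove[OF Suc.prems(1) l(1)])
      finally show ?thesis by simp
    qed
    have "(\<lambda>a. ?c j * F j a) \<in> N"
    proof (rule Suc.hyps(1))
      show "m = card (D - {l})" using Suc.hyps(2) Suc.prems(1) l by simp
      show "(\<lambda>a. \<Sum>j\<in>D - {l}. ?c j * F j a) \<in> N" using 1 unfolding 2 .
    qed (use Suc.prems(1,2,4) l in auto)
    moreover have "inverse (w i j - w i l) \<in> K" by (intro K(2) K.Rdiff wK i)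
    ultimately have "(\<lambda>a. inverse (w i j - w i l) * (?c j * F j a)) \<in> N" by (rule N(2)[rotated])
    moreover have "inverse (w i j - w i l) * (?c j * F j a) = c j * F j a" for a
      using i by (simp add: mult.assoc[symmetric])
    ultimately show ?thesis by (simp only:)
  qed
qed

context daha_field
begin

text \<open>\<open>VK\<close>, \<open>IK\<close> and \<open>Hinv\<close> are the counterparts of
  \<open>Vset\<close>, \<open>Iset\<close> and \<open>H_invariant\<close> for abstract
  parameters.\<close>

definition VK where "VK = {f. lp n f \<and> (\<forall>a. f a \<in> K)}"
definition IK where "IK = {f \<in> VK. \<forall>z\<in>Zg. lp_eval n f z = 0}"

definition Hinv where
  "Hinv W \<longleftrightarrow> W \<subseteq> VK \<and>
     (\<forall>f\<in>W. \<forall>g\<in>W. (\<lambda>a. f a + g a) \<in> W) \<and>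
     (\<forall>c\<in>K. \<forall>f\<in>W. (\<lambda>a. c * f a) \<in> W) \<and>
     (\<forall>i<n. \<forall>f\<in>W. lp_mult n (lp_X n i) f \<in> W \<and> lp_mult n (lp_Xinv n i) f \<in> W \<and>
        Y i f \<in> W \<and> Yi i f \<in> W) \<and>
     (\<forall>i. Suc i < n \<longrightarrow> (\<forall>f\<in>W. T i f \<in> W))"

lemma Kprod: "(\<And>k. k \<in> A \<Longrightarrow> F k \<in> K) \<Longrightarrow> prod F A \<in> K"
  by (induction A rule: infinite_finite_induct) (auto simp: KK.R1 KK.Rmult)

lemma IK_van: "f \<in> IK \<longleftrightarrow> f \<in> VK \<and> van f"
  by (auto simp: IK_def VK_def van_def)

abbreviation one where "one \<equiv> lp_mono (replicate n 0) (1::'a)"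

lemma one_VK: "one \<in> VK"
  by (auto simp: VK_def lp_mono_lp) (auto simp: lp_mono_def KK.R0 KK.R1)

lemma eval_mono: "length a = n \<Longrightarrow> lp_eval n (lp_mono a 1) z = mval n z a"
  by (subst lp_eval_eq[of "{a}"]) (auto simp: lp_mono_def)

lemma eval_one: "lp_eval n one z = 1"
  by (simp add: eval_mono) (simp add: mval_def)

lemma mono_not_van: "length a = n \<Longrightarrow> \<not> van (lp_mono a 1)"
proof
  assume a: "length a = n" and v: "van (lp_mono a (1::'a))"
  have "replicate n 0 \<in> alc n r" using r2 by (simp add: alc_def)
  then have "lp_eval n (lp_mono a 1) (zp (replicate n 0) 1) = 0" using v KK.R1 unfolding van_iff by auto
  then show False using mval_nonzero[of "zp (replicate n 0) 1" n a] zp_nonzero[of 1] a by (simp add: eval_mono)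
qed

section \<open>Irreducibility of the quotient\<close>

text \<open>In degree zero a function is constant on each of the punctured lines that make up the
  variety, so lines can be treated like points.\<close>

definition deg0 where "deg0 f \<longleftrightarrow> (\<forall>b. f b \<noteq> 0 \<longrightarrow> sum_list b = (0::int))"

lemma mval_scale_point:
  assumes "length z = n" "length b = n" "k \<noteq> 0"
  shows "mval n (map (\<lambda>x. k * x) z) b = k powi (sum_list b) * mval n z b"
proof -
  have "mval n (map (\<lambda>x. k * x) z) b = (\<Prod>i<n. k powi (b ! i)) * mval n z b"
    unfolding mval_def prod.distrib[symmetric]
    by (intro prod.cong) (use assms in \<open>auto simp: power_int_mult_distrib\<close>)
  also have "(\<Prod>i<n. k powi (b ! i)) = k powi (sum_list b)"
    using power_int_sum[OF assms(3), of "\<lambda>i. b ! i" "{..<n}"] assms by (simp add: sum_list_sum_nth atLeast0LessThan)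
  finally show ?thesis .
qed

lemma zp_scale: "zp a (k * c) = map (\<lambda>x. k * x) (zp a c)"
  by (simp add: zp_def)

lemma deg0_eval:
  assumes "deg0 f" "lp n f" "k \<noteq> 0"
  shows "lp_eval n f (zp a k) = lp_eval n f (zp a 1)"
proof -
  have "lp_eval n f (zp a (k * 1)) = lp_eval n f (zp a 1)"
    unfolding zp_scale lp_eval_eq[OF lp_fin[OF assms(2)] order_refl]
    by (intro sum.cong refl) (use assms lp_len[OF assms(2)] in \<open>auto simp: mval_scale_point deg0_def\<close>)
  then show ?thesis by simp
qed

lemma sum_list_lmv: "Suc i < length a \<Longrightarrow> sum_list (lmv i k a) = sum_list a"
proof -
  assume i: "Suc i < length a"
  have "sum_list (lmv i k a) = (\<Sum>j<length a. a ! j + (if j = i then k else 0) - (if j = Suc i then k else 0))"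
    unfolding sum_list_sum_nth atLeast0LessThan length_lmv
    by (intro sum.cong) (use i in \<open>auto simp: nth_lmv\<close>)
  also have "\<dots> = sum_list a"
    using i by (simp add: sum.distrib sum_subtractf sum_list_sum_nth atLeast0LessThan)
  finally show ?thesis .
qed

lemma deg0_T: 
  assumes i: "Suc i < n" and f: "lp n f" "deg0 f" shows "deg0 (T i f)"
  unfolding deg0_def
proof (intro allI impI)
  fix b assume nz: "T i f b \<noteq> 0"
  then have l: "length b = n" using lp_len[OF Top_lp[OF i f(1)]] by blast
  show "sum_list b = 0"
  proof (rule ccontr)
    assume "sum_list b \<noteq> 0"
    then have "f (lmv i k b) = 0" for k using f(2) sum_list_lmv[of i b k] i l by (metis deg0_def)
    then have "T i f b = 0" unfolding Top_coeff[OF i f(1) l] by (simp add: fsum_zero)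
    then show False using nz by simp
  qed
qed

lemma sum_list_rot: "b \<noteq> [] \<Longrightarrow> sum_list (last b # butlast b) = sum_list b" for b :: "int list"
  by (cases b rule: rev_cases) auto

lemma deg0_om: "deg0 f \<Longrightarrow> deg0 (om f)"
  unfolding deg0_def
proof (intro allI impI)
  fix b assume f: "\<forall>b. f b \<noteq> 0 \<longrightarrow> sum_list b = 0" and nz: "om f b \<noteq> 0"
  show "sum_list b = 0"
  proof (cases "b = []")
    case False
    then have "f (last b # butlast b) \<noteq> 0" using nz by (auto simp: omega_def)
    then show ?thesis using f sum_list_rot[OF False] by metis
  qed simp
qed

lemma deg0_omi: "deg0 f \<Longrightarrow> deg0 (omi f)"
proof -
  have "sum_list (rotate1 b) = sum_list b" for b :: "int list" by (cases b) auto
  then show "deg0 f \<Longrightarrow> deg0 (omi f)" unfolding deg0_def omega_inv_def by (auto split: if_splits)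
qed

lemma om_power:
  assumes "lp n f"
  shows "k \<le> n \<Longrightarrow> length b = n \<Longrightarrow>
    (om ^^ k) f b = f (drop (n - k) b @ take (n - k) b) * q powi (sum_list (drop (n - k) b))"
proof (induction k arbitrary: b)
  case (Suc k)
  have bne: "b \<noteq> []" using Suc.prems by auto
  obtain c x where b: "b = c @ [x]" using bne by (cases b rule: rev_cases) auto
  have lc: "length c = n - 1" using Suc.prems b by simp
  obtain m where m: "n - k = Suc m" using Suc.prems by (cases "n - k") auto
  have mk: "n - Suc k = m" using m by simp
  have ml: "m \<le> length c" using lc m by simp
  have "(om ^^ Suc k) f b = (om ^^ k) f (x # c) * q powi x" by (simp add: omega_def b)
  also have "\<dots> = f (drop m c @ x # take m c) * (q powi (sum_list (drop m c)) * q powi x)"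
    using Suc.IH[of "x # c"] Suc.prems lc m by (simp add: mult.assoc)
  also have "drop m c @ x # take m c = drop m b @ take m b" using ml by (simp add: b)
  also have "q powi (sum_list (drop m c)) * q powi x = q powi (sum_list (drop m b))"
    using ml q0 by (simp add: b power_int_add)
  finally show ?case unfolding mk .
qed simp

text \<open>After n turns every variable is back in place, multiplied by q. The degrees become
  distinguishable by the eigenvalues q^d.\<close>

lemma om_power_n: "lp n f \<Longrightarrow> (om ^^ n) f = (\<lambda>b. q powi (sum_list b) * f b)"
proof (rule ext)
  fix b assume f: "lp n f"
  have "lp n ((om ^^ k) f)" for k by (induction k) (use f in auto)
  then show "(om ^^ n) f b = q powi (sum_list b) * f b"
    using om_power[OF f, of n b] f lp_zero[of n "(om ^^ n) f" b]
    by (cases "length b = n") (auto simp: lp_zero)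
qed

lemma q_powi_eq: "q powi i = q powi j \<Longrightarrow> i = j"
proof -
  assume "q powi i = q powi j"
  then have "s powi (2 * 0) * q powi (i - j) = 1" using q0 by (simp add: power_int_diff)
  then show ?thesis using star[of 0 "i - j"] n2 by simp
qed

lemma om_eq: "lp n f \<Longrightarrow> om f = foldr U (rev [0..<n - 1]) (Y 0 f)"
  by (simp add: Yop_def)

lemma omi_eq: "lp n f \<Longrightarrow> omi f = Yi 0 (foldr T [0..<n - 1] f)"
  by (simp add: Yinv_def)

theorem irreducible:
  assumes IW: "IK \<subseteq> W" and H: "Hinv W"
  shows "W = IK \<or> W = VK"
proof -
  have WV: "W \<subseteq> VK" and Wadd: "\<And>f g. f \<in> W \<Longrightarrow> g \<in> W \<Longrightarrow> (\<lambda>a. f a + g a) \<in> W"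
    and Wsc: "\<And>c f. c \<in> K \<Longrightarrow> f \<in> W \<Longrightarrow> (\<lambda>a. c * f a) \<in> W"
    and WX: "\<And>i f. i < n \<Longrightarrow> f \<in> W \<Longrightarrow> lp_shift n (unitv n i) f \<in> W"
    and WXi: "\<And>i f. i < n \<Longrightarrow> f \<in> W \<Longrightarrow> lp_shift n (map uminus (unitv n i)) f \<in> W"
    and WY: "\<And>i f. i < n \<Longrightarrow> f \<in> W \<Longrightarrow> Y i f \<in> W" and WYi: "\<And>i f. i < n \<Longrightarrow> f \<in> W \<Longrightarrow> Yi i f \<in> W"
    and WT: "\<And>i f. Suc i < n \<Longrightarrow> f \<in> W \<Longrightarrow> T i f \<in> W"
    using H unfolding Hinv_def mult_X mult_Xinv by blast+
  have Wlp: "lp n f" and WK: "f a \<in> K" if "f \<in> W" for f a using that WV by (auto simp: VK_def)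
  have W0: "(\<lambda>a. 0) \<in> W" using IW by (auto simp: IK_def VK_def KK.R0)
  have WU: "U i f \<in> W" if "Suc i < n" "f \<in> W" for i f
  proof -
    have "(\<lambda>a. T i f a + (- (s - inverse s)) * f a) \<in> W"
      by (intro Wadd Wsc WT that KK.Rminus KK.Rdiff sK Kinv)
    then show ?thesis by (simp add: Tinv_def algebra_simps)
  qed
  have Wom: "om f \<in> W" if "f \<in> W" for f
    unfolding om_eq[OF Wlp[OF that]] by (rule foldr_pres[where Q = "\<lambda>f. f \<in> W"]) (use that in \<open>auto intro: WU WY\<close>)
  have Womi: "omi f \<in> W" if "f \<in> W" for f
    unfolding omi_eq[OF Wlp[OF that]]
    by (rule WYi[OF n0], rule foldr_pres[where Q = "\<lambda>f. f \<in> W"]) (use that in \<open>auto intro: WT\<close>)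
  have Wsum: "(\<lambda>a. \<Sum>b\<in>B. G b a) \<in> W" if "\<And>b. b \<in> B \<Longrightarrow> G b \<in> W" for B and G :: "int list \<Rightarrow> 'a lpoly"
    using that by (induction B rule: infinite_finite_induct) (auto intro: W0 Wadd)
  \<comment> \<open>One variable or inverse variable at a time, by induction on the sum of the
    absolute values of the exponents.\<close>
  have Wsh: "lp_shift n b f \<in> W" if f: "f \<in> W" and b: "length b = n" for b f
    using b
  proof (induction "\<Sum>i<n. nat \<bar>b ! i\<bar>" arbitrary: b rule: less_induct)
    case less
    show ?case
    proof (cases "\<exists>i<n. b ! i \<noteq> 0")
      case False
      then have "b = replicate n 0" using less.prems by (intro nth_equalityI) auto
      then show ?thesis using f by (simp add: shift_0 Wlp)
    next
      case True
      then obtain i where i: "i < n" "b ! i \<noteq> 0" by blast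
      define e where "e = sgn (b ! i)"
      define c where "c = b[i := b ! i - e]"
      have lc: "length c = n" using less.prems by (simp add: c_def)
      have "(\<Sum>j<n. nat \<bar>c ! j\<bar>) < (\<Sum>j<n. nat \<bar>b ! j\<bar>)"
      proof (rule sum_strict_mono_ex1)
        have ci: "nat \<bar>c ! i\<bar> < nat \<bar>b ! i\<bar>" using i less.prems by (auto simp: c_def e_def sgn_if)
        then show "\<exists>a\<in>{..<n}. nat \<bar>c ! a\<bar> < nat \<bar>b ! a\<bar>" using i by blast
        have "nat \<bar>c ! j\<bar> \<le> nat \<bar>b ! j\<bar>" if "j < n" for j
          using ci by (cases "j = i") (auto simp: c_def)
        then show "\<forall>x\<in>{..<n}. nat \<bar>c ! x\<bar> \<le> nat \<bar>b ! x\<bar>" by simp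
      qed simp
      then have cW: "lp_shift n c f \<in> W" using less.hyps lc by blast
      show ?thesis
      proof (cases "b ! i > 0")
        case True
        have "map2 (+) (unitv n i) c = b" using less.prems i True
          by (intro nth_equalityI) (auto simp: c_def e_def nth_unitv nth_list_update)
        then show ?thesis using WX[OF i(1) cW] lc by (simp add: shift_shift)
      next
        case neg: False
        have "map2 (+) (map uminus (unitv n i)) c = b" using less.prems i neg
          by (intro nth_equalityI) (auto simp: c_def e_def nth_unitv nth_list_update)
        then show ?thesis using WXi[OF i(1) cW] lc by (simp add: shift_shift)
      qed
    qed
  qed
  have Wmult: "lp_mult n f g \<in> W" if f: "f \<in> VK" and g: "g \<in> W" for f g
    unfolding lp_mult_eq_sum using f by (intro Wsum Wsc Wsh g) (auto simp: VK_def lp_len)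
  show ?thesis
  proof (cases "W = IK")
    case False
    then obtain f where f: "f \<in> W" "f \<notin> IK" using IW by blast
    then have fl: "lp n f" and fV: "f \<in> VK" using Wlp WV by auto
    then obtain a c where ac: "a \<in> alc n r" "c \<in> K" "c \<noteq> 0" "lp_eval n f (zp a c) \<noteq> 0"
      using f(2) by (auto simp: IK_van van_iff)
    define hom where "hom = (\<lambda>d b. if sum_list b = d then f b else 0)"
    have homl: "lp n (hom d)" for d
      by (rule lpI[OF lp_fin[OF fl]]) (use fl lp_len in \<open>auto simp: hom_def split: if_splits\<close>)
    define Ds where "Ds = sum_list ` {b. f b \<noteq> 0}"
    have Ds: "finite Ds" unfolding Ds_def using lp_fin[OF fl] by simp
    have fsum': "f = (\<lambda>b. \<Sum>d\<in>Ds. 1 * hom d b)"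
    proof (rule ext)
      fix b
      have "(\<Sum>d\<in>Ds. 1 * hom d b) = (\<Sum>d\<in>Ds. if sum_list b = d then f b else 0)" by (simp add: hom_def)
      also have "\<dots> = f b" using Ds by (auto simp: Ds_def)
      finally show "f b = (\<Sum>d\<in>Ds. 1 * hom d b)" by simp
    qed
    have omn: "(om ^^ n) g \<in> W" if "g \<in> W" for g
    proof -
      have "(om ^^ k) g \<in> W" for k by (induction k) (use that Wom in auto)
      then show ?thesis .
    qed
    have homW: "hom d \<in> W" if d: "d \<in> Ds" for d
    proof -
      have "(\<lambda>b. 1 * hom d b) \<in> W"
      proof (rule eigen_split[where K = K and N = W and A = "\<lambda>_::unit. om ^^ n" and Ix = UNIV
            and w = "\<lambda>_ d. q powi d" and B = Ds and D = Ds and c = "\<lambda>_. 1"])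
        fix i :: unit and D :: "int set" and c :: "int \<Rightarrow> 'a" assume D: "finite D"
        have l: "lp n (\<lambda>a. \<Sum>j\<in>D. c j * hom j a)" by (intro lp_sum lp_scale homl)
        show "(om ^^ n) (\<lambda>a. \<Sum>j\<in>D. c j * hom j a) = (\<lambda>a. \<Sum>j\<in>D. c j * q powi j * hom j a)"
          unfolding om_power_n[OF l]
          by (auto simp: sum_distrib_left hom_def mult_ac intro!: sum.cong ext)
      next
        fix i :: unit and j show "q powi j \<in> K" by (intro K_powi qK)
      next
        show "(\<lambda>a. \<Sum>j\<in>Ds. 1 * hom j a) \<in> W" using f(1) unfolding fsum'[symmetric] .
      qed (use Khom Kinv Wadd Wsc omn q_powi_eq Ds d in auto)
      then show ?thesis by simp
    qed
    have "lp_eval n f (zp a c) = (\<Sum>d\<in>Ds. lp_eval n (hom d) (zp a c))"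
      by (subst fsum') (simp add: eval_sum homl)
    then obtain d where d: "d \<in> Ds" "lp_eval n (hom d) (zp a c) \<noteq> 0" using ac(4) by (metis sum.neutral)
    \<comment> \<open>The lines on which W does not vanish; in degree zero the choice of the point
      on the line is immaterial.\<close>
    define P where "P = (\<lambda>a. \<exists>g\<in>W. deg0 g \<and> lp_eval n g (zp a 1) \<noteq> 0)"
    have Pa: "P a"
    proof -
      \<comment> \<open>Multiplication by x_0^(-d) brings the component to degree zero without
        changing its zeros among points with nonzero coordinates.\<close>
      define b where "b = (- d) # replicate (n - 1) 0"
      have lb: "length b = n" using n0 by (simp add: b_def del: n0)
      let ?g = "lp_shift n b (hom d)"
      have gW: "?g \<in> W" using Wsh homW d lb by blast
      have gd: "deg0 ?g" unfolding deg0_def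
      proof (intro allI impI)
        fix x assume nz: "?g x \<noteq> 0"
        then have lx: "length x = n" by (auto simp: lp_shift_def split: if_splits)
        then have "sum_list (map2 (-) x b) = d" using nz by (auto simp: lp_shift_def hom_def split: if_splits)
        moreover have "sum_list (map2 (-) x b) = sum_list x - sum_list b"
          using lx lb by (simp add: sum_list_sum_nth sum_subtractf)
        moreover have "sum_list b = - d" by (simp add: b_def sum_list_replicate)
        ultimately show "sum_list x = 0" by simp
      qed
      have "lp_eval n ?g (zp a c) \<noteq> 0"
        using eval_shift[OF lb homl _ zp_nonzero] mval_nonzero[OF _ zp_nonzero] ac(3) d(2) by simp
      then have "lp_eval n ?g (zp a 1) \<noteq> 0" using deg0_eval[OF gd Wlp[OF gW] ac(3)] by simp
      then show ?thesis using gW gd by (auto simp: P_def)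
    qed
    \<comment> \<open>If g vanishes on the exchanged line, then T_i g takes there the value of g on
      the line of \<open>a\<close>, times \<open>ca\<close>; otherwise g itself serves.\<close>
    have step: "P (lsw i a)" if a: "a \<in> alc n r" and b: "lsw i a \<in> alc n r" and i: "Suc i < n"
      and ne: "a ! i \<noteq> a ! Suc i" "s\<^sup>2 * ev a i \<noteq> ev a (Suc i)" and P: "P a" for a i
    proof -
      note l = alcD(1)[OF a]
      obtain g where g: "g \<in> W" "deg0 g" "lp_eval n g (zp a 1) \<noteq> 0" using P by (auto simp: P_def)
      have z: "lsw i (zp (lsw i a) 1) = zp a 1" using zp_lsw[OF l i ne(1), of 1] i by simp
      have "ev (lsw i a) i \<noteq> s\<^sup>2 * ev (lsw i a) (Suc i)"
        using ne i l by (simp add: ev_lsw tsw_def)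
      then have nz: "ca (zp (lsw i a) 1 ! i) (zp (lsw i a) 1 ! Suc i) \<noteq> 0"
        using ca_zero_iff[OF b i, of 1] by simp
      show ?thesis
      proof (cases "lp_eval n g (zp (lsw i a) 1) = 0")
        case True
        then have "lp_eval n (T i g) (zp (lsw i a) 1) \<noteq> 0"
          using ev_T_zp[OF b i Wlp[OF g(1)], of 1] nz g(3) by (simp add: z)
        then show ?thesis using WT[OF i g(1)] deg0_T[OF i Wlp[OF g(1)] g(2)] by (auto simp: P_def)
      qed (use g in \<open>auto simp: P_def\<close>)
    qed
    have sw: "P a \<longleftrightarrow> P (lsw i a)" if a: "a \<in> alc n r" and b: "lsw i a \<in> alc n r" and i: "Suc i < n"
      and gt: "a ! i > a ! Suc i" for a i
    proof
      note l = alcD(1)[OF a]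
      assume "P a" then show "P (lsw i a)" using step[OF a b i] alc_edge[OF a i gt] gt by simp
    next
      note l = alcD(1)[OF a]
      assume Pb: "P (lsw i a)"
      have ll: "lsw i (lsw i a) = a" using l i by simp
      have "s\<^sup>2 * ev (lsw i a) i \<noteq> ev (lsw i a) (Suc i)"
        using alc_edge(1)[OF a i gt] gt i l by (simp add: ev_lsw tsw_def)
      then show "P a" using step[OF b _ i _ _ Pb] a gt i l unfolding ll by (simp add: nth_lsw)
    qed
    have rot: "P a \<longleftrightarrow> P (rotp a)" if a: "a \<in> alc n r" for a
    proof
      note l = alcD(1)[OF a]
      show "P (rotp a)" if "P a"
        using that Wom deg0_om eval_om_zp[OF l Wlp] unfolding P_def by (metis zero_neq_one)
      show "P a" if Pr: "P (rotp a)"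
      proof -
        obtain g where g: "g \<in> W" "deg0 g" "lp_eval n g (zp (rotp a) 1) \<noteq> 0" using Pr by (auto simp: P_def)
        then have "lp_eval n (omi g) (zp a 1) \<noteq> 0" using eval_om_zp[OF l lp_omi[OF Wlp[OF g(1)]], of 1] by simp
        then show ?thesis using Womi[OF g(1)] deg0_omi[OF g(2)] by (auto simp: P_def)
      qed
    qed
    \<comment> \<open>Adding a constant to all entries only rescales the point by a power of q, so
      the line stays the same.\<close>
    have shiftP: "zp b c = zp b' (c * q powi - k)" if "length b = n" "b' = map (\<lambda>x. x - k) b" for b b' k c
    proof (rule nth_equalityI)
      fix i assume "i < length (zp b c)"
      then have i: "i < n" by simp
      have "rank b' i = rank b i" unfolding rank_def using that i
        by (intro arg_cong[of _ _ card]) (auto simp: beats_def)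
      then have "ev b i = ev b' i * q powi k"
        using that i q0 by (simp add: ev_rank power_int_diff)
      then show "zp b c ! i = zp b' (c * q powi - k) ! i" using i q0 by (simp add: power_int_minus field_simps)
    qed simp
    have Pall: "P b" if b: "b \<in> alc n r" for b
    proof -
      have con: "\<exists>c. P b \<longleftrightarrow> P (replicate n c)" if "b \<in> alc n r" for b
        using alc_connected[OF n0 r2, of P b] sw rot that by blast
      have c0: "P (replicate n c) \<longleftrightarrow> P (replicate n 0)" for c
      proof -
        have e: "zp (replicate n c) 1 = zp (replicate n 0) (1 * q powi - c)"
        proof (rule shiftP)
          show "length (replicate n c) = n" by (rule length_replicate)
          show "replicate n 0 = map (\<lambda>x. x - c) (replicate n c)"
            unfolding map_replicate diff_self ..
        qed
        have "lp_eval n g (zp (replicate n c) 1) = lp_eval n g (zp (replicate n 0) 1)" if "g \<in> W" "deg0 g" for g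
          unfolding e by (rule deg0_eval[OF that(2) Wlp[OF that(1)]]) (use q0 in simp)
        then show ?thesis unfolding P_def by metis
      qed
      show ?thesis using con[OF b] con[OF ac(1)] c0 Pa by metis
    qed
    have unit: "\<exists>g\<in>W. \<forall>c. c \<noteq> 0 \<longrightarrow> lp_eval n g (zp b c) = 1" if b: "b \<in> alc n r" for b
    proof -
      obtain g where g: "g \<in> W" "deg0 g" "lp_eval n g (zp b 1) \<noteq> 0" using Pall[OF b] by (auto simp: P_def)
      define v where "v = lp_eval n g (zp b 1)"
      have "v \<in> K" unfolding v_def lp_eval_eq[OF lp_fin[OF Wlp[OF g(1)]] order_refl] mval_def
      proof (intro KK.Rsum KK.Rmult WK[OF g(1)])
        fix x show "(\<Prod>i<n. (zp b 1 ! i) powi (x ! i)) \<in> K"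
          by (rule Kprod) (auto intro!: K_powi Kdivide KK.R1 evK)
      qed
      then have "(\<lambda>a. inverse v * g a) \<in> W" using Wsc Kinv g(1) by blast
      moreover have "lp_eval n (\<lambda>a. inverse v * g a) (zp b c) = 1" if "c \<noteq> 0" for c
        using g(3) deg0_eval[OF g(2) Wlp[OF g(1)] that] by (simp add: eval_scale Wlp[OF g(1)] v_def)
      ultimately show ?thesis by blast
    qed
    \<comment> \<open>Every line is reached with first entry 0, and the other entries then have
      absolute value at most r - 1: there are finitely many lines.\<close>
    define B0 where "B0 = {b \<in> alc n r. b ! 0 = 0}"
    have B0: "finite B0"
    proof (rule finite_subset[OF _ finite_lists_between[of n "- int r" "int r"]])
      show "B0 \<subseteq> {a. length a = n \<and> set a \<subseteq> {- int r..int r}}"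
      proof (intro subsetI CollectI conjI)
        fix b x assume b: "b \<in> B0"
        then show lb: "length b = n" using alcD(1) by (auto simp: B0_def)
        assume "x \<in> set b"
        then obtain j where "j < n" "x = b ! j" using lb by (auto simp: in_set_conv_nth)
        then show "x \<in> {- int r..int r}" using b alcD(2)[of b n r j 0] alcD(2)[of b n r 0 j] n0
          unfolding B0_def by auto
      qed
    qed
    have "\<exists>g\<in>W. \<forall>b\<in>B. \<forall>c. c \<noteq> 0 \<longrightarrow> lp_eval n g (zp b c) = 1" if "finite B" "B \<subseteq> alc n r" for B
      using that
    proof (induction B rule: finite_induct)
      case empty then show ?case using W0 by blast
    next
      case (insert b B)
      then obtain g where g: "g \<in> W" "\<And>b c. b \<in> B \<Longrightarrow> c \<noteq> 0 \<Longrightarrow> lp_eval n g (zp b c) = 1" by auto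
      obtain h where h: "h \<in> W" "\<And>c. c \<noteq> 0 \<Longrightarrow> lp_eval n h (zp b c) = 1" using unit insert.prems by blast
      \<comment> \<open>This is 1 - (1 - g)(1 - h), which equals 1 wherever g or h does.\<close>
      let ?k = "\<lambda>a. (g a + h a) + (-1) * lp_mult n g h a"
      have "?k \<in> W" using g(1) h(1) WV by (intro Wadd Wsc Wmult KK.Rminus KK.R1) auto
      moreover have "lp_eval n ?k (zp x c) = 1" if "x \<in> insert b B" "c \<noteq> 0" for x c
      proof -
        note l = Wlp[OF g(1)] Wlp[OF h(1)]
        have "lp_eval n ?k (zp x c) = lp_eval n g (zp x c) + lp_eval n h (zp x c)
            + (-1) * (lp_eval n g (zp x c) * lp_eval n h (zp x c))"
          by (simp only: eval_add[OF lp_add[OF l] lp_scale[OF lp_mult_lp[OF l]]] eval_add[OF l]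
            eval_scale[OF lp_mult_lp[OF l]] eval_mult[OF l length_zp zp_nonzero[OF that(2)]])
        then show ?thesis using that g(2) h(2) by auto
      qed
      ultimately show ?case by blast
    qed
    from this[OF B0] obtain g where g: "g \<in> W" "\<And>b c. b \<in> B0 \<Longrightarrow> c \<noteq> 0 \<Longrightarrow> lp_eval n g (zp b c) = 1"
      by (auto simp: B0_def)
    have g1: "lp_eval n g (zp b c) = 1" if b: "b \<in> alc n r" and c: "c \<noteq> 0" for b c
    proof -
      note l = alcD(1)[OF b]
      let ?b = "map (\<lambda>x. x - b ! 0) b"
      have "?b \<in> B0" using b l n0 unfolding B0_def alc_def by auto
      then show ?thesis using shiftP[OF l refl, of c "b ! 0"] g(2)[of ?b] c q0 by simp
    qed
    have "(\<lambda>a. one a + (-1) * g a) \<in> IK"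
      unfolding IK_van van_iff
    proof (intro conjI ballI impI)
      show "(\<lambda>a. one a + (-1) * g a) \<in> VK"
        using one_VK g(1) WV unfolding VK_def
        by (auto intro!: lp_diff KK.Rdiff)
      then show "lp n (\<lambda>a. one a + (-1) * g a)" by (simp add: VK_def)
      fix b c assume "b \<in> alc n r" "c \<in> K" "c \<noteq> 0"
      then show "lp_eval n (\<lambda>a. one a + (-1) * g a) (zp b c) = 0"
        using g1 eval_diff[of n one g "zp b c"] Wlp[OF g(1)] by (simp add: lp_mono_lp eval_one)
    qed
    then have "(\<lambda>a. (one a + (-1) * g a) + g a) \<in> W" using IW g(1) Wadd by blast
    then have oneW: "one \<in> W" by simp
    have "f \<in> W" if f: "f \<in> VK" for f
    proof -
      have fl: "lp n f" using f by (simp add: VK_def)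
      have "lp_mult n f one = f"
      proof (rule ext)
        fix a
        have sh: "lp_shift n b one a = (if a = b then 1 else 0)" if b: "length b = n" for b
        proof (cases "length a = n")
          case True
          have "map2 (-) a b = replicate n 0 \<longleftrightarrow> a = b"
            using True b by (auto simp: list_eq_iff_nth_eq)
          then show ?thesis using True by (simp add: lp_shift_def lp_mono_def)
        qed (use b in \<open>auto simp: lp_shift_def\<close>)
        have "lp_mult n f one a = (\<Sum>b\<in>{b. f b \<noteq> 0}. if a = b then f b else 0)"
          unfolding lp_mult_eq_sum by (intro sum.cong refl) (use lp_len[OF fl] sh in auto)
        also have "\<dots> = f a" using lp_fin[OF fl] by auto
        finally show "lp_mult n f one a = f a" .
      qed
      then show ?thesis using Wmult[OF f oneW] by simp
    qed
    then show ?thesis using WV by blast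
  qed simp
qed

end

section \<open>The basis of the quotient\<close>

context daha_field
begin

lemma E_K: "length lam = n \<Longrightarrow> E lam a \<in> K"
proof -
  assume l: "length lam = n"
  have "\<exists>f. wt f (ev lam) \<and> f lam = 1 \<and> (\<forall>mu. f mu \<noteq> 0 \<longrightarrow> mu = lam \<or> prec mu lam) \<and> (\<forall>a. f a \<in> K)"
  proof (rule E_exists[OF l Khom sK Kinv[OF sK] qK Kinv[OF qK]])
    fix mu assume p: "prec mu lam"
    then have "lam \<noteq> mu" "length mu = n" using l prec_length by auto
    then obtain i where "i < n" "ev lam i \<noteq> ev mu i" using ev_inj l by blast
    then show "\<exists>i<n. ev lam i \<noteq> ev mu i \<and> inverse (ev lam i - ev mu i) \<in> K"
      by (intro exI[of _ i]) (auto intro: Kinv KK.Rdiff evK)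
  qed
  then obtain f where f: "wt f (ev lam)" "f lam = 1" "\<forall>mu. f mu \<noteq> 0 \<longrightarrow> mu = lam \<or> prec mu lam" "\<forall>a. f a \<in> K"
    by blast
  then show ?thesis using E_eqI[OF l f(1-3)] by simp
qed

lemma E_VK: "length lam = n \<Longrightarrow> E lam \<in> VK"
  by (simp add: VK_def E_K)

lemma E_nz: "length lam = n \<Longrightarrow> E lam \<noteq> (\<lambda>a. 0)"
  using E_one by (metis zero_neq_one)

lemma wt_cong: "wt f w \<Longrightarrow> (\<And>i. i < n \<Longrightarrow> w i = w' i) \<Longrightarrow> wt f w'"
  by (simp add: wt_def)

text \<open>Simplicity of the spectrum makes the image of E_a a multiple of E at the exchanged
  exponent. Going back with the reverse intertwiner multiplies E_a by the scalar of
  \<open>one_plus_cw\<close>, so k cannot be zero when that scalar is not.\<close>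

lemma T_link:
  assumes l: "length a = n" and i: "Suc i < n" and ne: "a ! i \<noteq> a ! Suc i"
  defines "x \<equiv> ev a i" and "y \<equiv> ev a (Suc i)"
  obtains k where "(\<lambda>u. T i (E a) u + cw x y * E a u) = (\<lambda>u. k * E (lsw i a) u)"
    and "x \<noteq> s\<^sup>2 * y \<Longrightarrow> s\<^sup>2 * x \<noteq> y \<Longrightarrow> k \<noteq> 0"
proof -
  have xy: "x \<noteq> y" unfolding x_def y_def using ev_ne[OF l] i by simp
  let ?g = "\<lambda>u. T i (E a) u + cw x y * E a u"
  have "wt ?g (\<lambda>j. if j = i then ev a (Suc i) else if j = Suc i then ev a i else ev a j)"
    using wt_T[OF E_wt[OF l] i] xy unfolding x_def y_def by blast
  then have "wt ?g (ev (lsw i a))"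
    by (rule wt_cong) (use l i ne in \<open>auto simp: ev_lsw tsw_def\<close>)
  then have g: "?g = (\<lambda>u. ?g (lsw i a) * E (lsw i a) u)" using l by (intro wt_unique) simp_all
  have "?g (lsw i a) \<noteq> 0" if c: "x \<noteq> s\<^sup>2 * y" "s\<^sup>2 * x \<noteq> y"
  proof
    assume "?g (lsw i a) = 0"
    then have g0: "?g = (\<lambda>u. 0)" by (subst g) simp
    have sq: "T i ?g a + cw y x * ?g a = (1 + cw x y * cw y x) * E a a"
      by (rule fun_cong[OF intertwiner_square[OF E_lp[OF l] i xy]])
    have "T i ?g = (\<lambda>u. 0)" unfolding g0 using T_scale[OF i lp_0, of 0] by simp
    then have "(1 + cw x y * cw y x) * E a a = 0"
      unfolding sq[symmetric] fun_cong[OF g0] by (simp only: mult_zero_right add_0_right)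
    then show False using one_plus_cw[OF xy] c E_one[OF l] by simp
  qed
  then show thesis using that g by blast
qed

text \<open>The weights match by \<open>ev_rotp\<close>, and k is nonzero because \<open>Ph\<close>
  is invertible.\<close>

lemma Ph_link:
  assumes l: "length a = n"
  obtains k where "Ph (E a) = (\<lambda>u. k * E (rotp a) u)" "k \<noteq> 0"
proof -
  have lr: "length (rotp a) = n" using l length_rotp n0 by blast
  have "wt (Ph (E a)) (ev (rotp a))"
    by (rule wt_cong[OF wt_Ph[OF E_wt[OF l]]]) (use l in \<open>simp add: ev_rotp\<close>)
  then have g: "Ph (E a) = (\<lambda>u. Ph (E a) (rotp a) * E (rotp a) u)" by (rule wt_unique[OF lr])
  have "Ph (E a) (rotp a) \<noteq> 0"
  proof
    assume "Ph (E a) (rotp a) = 0"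
    then have "Ph (E a) = (\<lambda>u. 0)" by (subst g) simp
    then have "Phi' (Ph (E a)) = Phi' (\<lambda>u. 0)" by simp
    also have "Phi' (\<lambda>u. 0) = (\<lambda>u. 0)" by (auto simp: Phi'_def omega_inv_def lp_shift_def fun_eq_iff)
    finally show False using E_nz[OF l] l by simp
  qed
  then show thesis using that g by blast
qed

text \<open>A constant vector is minimal for \<open>prec\<close>: dominance bounds every entry by c,
  and the total n c leaves no room for smaller ones. Such an E, being a monomial, is nonzero at all
  points of the variety and serves as the anchor of \<open>E_not_van\<close>.\<close>

lemma E_const: "E (replicate n c) = lp_mono (replicate n c) 1"
proof -
  let ?a = "replicate n c"
  have "\<not> prec mu ?a" for mu
  proof
    assume p: "prec mu ?a"
    have l: "length mu = n" using prec_length[OF p] by simp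
    have da: "dplus ?a = ?a" by (simp add: dplus_def sort_replicate)
    have d: "dom_le (dplus mu) ?a" using prec_dom_le[OF p] by (simp add: da)
    have dm: "sum_list (take m (dplus mu)) \<le> sum_list (take m ?a)" if "m \<le> n" for m
      using d that unfolding dom_le_def by simp
    have le: "x \<le> c" if "x \<in> set mu" for x
    proof -
      have "sum_mset {#x#} \<le> sum_list (take (size {#x#}) (dplus mu))"
        by (rule sum_take_ge[OF sorted_dplus]) (use that in simp)
      also have "\<dots> \<le> sum_list (take 1 ?a)"
        unfolding size_single by (rule dm) (use n0 in linarith)
      also have "\<dots> = c" using n2 by (cases n) auto
      finally show ?thesis by simp
    qed
    have "sum_list mu = int n * c" using d by (simp add: dom_le_def sum_list_mset sum_list_replicate)
    then have "(\<Sum>i<n. c - mu ! i) = 0"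
      using l by (simp add: sum_subtractf sum_list_sum_nth atLeast0LessThan)
    then have "\<forall>i\<in>{..<n}. c - mu ! i = 0"
      by (subst (asm) sum_nonneg_eq_0_iff) (use le l in auto)
    then have "mu = ?a" using l by (intro nth_equalityI) auto
    then show False using p by simp
  qed
  then show ?thesis
    using E_supp[of ?a] E_one[of ?a] by (auto simp: lp_mono_def fun_eq_iff)
qed

lemma van_E_const: "\<not> van (E (replicate n c))"
  unfolding E_const by (rule mono_not_van) simp

lemma van_scale_iff: "k \<noteq> 0 \<Longrightarrow> van (\<lambda>a. k * f a) \<longleftrightarrow> van f"
  using van_scale[of "\<lambda>a. k * f a" "inverse k"] van_scale[of f k] by (auto simp: mult.assoc[symmetric])

lemma E_not_van:
  assumes a: "a \<in> alc n r" shows "\<not> van (E a)"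
proof -
  have step: "van (E (lsw i a))" if l: "length a = n" and i: "Suc i < n" and ne: "a ! i \<noteq> a ! Suc i"
    and c: "ev a i \<noteq> s\<^sup>2 * ev a (Suc i)" "s\<^sup>2 * ev a i \<noteq> ev a (Suc i)" and v: "van (E a)" for a i
  proof -
    obtain k where k: "(\<lambda>u. T i (E a) u + cw (ev a i) (ev a (Suc i)) * E a u) = (\<lambda>u. k * E (lsw i a) u)" "k \<noteq> 0"
      using T_link[OF l i ne] c by metis
    have "van (\<lambda>u. T i (E a) u + cw (ev a i) (ev a (Suc i)) * E a u)"
      by (intro van_add van_scale van_T i v)
    then show ?thesis unfolding k(1) using k(2) by (simp add: van_scale_iff)
  qed
  have "\<exists>c. (van (E a)) \<longleftrightarrow> (van (E (replicate n c)))"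
  proof (rule alc_connected[OF n0 r2, where P = "\<lambda>a. van (E a)", OF _ _ a])
    fix a i assume a: "a \<in> alc n r" "lsw i a \<in> alc n r" and i: "Suc i < n" and gt: "a ! i > a ! Suc i"
    note l = alcD(1)[OF a(1)]
    have e: "ev (lsw i a) i = ev a (Suc i)" "ev (lsw i a) (Suc i) = ev a i"
      using l i gt by (simp_all add: ev_lsw tsw_def)
    show "van (E a) \<longleftrightarrow> van (E (lsw i a))"
    proof
      assume "van (E a)"
      then show "van (E (lsw i a))" using step[OF l i] alc_edge[OF a(1) i gt] gt by simp
    next
      assume v: "van (E (lsw i a))"
      have "van (E (lsw i (lsw i a)))"
      proof (rule step[OF _ i _ _ _ v])
        show "lsw i a ! i \<noteq> lsw i a ! Suc i" using gt i l by (simp add: nth_lsw)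
        show "ev (lsw i a) i \<noteq> s\<^sup>2 * ev (lsw i a) (Suc i)" unfolding e using alc_edge(2)[OF a(1) i gt] by metis
        show "s\<^sup>2 * ev (lsw i a) i \<noteq> ev (lsw i a) (Suc i)" unfolding e using alc_edge(1)[OF a(1) i gt] by metis
      qed (simp add: l)
      then show "van (E a)" using l i by simp
    qed
  next
    fix a assume a: "a \<in> alc n r"
    note l = alcD(1)[OF a]
    obtain k where k: "Ph (E a) = (\<lambda>u. k * E (rotp a) u)" "k \<noteq> 0" by (rule Ph_link[OF l])
    have "van (E (rotp a)) \<longleftrightarrow> van (Ph (E a))" unfolding k(1) using k(2) by (simp add: van_scale_iff)
    also have "\<dots> \<longleftrightarrow> van (E a)" using van_Ph van_Phi'[of "Ph (E a)"] l by auto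
    finally show "van (E a) \<longleftrightarrow> van (E (rotp a))" by simp
  qed
  then show ?thesis using van_E_const by blast
qed

lemma Y_sum:
  assumes "i < n" "finite D" "\<And>mu. mu \<in> D \<Longrightarrow> length mu = n"
  shows "Y i (\<lambda>a. \<Sum>mu\<in>D. c mu * E mu a) = (\<lambda>a. \<Sum>mu\<in>D. c mu * ev mu i * E mu a)"
  using assms(2,3)
proof (induction D rule: finite_induct)
  case empty
  then show ?case using Y_scale[OF assms(1) lp_0, of 0] by simp
next
  case (insert mu D)
  have e: "Y i (E mu) = (\<lambda>a. ev mu i * E mu a)" using E_wt[of mu] insert.prems assms(1) by (simp add: wt_def)
  have "lp n (\<lambda>a. \<Sum>mu\<in>D. c mu * E mu a)" by (intro lp_sum lp_scale E_lp) (use insert.prems in simp)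
  then show ?case using insert assms(1) by (simp add: Y_add Y_scale lp_scale e mult.assoc)
qed

text \<open>Vanishing on the variety is stable under the Y_i, whose joint eigenvalues separate the
  summands.\<close>

lemma van_components:
  assumes D: "finite D" "\<And>mu. mu \<in> D \<Longrightarrow> length mu = n"
    and v: "van (\<lambda>a. \<Sum>mu\<in>D. c mu * E mu a)" and mu: "mu \<in> D"
  shows "van (\<lambda>a. c mu * E mu a)"
proof -
  have "(\<lambda>a. c mu * E mu a) \<in> Collect van"
  proof (rule eigen_split[where K = UNIV and N = "Collect van" and A = Y and Ix = "{..<n}"
        and w = "\<lambda>i mu. ev mu i" and B = "{mu. length mu = n}" and D = D])
    show "coeff_hom UNIV (\<lambda>x::'a. x)" by unfold_locales auto
    fix i and D :: "int list set" and c :: "int list \<Rightarrow> 'a" assume "i \<in> {..<n}" "finite D" "D \<subseteq> {mu. length mu = n}"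
    then show "Y i (\<lambda>a. \<Sum>j\<in>D. c j * E j a) = (\<lambda>a. \<Sum>j\<in>D. c j * ev j i * E j a)" by (intro Y_sum) auto
  next
    fix j l :: "int list" assume "j \<in> {mu. length mu = n}" "l \<in> {mu. length mu = n}" "j \<noteq> l"
    then show "\<exists>i\<in>{..<n}. ev j i \<noteq> ev l i" using ev_inj[of j l] by blast
  qed (use assms van_add van_scale van_Y in auto)
  then show ?thesis by simp
qed

text \<open>Coefficients are arbitrary here; the subrepresentation of V is obtained by intersecting
  with \<open>VK\<close>.\<close>

definition J where
  "J = {f. \<exists>D c. finite D \<and> D \<subseteq> {mu. length mu = n \<and> mu \<notin> alc n r} \<and> f = (\<lambda>a. \<Sum>mu\<in>D. c mu * E mu a)}"

lemma JI: "finite D \<Longrightarrow> D \<subseteq> {mu. length mu = n \<and> mu \<notin> alc n r} \<Longrightarrow> (\<lambda>a. \<Sum>mu\<in>D. c mu * E mu a) \<in> J"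
  unfolding J_def by blast

lemma J_lp: "f \<in> J \<Longrightarrow> lp n f"
proof -
  assume "f \<in> J"
  then obtain D c where D: "D \<subseteq> {mu. length mu = n \<and> mu \<notin> alc n r}" "f = (\<lambda>a. \<Sum>mu\<in>D. c mu * E mu a)"
    unfolding J_def by blast
  show ?thesis unfolding D(2) by (intro lp_sum lp_scale E_lp) (use D(1) in blast)
qed

lemma J_0: "(\<lambda>a. 0) \<in> J"
  using JI[of "{}"] by simp

lemma J_E: "length mu = n \<Longrightarrow> mu \<notin> alc n r \<Longrightarrow> E mu \<in> J"
  using JI[of "{mu}" "\<lambda>_. 1"] by simp

lemma J_add:
  assumes "f \<in> J" "g \<in> J" shows "(\<lambda>a. f a + g a) \<in> J"
proof -
  obtain D c where D: "finite D" "D \<subseteq> {mu. length mu = n \<and> mu \<notin> alc n r}" "f = (\<lambda>a. \<Sum>mu\<in>D. c mu * E mu a)"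
    using assms(1) unfolding J_def by blast
  obtain D' c' where D': "finite D'" "D' \<subseteq> {mu. length mu = n \<and> mu \<notin> alc n r}" "g = (\<lambda>a. \<Sum>mu\<in>D'. c' mu * E mu a)"
    using assms(2) unfolding J_def by blast
  let ?c = "\<lambda>mu. (if mu \<in> D then c mu else 0) + (if mu \<in> D' then c' mu else 0)"
  have "f a + g a = (\<Sum>mu\<in>D \<union> D'. ?c mu * E mu a)" for a
  proof -
    have "f a = (\<Sum>mu\<in>D \<union> D'. (if mu \<in> D then c mu else 0) * E mu a)"
      unfolding D(3) by (rule sum.mono_neutral_cong_left) (use D(1) D'(1) in auto)
    moreover have "g a = (\<Sum>mu\<in>D \<union> D'. (if mu \<in> D' then c' mu else 0) * E mu a)"
      unfolding D'(3) by (rule sum.mono_neutral_cong_left) (use D(1) D'(1) in auto)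
    ultimately show ?thesis by (simp only: sum.distrib distrib_right)
  qed
  then show ?thesis using JI[of "D \<union> D'" ?c] D(1,2) D'(1,2) by simp
qed

lemma J_scale: "f \<in> J \<Longrightarrow> (\<lambda>a. k * f a) \<in> J"
proof -
  assume "f \<in> J"
  then obtain D c where D: "finite D" "D \<subseteq> {mu. length mu = n \<and> mu \<notin> alc n r}" "f = (\<lambda>a. \<Sum>mu\<in>D. c mu * E mu a)"
    unfolding J_def by blast
  show ?thesis using JI[OF D(1,2), of "\<lambda>mu. k * c mu"] by (simp add: D(3) sum_distrib_left mult.assoc)
qed

lemma J_sum: "(\<And>b. b \<in> B \<Longrightarrow> G b \<in> J) \<Longrightarrow> (\<lambda>a. \<Sum>b\<in>B. G b a) \<in> J"
  by (induction B rule: infinite_finite_induct) (auto intro: J_0 J_add)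

lemma J_op:
  assumes add: "\<And>f g. lp n f \<Longrightarrow> lp n g \<Longrightarrow> A (\<lambda>a. f a + g a) = (\<lambda>a. A f a + A g a)"
    and sc: "\<And>c f. lp n f \<Longrightarrow> A (\<lambda>a. c * f a) = (\<lambda>a. c * A f a)"
    and E: "\<And>mu. length mu = n \<Longrightarrow> mu \<notin> alc n r \<Longrightarrow> A (E mu) \<in> J" and f: "f \<in> J"
  shows "A f \<in> J"
proof -
  obtain D c where D: "finite D" "D \<subseteq> {mu. length mu = n \<and> mu \<notin> alc n r}" "f = (\<lambda>a. \<Sum>mu\<in>D. c mu * E mu a)"
    using f unfolding J_def by blast
  have "A (\<lambda>a. \<Sum>mu\<in>D. c mu * E mu a) \<in> J" using D(1,2)
  proof (induction D rule: finite_induct)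
    case empty
    have "A (\<lambda>a. 0) = (\<lambda>a. 0)" using sc[OF lp_0, of 0] by simp
    then show ?case using J_0 by simp
  next
    case (insert mu D)
    have l: "lp n (E mu)" "lp n (\<lambda>a. \<Sum>mu\<in>D. c mu * E mu a)"
      by (intro lp_sum lp_scale E_lp; use insert.prems in blast)+
    have "A (\<lambda>a. c mu * E mu a + (\<Sum>mu\<in>D. c mu * E mu a)) \<in> J"
      unfolding add[OF lp_scale[OF l(1)] l(2)] sc[OF l(1)]
      using insert E by (intro J_add J_scale) auto
    then show ?case using insert.hyps by simp
  qed
  then show ?thesis by (simp add: D(3))
qed

text \<open>The critical case is mu outside and lam = s_i mu inside the index set. By
  \<open>alc_block\<close> the eigenvalues differ by a factor t, so the squared intertwiner kills
  E_mu. If the image k E_lam were nonzero, the reverse intertwiner would kill E_lam; but its value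
  on E_lam has the coefficient s at mu, an exponent above lam. Hence k = 0.\<close>

lemma J_T:
  assumes i: "Suc i < n" and f: "f \<in> J" shows "T i f \<in> J"
proof (rule J_op[OF _ _ _ f])
  fix mu assume l: "length mu = n" and mu: "mu \<notin> alc n r"
  define x y where "x = ev mu i" and "y = ev mu (Suc i)"
  have xy: "x \<noteq> y" unfolding x_def y_def using ev_ne[OF l] i by simp
  show "T i (E mu) \<in> J"
  proof -
    have red: "T i (E mu) \<in> J" if "(\<lambda>u. T i (E mu) u + cw x y * E mu u) \<in> J"
    proof -
      have "(\<lambda>u. (T i (E mu) u + cw x y * E mu u) + (- cw x y) * E mu u) \<in> J"
        by (intro J_add J_scale J_E that l mu)
      then show ?thesis by simp
    qed
    show ?thesis
    proof (cases "mu ! i = mu ! Suc i")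
      case True
      let ?g = "\<lambda>u. T i (E mu) u + cw x y * E mu u"
      let ?w = "\<lambda>j. if j = i then ev mu (Suc i) else if j = Suc i then ev mu i else ev mu j"
      have w: "wt ?g ?w" using wt_T[OF E_wt[OF l] i] xy unfolding x_def y_def by blast
      \<comment> \<open>An exponent with the interchanged eigenvalues would have the same entries as
        \<open>mu\<close>, these two entries being equal. It would then be \<open>mu\<close> itself,
        whose eigenvalues at i and i + 1 are distinct.\<close>
      have "?g = (\<lambda>u. 0)"
      proof (rule ccontr)
        assume "?g \<noteq> (\<lambda>u. 0)"
        then obtain nu where nu: "length nu = n" "\<And>j. j < n \<Longrightarrow> ?w j = ev nu j" using wt_spectrum[OF w] by metis
        have "nu ! j = mu ! j" if j: "j < n" for j
        proof -
          consider "j = i" | "j = Suc i" | "j \<noteq> i" "j \<noteq> Suc i" by blast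
          then show ?thesis
          proof cases
            case 1
            then have "ev nu i = ev mu (Suc i)" using nu(2)[of i] i by simp
            then show ?thesis using ev_eqD[OF nu(1) l, of i "Suc i"] i True 1 by simp
          next
            case 2
            then have "ev nu (Suc i) = ev mu i" using nu(2)[of "Suc i"] i by simp
            then show ?thesis using ev_eqD[OF nu(1) l, of "Suc i" i] i True 2 by simp
          next
            case 3
            then have "ev nu j = ev mu j" using nu(2)[OF j] by simp
            then show ?thesis using ev_eqD[OF nu(1) l j j] by simp
          qed
        qed
        then have "nu = mu" using l nu(1) by (intro nth_equalityI) auto
        then show False using nu(2)[of i] i xy by (simp add: x_def y_def)
      qed
      then show ?thesis using red J_0 by simp
    next
      case False
      obtain k where k: "(\<lambda>u. T i (E mu) u + cw x y * E mu u) = (\<lambda>u. k * E (lsw i mu) u)"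
        unfolding x_def y_def by (rule T_link[OF l i False])
      show ?thesis
      proof (cases "lsw i mu \<in> alc n r")
        case nin: False
        then show ?thesis using red k J_scale[OF J_E[of "lsw i mu"]] l by simp
      next
        case lam: True
        define lam where "lam = lsw i mu"
        have ll: "length lam = n" using l by (simp add: lam_def)
        have la: "lam \<in> alc n r" and bk: "lsw i lam = mu" using lam l i by (simp_all add: lam_def)
        have gt: "mu ! i > mu ! Suc i"
        proof (rule ccontr)
          assume "\<not> mu ! Suc i < mu ! i"
          then have "lam ! i > lam ! Suc i" using False i l by (auto simp: lam_def nth_lsw)
          then show False using alc_lsw[OF la r2 i] bk mu by simp
        qed
        have "ev lam i = s\<^sup>2 * ev lam (Suc i)" using alc_block[OF la i] bk mu by simp
        then have eq: "y = s\<^sup>2 * x"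
          using False i l by (simp add: lam_def ev_lsw tsw_def x_def y_def)
        have pm: "prec lam mu"
        proof -
          have "prec lam (lam[i := lam ! Suc i, Suc i := lam ! i])"
            using gt i l by (intro prec_swap) (auto simp: lam_def nth_lsw)
          then show ?thesis using bk by (simp add: lsw_def)
        qed
        have Elam: "E lam nu = 0" if "prec mu nu" for nu
        proof (rule ccontr)
          assume "E lam nu \<noteq> 0"
          then have "nu = lam \<or> prec nu lam" using E_supp[OF ll] by blast
          then have "prec mu mu" using that pm prec_trans by blast
          then show False by simp
        qed
        define d where "d = mu ! Suc i - mu ! i"
        \<comment> \<open>All exponents above \<open>mu\<close> are missing from E_lam, so only the
          ends of the segment count. Here d < 0, and the far end is \<open>lam\<close> with
          coefficient 1.\<close>
        have Tmu: "T i (E lam) mu = s"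
        proof -
          have "T i (E lam) mu = s * E lam (lmv i d mu) +
              (if d > 0 then (s - inverse s) * (E lam mu - E lam (lmv i d mu)) else 0)"
          proof (rule T_local[OF i E_lp[OF ll] l d_def])
            fix j assume j: "j < min 0 d \<or> j > max 0 d"
            have "prec mu (mu[i := mu ! Suc i - (d - j), Suc i := mu ! i + (d - j)])"
              using j i l by (intro prec_transfer) (auto simp: d_def)
            moreover have "mu[i := mu ! Suc i - (d - j), Suc i := mu ! i + (d - j)] = lmv i j mu"
              by (simp add: lmv_def d_def)
            ultimately show "E lam (lmv i j mu) = 0" using Elam by simp
          qed
          moreover have "lmv i d mu = lam" using lsw_eq_lmv[of i mu] i l by (simp add: lam_def d_def)
          ultimately show ?thesis using gt E_one[OF ll] by (simp add: d_def)
        qed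
        have "k = 0"
        proof (rule ccontr)
          assume k0: "k \<noteq> 0"
          have c0: "1 + cw x y * cw y x = 0" using one_plus_cw[OF xy] eq by simp
          have "(\<lambda>a. T i (\<lambda>u. k * E lam u) a + cw y x * (k * E lam a)) = (\<lambda>a. 0 * E mu a)"
            using intertwiner_square[OF E_lp[OF l] i xy] unfolding k[folded lam_def] c0
            using fun_cong[OF k[folded lam_def]] by simp
          then have "k * T i (E lam) mu + cw y x * (k * E lam mu) = 0"
            using T_scale[OF i E_lp[OF ll], of k] by (metis mult_zero_left)
          moreover have "E lam mu = 0"
          proof (rule ccontr)
            assume "E lam mu \<noteq> 0"
            then have "mu = lam \<or> prec mu lam" using E_supp[OF ll] by blast
            then have "prec mu mu" using pm prec_trans by blast
            then show False by simp
          qed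
          ultimately show False using Tmu k0 s0 by simp
        qed
        then show ?thesis using red k J_0 by simp
      qed
    qed
  qed
qed (use i in \<open>simp_all add: T_add T_scale\<close>)

lemma J_U:
  assumes "Suc i < n" "f \<in> J" shows "U i f \<in> J"
proof -
  have "(\<lambda>a. T i f a + (- (s - inverse s)) * f a) \<in> J" by (intro J_add J_scale J_T assms)
  then show ?thesis by (simp add: Tinv_def algebra_simps)
qed

lemma J_Y: "i < n \<Longrightarrow> f \<in> J \<Longrightarrow> Y i f \<in> J"
proof (rule J_op[where A = "Y i"])
  fix mu assume "i < n" "length mu = n" "mu \<notin> alc n r"
  then show "Y i (E mu) \<in> J" using E_wt[of mu] J_scale[OF J_E[of mu]] by (simp add: wt_def)
qed (auto simp: Y_add Y_scale)

lemma Yi_eqI: "i < n \<Longrightarrow> lp n g \<Longrightarrow> Y i g = f \<Longrightarrow> Yi i f = g"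
  by auto

lemma J_Yi: "i < n \<Longrightarrow> f \<in> J \<Longrightarrow> Yi i f \<in> J"
proof (rule J_op[where A = "Yi i"])
  fix f g :: "'a lpoly" assume "i < n" "lp n f" "lp n g"
  then show "Yi i (\<lambda>a. f a + g a) = (\<lambda>a. Yi i f a + Yi i g a)"
    by (intro Yi_eqI) (auto simp: Y_add lp_add)
next
  fix c and f :: "'a lpoly" assume "i < n" "lp n f"
  then show "Yi i (\<lambda>a. c * f a) = (\<lambda>a. c * Yi i f a)"
    by (intro Yi_eqI) (auto simp: Y_scale lp_scale)
next
  fix mu assume i: "i < n" and mu: "length mu = n" "mu \<notin> alc n r"
  have "Y i (E mu) = (\<lambda>a. ev mu i * E mu a)" using E_wt[of mu] mu i by (simp add: wt_def)
  then have "Y i (\<lambda>a. inverse (ev mu i) * E mu a) = E mu"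
    using i mu by (simp add: Y_scale mult.assoc[symmetric])
  then have "Yi i (E mu) = (\<lambda>a. inverse (ev mu i) * E mu a)"
    using i mu by (intro Yi_eqI) (simp_all add: lp_scale)
  then show "Yi i (E mu) \<in> J" using J_scale[OF J_E] mu by simp
qed auto

lemma J_Ph: "f \<in> J \<Longrightarrow> Ph f \<in> J"
proof (rule J_op[where A = Ph])
  fix mu assume mu: "length mu = n" "mu \<notin> alc n r"
  obtain k where k: "Ph (E mu) = (\<lambda>u. k * E (rotp mu) u)" by (rule Ph_link[OF mu(1)])
  show "Ph (E mu) \<in> J" unfolding k
    by (intro J_scale J_E) (use mu alc_rotp[OF mu(1)] length_rotp[OF mu(1) n0] in auto)
qed (auto simp: Ph_add Ph_scale)

lemma shift_add: "lp_shift n b (\<lambda>a. f a + g a) = (\<lambda>a. lp_shift n b f a + lp_shift n b g a)"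
  and shift_scale: "lp_shift n b (\<lambda>a. c * f a) = (\<lambda>a. c * lp_shift n b f a)" for f g :: "'a lpoly"
  by (auto simp: lp_shift_def fun_eq_iff)

lemma J_Phi': "f \<in> J \<Longrightarrow> Phi' f \<in> J"
proof (rule J_op[where A = Phi'])
  fix mu assume mu: "length mu = n" "mu \<notin> alc n r"
  obtain b where b: "length b = n" "rotp b = mu" by (rule rotp_surj[OF mu(1)])
  obtain k where k: "Ph (E b) = (\<lambda>u. k * E mu u)" "k \<noteq> 0" using Ph_link[OF b(1)] b(2) by metis
  have "Ph (\<lambda>u. inverse k * E b u) = E mu" unfolding Ph_scale k(1) using k(2) by (simp add: mult.assoc[symmetric])
  then have "Phi' (E mu) = (\<lambda>u. inverse k * E b u)"
    using Phi'_Ph[OF lp_scale[OF E_lp[OF b(1)]], of "inverse k"] by simp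
  then show "Phi' (E mu) \<in> J" using J_scale[OF J_E[OF b(1)]] alc_rotp[OF b(1)] b(2) mu(2) by simp
qed (simp_all add: Phi'_def shift_add shift_scale omi_add omi_scale)

lemma J_om: "f \<in> J \<Longrightarrow> om f \<in> J"
  using om_eq[OF J_lp] foldr_pres[where Q = "\<lambda>f. f \<in> J" and B = U and ks = "rev [0..<n - 1]"] J_U J_Y[OF n0] by auto

lemma J_omi: "f \<in> J \<Longrightarrow> omi f \<in> J"
  using omi_eq[OF J_lp] foldr_pres[where Q = "\<lambda>f. f \<in> J" and B = T and ks = "[0..<n - 1]"] J_T J_Yi[OF n0] by auto

abbreviation Xi where "Xi i \<equiv> lp_shift n (map uminus (unitv n i))"

text \<open>X_(n-1) is \<open>Ph\<close> composed with the inverse of \<open>om\<close>, and the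
  other variables follow downwards from X_i = U_i X_(i+1) U_i; similarly for their inverses.\<close>

lemma J_X:
  assumes "i < n" "f \<in> J" shows "X i f \<in> J" "Xi i f \<in> J"
proof -
  have "i \<le> n - 1" using assms by simp
  then have "\<forall>f\<in>J. X i f \<in> J \<and> Xi i f \<in> J"
  proof (induction i rule: inc_induct)
    case base
    show ?case
    proof (intro ballI conjI)
      fix f assume f: "f \<in> J"
      note l = J_lp[OF f]
      have "X (n - 1) f = Ph (omi f)" by (simp add: Ph_def)
      then show "X (n - 1) f \<in> J" using J_Ph[OF J_omi[OF f]] by simp
      have "Xi (n - 1) f = om (Phi' f)" by (simp add: Phi'_def)
      then show "Xi (n - 1) f \<in> J" using J_om[OF J_Phi'[OF f]] by simp
    qed
  next
    case (step i)
    have i: "Suc i < n" using step by simp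
    show ?case
    proof (intro ballI conjI)
      fix f assume f: "f \<in> J"
      note l = J_lp[OF f]
      have "X i f = U i (X (Suc i) (U i f))" using UX[OF i Tinv_lp[OF i l]] i l by simp
      then show "X i f \<in> J" using step.IH J_U[OF i] f by simp
      define g where "g = T i (Xi (Suc i) (T i f))"
      have g: "g \<in> J" unfolding g_def using step.IH J_T[OF i] f by simp
      have lT: "lp n (Xi (Suc i) (T i f))" using i l by simp
      have "X i g = U i (X (Suc i) (U i g))" using UX[OF i Tinv_lp[OF i J_lp[OF g]]] i J_lp[OF g] by simp
      also have "U i g = Xi (Suc i) (T i f)" unfolding g_def using UT[OF i lT] .
      also have "X (Suc i) (Xi (Suc i) (T i f)) = T i f" using i l by (intro shift_uminus) auto
      finally have "X i g = f" using i l by simp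
      then have "Xi i f = g" using shift_uminus(2)[of "unitv n i" g] J_lp[OF g] by simp
      then show "Xi i f \<in> J" using g by simp
    qed
  qed
  then show "X i f \<in> J" "Xi i f \<in> J" using assms(2) by auto
qed

lemma VK_ops:
  assumes "f \<in> VK"
  shows "i < n \<Longrightarrow> X i f \<in> VK" "i < n \<Longrightarrow> Xi i f \<in> VK" "i < n \<Longrightarrow> Y i f \<in> VK" "i < n \<Longrightarrow> Yi i f \<in> VK"
    "Suc i < n \<Longrightarrow> T i f \<in> VK"
  using assms KK.Yop_hom(1)[OF sK Kinv[OF sK] qK Kinv[OF qK] _ q0]
    KK.Yinv_hom[OF sK Kinv[OF sK] qK Kinv[OF qK] _ q0] KK.Top_hom(1)[OF sK Kinv[OF sK] qK Kinv[OF qK]]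
  unfolding VK_def by (auto simp: lp_shift_def KK.R0) (auto simp flip: lp_shift_def)

lemma Hinv_J: "Hinv (J \<inter> VK)"
  unfolding Hinv_def mult_X mult_Xinv
  using VK_ops J_add J_scale J_X J_Y J_Yi J_T
  by (auto simp: VK_def intro!: lp_add lp_scale KK.Radd KK.Rmult)

lemma expand:
  assumes "f \<in> VK"
  obtains D c where "finite D" "\<And>mu. mu \<in> D \<Longrightarrow> length mu = n" "\<And>mu. c mu \<in> K"
    "f = (\<lambda>a. \<Sum>mu\<in>D. c mu * E mu a)"
  using E_expansion[OF Khom E_K, of f] assms unfolding VK_def by blast

text \<open>The Y-components of an element of I vanish on the variety as well, which
  \<open>E_not_van\<close> forbids for exponents in \<open>alc\<close>.\<close>

lemma IK_J: "IK \<subseteq> J"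
proof
  fix f assume f: "f \<in> IK"
  then have fV: "f \<in> VK" by (simp add: IK_van)
  obtain D c where D: "finite D" "\<And>mu. mu \<in> D \<Longrightarrow> length mu = n" "f = (\<lambda>a. \<Sum>mu\<in>D. c mu * E mu a)"
    using expand[OF fV] by blast
  have "(\<lambda>a. c mu * E mu a) \<in> J" if mu: "mu \<in> D" for mu
  proof (cases "c mu = 0")
    case True then show ?thesis using J_0 by simp
  next
    case False
    have "van (\<lambda>a. c mu * E mu a)" using van_components[OF D(1,2) _ mu] f unfolding IK_van D(3) by blast
    then have "mu \<notin> alc n r" using E_not_van van_scale_iff[OF False] by blast
    then show ?thesis using J_scale J_E D(2)[OF mu] by blast
  qed
  then show "f \<in> J" unfolding D(3) by (rule J_sum)
qed

text \<open>The constant 1 is the polynomial of the zero vector, which lies in \<open>alc\<close>.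
  Membership in \<open>J\<close> would give a linear relation between the E's; the zero function
  vanishes on the variety, hence so would the component of the zero vector, against
  \<open>E_not_van\<close>.\<close>

lemma one_not_J: "one \<notin> J"
proof
  assume "one \<in> J"
  then obtain D c where D: "finite D" "D \<subseteq> {mu. length mu = n \<and> mu \<notin> alc n r}" "one = (\<lambda>a. \<Sum>mu\<in>D. c mu * E mu a)"
    unfolding J_def by blast
  have o: "replicate n 0 \<in> alc n r" using r2 by (simp add: alc_def)
  then have oD: "replicate n 0 \<notin> D" using D(2) by blast
  let ?c = "c(replicate n 0 := - 1)"
  have "(\<Sum>mu\<in>insert (replicate n 0) D. ?c mu * E mu a) = 0" for a
  proof -
    have "(\<Sum>mu\<in>D. ?c mu * E mu a) = (\<Sum>mu\<in>D. c mu * E mu a)"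
      by (intro sum.cong) (use oD in auto)
    also have "\<dots> = one a" using D(3) by metis
    finally show ?thesis using D(1) oD by (simp add: E_const)
  qed
  then have "van (\<lambda>a. \<Sum>mu\<in>insert (replicate n 0) D. ?c mu * E mu a)" by (simp add: van_def)
  then have "van (\<lambda>a. ?c (replicate n 0) * E (replicate n 0) a)"
    using D(1,2) by (intro van_components[of "insert (replicate n 0) D"]) auto
  then show False using van_scale_iff[of "- 1"] E_not_van[OF o] by simp
qed

lemma van_E_iff: "length mu = n \<Longrightarrow> van (E mu) \<longleftrightarrow> mu \<notin> alc n r"
proof
  assume l: "length mu = n" and mu: "mu \<notin> alc n r"
  have "IK \<subseteq> J \<inter> VK" using IK_J by (auto simp: IK_van)
  then have "J \<inter> VK = IK \<or> J \<inter> VK = VK" using irreducible Hinv_J by blast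
  moreover have "J \<inter> VK \<noteq> VK" using one_not_J one_VK by blast
  ultimately have "E mu \<in> IK" using J_E[OF l mu] E_VK[OF l] by blast
  then show "van (E mu)" by (simp add: IK_van)
qed (use E_not_van in blast)

theorem basis: "quot_basis K VK IK (alc n r) E"
  unfolding quot_basis_def
proof (intro conjI ballI allI impI)
  fix b assume "b \<in> alc n r"
  then show "E b \<in> VK" using E_VK alcD(1) by blast
next
  fix F c b
  assume F: "finite F" "F \<subseteq> alc n r" "(\<lambda>a. \<Sum>b\<in>F. c b * E b a) \<in> IK" and b: "b \<in> F"
  have "van (\<lambda>a. c b * E b a)"
    by (rule van_components[OF F(1) _ _ b]) (use F alcD(1) in \<open>auto simp: IK_van\<close>)
  then show "c b = 0" using van_scale_iff[of "c b" "E b"] E_not_van[of b] F(2) b by blast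
next
  fix f assume f: "f \<in> VK"
  obtain D c where D: "finite D" "\<And>mu. mu \<in> D \<Longrightarrow> length mu = n" "\<And>mu. c mu \<in> K"
    "f = (\<lambda>a. \<Sum>mu\<in>D. c mu * E mu a)"
    using expand[OF f] by blast
  let ?F = "D \<inter> alc n r" and ?G = "D - alc n r"
  have e: "(\<lambda>a. f a - (\<Sum>b\<in>?F. c b * E b a)) = (\<lambda>a. \<Sum>b\<in>?G. c b * E b a)"
  proof (rule ext)
    fix a
    have "f a = (\<Sum>b\<in>?F. c b * E b a) + (\<Sum>b\<in>?G. c b * E b a)"
      unfolding D(4) by (rule sum.Int_Diff[OF D(1)])
    then show "f a - (\<Sum>b\<in>?F. c b * E b a) = (\<Sum>b\<in>?G. c b * E b a)" by simp
  qed
  have "finite G \<Longrightarrow> G \<subseteq> ?G \<Longrightarrow> (\<lambda>a. \<Sum>b\<in>G. c b * E b a) \<in> IK" for G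
  proof (induction G rule: finite_induct)
    case empty
    then show ?case by (simp add: IK_def VK_def KK.R0)
  next
    case (insert b G)
    have l: "length b = n" using insert.prems D(2) by blast
    have "van (\<lambda>a. c b * E b a)" using van_scale van_E_iff[OF l] insert.prems by blast
    moreover have "(\<lambda>a. c b * E b a) \<in> VK"
      using D(3) E_VK[OF l] by (auto simp: VK_def lp_scale KK.Rmult)
    ultimately have 1: "(\<lambda>a. c b * E b a) \<in> IK" by (simp add: IK_van)
    have 2: "(\<lambda>a. \<Sum>b\<in>G. c b * E b a) \<in> IK" using insert by blast
    have "(\<lambda>a. c b * E b a + (\<Sum>b\<in>G. c b * E b a)) \<in> IK"
      using 1 2 van_add[of "\<lambda>a. c b * E b a" "\<lambda>a. \<Sum>b\<in>G. c b * E b a"]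
      by (auto simp: IK_van VK_def intro!: lp_add KK.Radd)
    then show ?case using insert.hyps by simp
  qed
  then have "(\<lambda>a. \<Sum>b\<in>?G. c b * E b a) \<in> IK" using D(1) by simp
  then show "\<exists>F c. finite F \<and> F \<subseteq> alc n r \<and> (\<forall>b\<in>F. c b \<in> K) \<and>
      (\<lambda>a. f a - (\<Sum>b\<in>F. c b * E b a)) \<in> IK"
    by (intro exI[of _ ?F] exI[of _ c]) (simp add: e D(1,3))
qed

lemma IK_ne_VK: "IK \<noteq> VK"
  using one_VK mono_not_van[of "replicate n 0"] by (auto simp: IK_van)

end

section \<open>Specialization\<close>

text \<open>Needed twice, for the polynomials in s and then for the polynomials in q over them, as
  \<open>spec_poly\<close> nests two substitutions.\<close>

lemma poly_map_hom:
  fixes f :: "'a::comm_ring_1 \<Rightarrow> 'b::comm_ring_1" and x :: 'b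
  assumes f: "f 0 = 0" "f 1 = 1" "\<And>x y. f (x + y) = f x + f y" "\<And>x y. f (x * y) = f x * f y"
  defines "g \<equiv> \<lambda>p. poly (map_poly f p) x"
  shows "g 0 = 0" "g 1 = 1" "g (p + p') = g p + g p'" "g (p * p') = g p * g p'" "g [:a:] = f a"
    and "g (pCons a p) = f a + x * g p"
proof -
  have pC: "g (pCons a p) = f a + x * g p" for a p
    by (simp add: g_def map_poly_pCons f(1))
  show g0: "g 0 = 0" by (simp add: g_def)
  show gc: "g [:a:] = f a" for a using pC[of a 0] g0 by simp
  show "g 1 = 1" using gc[of 1] f(2) by (simp add: one_pCons)
  have add: "g (p + p') = g p + g p'" for p p'
  proof (induction p arbitrary: p')
    case (pCons a p)
    show ?case by (cases p') (simp add: pC pCons.IH f(3), simp add: algebra_simps)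
  qed (simp add: g0)
  then show "g (p + p') = g p + g p'" .
  have sm: "g (smult c p) = f c * g p" for c p
    by (induction p) (simp_all add: g0 pC f(4) algebra_simps)
  show "g (p * p') = g p * g p'"
    by (induction p) (simp_all add: g0 pC add sm f(1) algebra_simps)
  show "g (pCons a p) = f a + x * g p" by (rule pC)
qed

section \<open>Substitution into polynomials and regular fractions\<close>

definition cst :: "complex \<Rightarrow> Kbig" where "cst z = Fract [:z:] 1"

lemma cst_hom: "cst 0 = 0" "cst 1 = 1" "cst (x + y) = cst x + cst y" "cst (x * y) = cst x * cst y"
  by (simp_all add: cst_def Zero_fract_def One_fract_def one_pCons mult.commute)

lemma cst_coeff_hom: "coeff_hom UNIV cst"
  by unfold_locales (auto simp: cst_hom)

definition spec1 :: "nat \<Rightarrow> nat \<Rightarrow> complex poly \<Rightarrow> Kbig" where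
  "spec1 k r c = poly (map_poly cst c) (sV k r)"

lemma spec1_hom: "spec1 k r 0 = 0" "spec1 k r 1 = 1"
  "spec1 k r (x + y) = spec1 k r x + spec1 k r y" "spec1 k r (x * y) = spec1 k r x * spec1 k r y"
  "spec1 k r [:0, 1:] = sV k r"
  unfolding spec1_def using poly_map_hom[where f = cst and x = "sV k r", OF cst_hom] by (simp_all add: cst_hom)

lemma spec_poly_eq: "spec_poly k r P = poly (map_poly (spec1 k r) P) (qV k r)"
  unfolding spec_poly_def spec1_def cst_def ..

lemma spec_poly_hom: "spec_poly k r 0 = 0" "spec_poly k r 1 = 1"
  "spec_poly k r (P + Q) = spec_poly k r P + spec_poly k r Q"
  "spec_poly k r (P * Q) = spec_poly k r P * spec_poly k r Q"
  "spec_poly k r [:c:] = spec1 k r c" "spec_poly k r (pCons c P) = spec1 k r c + qV k r * spec_poly k r P"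
  unfolding spec_poly_eq using poly_map_hom[where f = "spec1 k r" and x = "qV k r", OF spec1_hom(1-4)] by simp_all

text \<open>Two representations of one fraction agree after cross-multiplication, and substitution
  preserves that equation; the choice in \<open>spec\<close> is therefore immaterial.\<close>

lemma spec_Fract:
  assumes b: "spec_poly k r b \<noteq> 0"
  shows "spec k r (Fract a b) = spec_poly k r a / spec_poly k r b"
  unfolding spec_def
proof (rule some_equality)
  show "\<exists>a' b'. spec_poly k r b' \<noteq> 0 \<and> Fract a b = Fract a' b' \<and>
      spec_poly k r a / spec_poly k r b = spec_poly k r a' / spec_poly k r b'"
    using b by blast
  fix y assume "\<exists>a' b'. spec_poly k r b' \<noteq> 0 \<and> Fract a b = Fract a' b' \<and>
      y = spec_poly k r a' / spec_poly k r b'"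
  then obtain a' b' where b': "spec_poly k r b' \<noteq> 0" and e: "Fract a b = Fract a' b'"
    and y: "y = spec_poly k r a' / spec_poly k r b'" by blast
  have "b \<noteq> 0" "b' \<noteq> 0" using b b' spec_poly_hom(1) by metis+
  then have "a * b' = a' * b" using e by (simp add: eq_fract)
  then have "spec_poly k r a * spec_poly k r b' = spec_poly k r a' * spec_poly k r b"
    by (simp flip: spec_poly_hom(4))
  then show "y = spec_poly k r a / spec_poly k r b" using b b' by (simp add: y frac_eq_eq)
qed

lemma regularE:
  assumes "regular k r x"
  obtains a b where "spec_poly k r b \<noteq> 0" "b \<noteq> 0" "x = Fract a b" "spec k r x = spec_poly k r a / spec_poly k r b"
  using assms spec_Fract spec_poly_hom(1)[of k r] unfolding regular_def by metis

lemma regular_Fract: "spec_poly k r b \<noteq> 0 \<Longrightarrow> regular k r (Fract a b)"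
  unfolding regular_def by blast

lemma spec_coeff_hom: "coeff_hom {x. regular k r x} (spec k r)"
proof (unfold_locales; (unfold mem_Collect_eq)?)
  have one: "spec_poly k r 1 \<noteq> 0" by (simp add: spec_poly_hom)
  show "regular k r 0" unfolding Zero_fract_def by (rule regular_Fract[OF one])
  show "regular k r 1" unfolding One_fract_def by (rule regular_Fract[OF one])
  show "spec k r 1 = 1" using spec_Fract[OF one, of 1] by (simp add: spec_poly_hom(2) One_fract_def[where 'a = "complex poly poly", symmetric])
next
  fix x y assume "regular k r x" "regular k r y"
  then obtain a b c d where x: "spec_poly k r b \<noteq> 0" "b \<noteq> 0" "x = Fract a b" "spec k r x = spec_poly k r a / spec_poly k r b"
    and y: "spec_poly k r d \<noteq> 0" "d \<noteq> 0" "y = Fract c d" "spec k r y = spec_poly k r c / spec_poly k r d"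
    by (metis regularE)
  have bd: "spec_poly k r (b * d) \<noteq> 0" using x y by (simp add: spec_poly_hom(4))
  show "regular k r (x + y)" "regular k r (x * y)"
    unfolding x(3) y(3) using x(2) y(2) bd by (simp_all add: regular_Fract)
  show "spec k r (x + y) = spec k r x + spec k r y"
    unfolding x(4) y(4) unfolding x(3) y(3) using x(1,2) y(1,2) bd
    by (simp add: spec_Fract spec_poly_hom add_frac_eq)
  show "spec k r (x * y) = spec k r x * spec k r y"
    unfolding x(4) y(4) unfolding x(3) y(3) using x(1,2) y(1,2) bd
    by (simp add: spec_Fract spec_poly_hom)
next
  fix x assume "regular k r x"
  then obtain a b where x: "spec_poly k r b \<noteq> 0" "x = Fract a b" by (metis regularE)
  then show "regular k r (- x)" by (simp add: regular_Fract)
qed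

text \<open>The regular elements form a local ring: a fraction may be inverted there once its
  numerator has a nonzero specialization.\<close>

lemma regular_inverse: "regular k r x \<Longrightarrow> spec k r x \<noteq> 0 \<Longrightarrow> regular k r (inverse x)"
  by (metis regularE regular_Fract inverse_fract div_0)

lemma spec_poly_q: "spec_poly k r [:0, 1:] = qV k r"
  by (simp add: spec_poly_hom spec1_hom flip: one_pCons)

lemma spec_s_t: "regular k r s_t" "spec k r s_t = sV k r"
  unfolding s_t_def using spec_poly_hom(2)[of k r] 
  by (simp_all add: regular_Fract spec_Fract spec_poly_hom spec1_hom)

lemma spec_q_t: "regular k r q_t" "spec k r q_t = qV k r"
  unfolding q_t_def using spec_poly_hom(2)[of k r] spec_poly_q
  by (simp_all add: regular_Fract spec_Fract)

section \<open>Powers of v and the root of unity\<close>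

lemma vv_power: "vv ^ k = Fract (monom 1 k) 1"
  by (induction k) (simp_all add: vv_def One_fract_def monom_Suc one_pCons monom_0)

lemma vv_nonzero: "vv \<noteq> 0"
  by (simp add: vv_def Zero_fract_def eq_fract)

lemma cst_vv: "cst z * vv powi e = 1 \<Longrightarrow> e = 0 \<and> z = 1"
proof -
  assume h: "cst z * vv powi e = 1"
  show ?thesis
  proof (cases "e \<ge> 0")
    case True
    then have "cst z * vv ^ nat e = 1" using h by (simp add: power_int_nonneg_exp)
    then have m: "monom z (nat e) = 1"
      by (simp add: vv_power cst_def One_fract_def eq_fract smult_monom)
    then have "coeff (monom z (nat e)) 0 = 1" by simp
    then show ?thesis using True by (auto split: if_splits)
  next
    case False
    have "cst z * vv powi e * vv ^ nat (- e) = vv ^ nat (- e)" using h by simp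
    moreover have "vv powi e * vv ^ nat (- e) = 1"
      using False vv_nonzero by (simp add: power_int_def flip: power_mult_distrib)
    ultimately have "cst z = vv ^ nat (- e)" by (simp add: mult.assoc)
    then have "[:z:] = monom 1 (nat (- e))" by (simp add: vv_power cst_def eq_fract)
    then have "coeff [:z:] (nat (- e)) = 1" by simp
    then show ?thesis using False by (auto simp: coeff_pCons split: nat.splits)
  qed
qed

text \<open>Primitivity of the root of unity; it forces r - 1 to divide m in
  \<open>spec_star\<close>.\<close>

lemma tau_powi: "r \<ge> 2 \<Longrightarrow> tau r powi m = 1 \<longleftrightarrow> (int r - 1) dvd m"
proof -
  assume r: "r \<ge> 2"
  have "tau r powi m = cis (of_int m * (2 * pi / real (r - 1)))" by (simp add: tau_def cis_power_int)
  moreover have "cis y = 1 \<longleftrightarrow> (\<exists>c::int. y = of_int c * 2 * pi)" for y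
  proof -
    have "sin y = 0" if "cos y = 1" using sin_cos_squared_add[of y] that by simp
    then have "cis y = 1 \<longleftrightarrow> cos y = 1" by (auto simp: complex_eq_iff)
    then show ?thesis unfolding cos_one_2pi_int .
  qed
  moreover have "of_int m * (2 * pi / real (r - 1)) = of_int c * 2 * pi \<longleftrightarrow> m = c * (int r - 1)" for c
  proof -
    have "of_int m * (2 * pi / real (r - 1)) = of_int c * 2 * pi \<longleftrightarrow> (of_int m :: real) = of_int c * real (r - 1)"
    proof -
      have "x * (2 * pi / R) = y * 2 * pi \<longleftrightarrow> x = y * R" if "R > 0" for x y R :: real
        using that by (simp add: field_simps)
      then show ?thesis using r by simp
    qed
    also have "\<dots> \<longleftrightarrow> m = c * (int r - 1)"
    proof -
      have "of_int c * real (r - 1) = (of_int (c * (int r - 1)) :: real)" using r by simp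
      then show ?thesis by (simp only: of_int_eq_iff)
    qed
    finally show ?thesis .
  qed
  ultimately show ?thesis by (auto simp: dvd_def mult.commute)
qed

text \<open>\<open>Espec\<close> is identified with the polynomials at the special parameters only
  for exponents of length n, so the replacement is confined to the index set.\<close>

lemma quot_basis_cong:
  assumes b: "quot_basis K V I B e" and e: "\<And>b. b \<in> B \<Longrightarrow> e' b = e b"
  shows "quot_basis K V I B e'"
proof -
  have sums: "(\<Sum>b\<in>F. c b * e' b a) = (\<Sum>b\<in>F. c b * e b a)" if F: "F \<subseteq> B" for F c a
  proof (rule sum.cong)
    fix x assume "x \<in> F"
    then have "e' x = e x" using F by (intro e) blast
    then show "c x * e' x a = c x * e x a" by (simp only:)
  qed (rule refl)
  show ?thesis unfolding quot_basis_def
  proof (intro conjI ballI allI impI)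
    fix b' assume b': "b' \<in> B"
    have "e b' \<in> V" using b[unfolded quot_basis_def, THEN conjunct1] b' by (rule bspec)
    moreover have "e' b' = e b'" using b' by (rule e)
    ultimately show "e' b' \<in> V" by (simp only:)
  next
    fix F c b' assume F: "finite F" "F \<subseteq> B" "\<forall>b\<in>F. c b \<in> K"
      "(\<lambda>a. \<Sum>b\<in>F. c b * e' b a) \<in> I" "b' \<in> F"
    have "(\<lambda>a. \<Sum>b\<in>F. c b * e b a) \<in> I" using F(4) unfolding sums[OF F(2)] .
    with F(1-3) have "\<forall>b\<in>F. c b = 0"
      by (intro b[unfolded quot_basis_def, THEN conjunct2, THEN conjunct1, THEN spec, THEN spec,
        THEN mp, THEN mp, THEN mp, THEN mp])
    then show "c b' = 0" using F(5) by (rule bspec)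
  next
    fix f assume "f \<in> V"
    with b[unfolded quot_basis_def, THEN conjunct2, THEN conjunct2]
    have "\<exists>F c. finite F \<and> F \<subseteq> B \<and> (\<forall>b\<in>F. c b \<in> K) \<and> (\<lambda>a. f a - (\<Sum>b\<in>F. c b * e b a)) \<in> I"
      by (rule bspec)
    then obtain F c where F: "finite F" "F \<subseteq> B" "\<forall>b\<in>F. c b \<in> K"
      "(\<lambda>a. f a - (\<Sum>b\<in>F. c b * e b a)) \<in> I"
      by (elim exE conjE)
    have "(\<lambda>a. f a - (\<Sum>b\<in>F. c b * e' b a)) \<in> I" using F(4) unfolding sums[OF F(2)] .
    with F(1-3) show "\<exists>F c. finite F \<and> F \<subseteq> B \<and> (\<forall>b\<in>F. c b \<in> K) \<and> (\<lambda>a. f a - (\<Sum>b\<in>F. c b * e' b a)) \<in> I"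
      by (intro exI conjI)
  qed
qed

section \<open>The generic and the special parameters\<close>

context
  fixes n r k :: nat
  assumes n2: "n \<ge> 2" and r2: "r \<ge> 2" and nk: "n = k + 1"
begin

lemma nk_eq: "n - 1 = k"
  by (simp add: nk)

private abbreviation sv where "sv \<equiv> sV k r"
private abbreviation qv where "qv \<equiv> qV k r"

text \<open>The exponents of the specialization: t = v^(2 dA) and q = tau v^(-2 dB), with v a square
  root of u.\<close>

definition dA where "dA = (r - 1) div gcd n (r - 1)"
definition dB where "dB = n div gcd n (r - 1)"

lemma dAB: "dA * gcd n (r - 1) = r - 1" "dB * gcd n (r - 1) = n" "dA > 0"
proof -
  show "dA * gcd n (r - 1) = r - 1" "dB * gcd n (r - 1) = n" by (simp_all add: dA_def dB_def)
  then show "dA > 0" using r2 by (cases dA) auto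
qed

lemma sv_eq: "sv = vv ^ dA" and qv_eq: "qv = cst (tau r) * inverse (vv ^ (2 * dB))"
  unfolding sV_def qV_def gg_def dA_def dB_def cst_def nk[symmetric] by (rule refl)+

lemma sq_vv: "sv powi (2 * h) * qv powi m = cst (tau r powi m) * vv powi (2 * int dA * h - 2 * int dB * m)"
proof -
  have "cst (tau r powi m) = cst (tau r) powi m"
    using coeff_hom.hpowi[OF cst_coeff_hom] by simp
  moreover have "sv powi (2 * h) = vv powi (2 * int dA * h)"
    by (simp add: sv_eq power_int_power mult_ac)
  moreover have "qv powi m = cst (tau r) powi m * vv powi (- (2 * int dB * m))"
    by (simp add: qv_eq power_int_mult_distrib power_int_inverse power_int_power power_int_minus)
  moreover have "vv powi (2 * int dA * h - 2 * int dB * m) = vv powi (2 * int dA * h) * vv powi (- (2 * int dB * m))"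
    using vv_nonzero by (simp add: power_int_diff power_int_minus divide_inverse)
  ultimately show ?thesis by (simp add: mult_ac)
qed

text \<open>Comparing powers of v gives dA h = dB m, and the power of tau gives m = (r - 1) c. As r
  - 1 = dA g and k + 1 = dB g for the common divisor g, this means h = (k + 1) c. With k + 1 = n the
  bound |h| < n leaves only c = 0.\<close>

lemma spec_star:
  assumes h: "\<bar>h\<bar> < int n" and e: "sv powi (2 * h) * qv powi m = 1"
  shows "h = 0 \<and> m = 0"
proof -
  have v: "2 * int dA * h - 2 * int dB * m = 0" "tau r powi m = 1"
    using cst_vv e unfolding sq_vv by blast+
  then obtain c where m: "m = (int r - 1) * c" using tau_powi[OF r2] by (auto simp: dvd_def)
  have r1: "int r - 1 = int dA * int (gcd n (r - 1))" using dAB(1) r2 by (metis of_nat_mult of_nat_diff of_nat_1 order_trans one_le_numeral)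
  have "int dA * h = int dA * (int dB * int (gcd n (r - 1)) * c)"
    using v(1) by (simp add: m r1 mult_ac)
  then have "h = int dB * int (gcd n (r - 1)) * c" using dAB(3) by simp
  also have "int dB * int (gcd n (r - 1)) = int n" using dAB(2) by (metis of_nat_mult)
  finally have hc: "h = int n * c" .
  have "c = 0"
  proof (rule ccontr)
    assume "c \<noteq> 0"
    then have "\<bar>c\<bar> \<ge> 1" by simp
    then have "int n * 1 \<le> int n * \<bar>c\<bar>" by (intro mult_left_mono) auto
    then show False using h hc by (simp add: abs_mult)
  qed
  then show ?thesis using hc m by simp
qed

lemma spec_wrap: "sv powi (2 * int n) * qv powi (int r - 1) = 1"
proof -
  have r1: "int r - 1 = int dA * int (gcd n (r - 1))" using dAB(1) r2 by (metis of_nat_mult of_nat_diff of_nat_1 order_trans one_le_numeral)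
  have n1: "int n = int dB * int (gcd n (r - 1))" using dAB(2) by (metis of_nat_mult)
  have z: "2 * int dA * int n - 2 * int dB * (int r - 1) = 0" unfolding r1 by (subst n1) simp
  have t: "tau r powi (int r - 1) = 1" using tau_powi[OF r2] by simp
  show ?thesis unfolding sq_vv z t by (simp add: cst_hom)
qed

lemma sv_nonzero: "sv \<noteq> 0" and qv_nonzero: "qv \<noteq> 0"
proof -
  show "sv \<noteq> 0" using vv_nonzero by (simp add: sv_eq)
  have "tau r \<noteq> 0" by (simp add: tau_def)
  then have "cst (tau r) \<noteq> 0" by (simp add: cst_def Zero_fract_def eq_fract)
  then show "qv \<noteq> 0" using vv_nonzero by (simp add: qv_eq)
qed

private abbreviation RR where "RR \<equiv> {x. regular k r x}"
private abbreviation sp where "sp \<equiv> spec k r"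

lemma RR_gen: "s_t \<in> RR" "inverse s_t \<in> RR" "q_t \<in> RR" "inverse q_t \<in> RR"
  using spec_s_t spec_q_t sv_nonzero qv_nonzero by (auto intro: regular_inverse)

lemma sp_monomial: "sp (s_t powi h * q_t powi m) = sv powi h * qv powi m"
  and RR_monomial: "s_t powi h * q_t powi m \<in> RR"
proof -
  interpret coeff_hom RR sp by (rule spec_coeff_hom)
  show "s_t powi h * q_t powi m \<in> RR" by (intro Rmult Rpowi RR_gen)
  show "sp (s_t powi h * q_t powi m) = sv powi h * qv powi m"
    using RR_gen by (simp only: hmult[OF Rpowi Rpowi] hpowi spec_s_t spec_q_t)
qed

text \<open>A relation between the generic parameters would survive specialization.\<close>

lemma generic_star:
  assumes "\<bar>h\<bar> < int n" "s_t powi (2 * h) * q_t powi m = 1"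
  shows "h = 0 \<and> m = 0"
proof -
  have "sv powi (2 * h) * qv powi m = 1"
    using sp_monomial[of "2 * h" m] assms(2) coeff_hom.h1[OF spec_coeff_hom] by simp
  then show ?thesis using spec_star assms(1) by blast
qed

lemma generic: "daha_simple n s_t q_t"
proof
  show "n \<ge> 2" by (rule n2)
  show "s_t \<noteq> 0" "q_t \<noteq> 0"
    using spec_s_t(2)[of k r] spec_q_t(2)[of k r] sv_nonzero qv_nonzero
      coeff_hom.h0[OF spec_coeff_hom, of k r] by metis+
  show "q_t ^ m \<noteq> 1" if "m > 0" for m
    using generic_star[of 0 "int m"] that n2 by auto
  show "h = 0 \<and> m = 0" if "\<bar>h\<bar> < int n" "s_t powi (2 * h) * q_t powi m = 1" for h m
    using generic_star that by blast
qed

lemma special: "daha_field n sv qv r (Kset k r)"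
proof (intro daha_field.intro daha_spec.intro daha_simple.intro daha.intro
    daha_field_axioms.intro daha_spec_axioms.intro daha_simple_axioms.intro)
  interpret coeff_hom RR sp by (rule spec_coeff_hom)
  show "n \<ge> 2" "r \<ge> 2" by (rule n2 r2)+
  show "sv \<noteq> 0" "qv \<noteq> 0" by (rule sv_nonzero qv_nonzero)+
  show "qv ^ m \<noteq> 1" if "m > 0" for m
    using spec_star[of 0 "int m"] that n2 by auto
  show "h = 0 \<and> m = 0" if "\<bar>h\<bar> < int n" "sv powi (2 * h) * qv powi m = 1" for h m
    using spec_star that by blast
  show "sv powi (2 * int n) * qv powi (int r - 1) = 1" by (rule spec_wrap)
  show "coeff_hom (Kset k r) (\<lambda>x. x)"
  proof unfold_locales
    show "0 \<in> Kset k r" "1 \<in> Kset k r" unfolding Kset_def using R0 R1 h0 h1 by (metis image_eqI)+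
    fix x y assume "x \<in> Kset k r" "y \<in> Kset k r"
    then obtain a b where "a \<in> RR" "b \<in> RR" "x = sp a" "y = sp b" by (auto simp: Kset_def)
    then show "x + y \<in> Kset k r" "x * y \<in> Kset k r" "- x \<in> Kset k r"
      unfolding Kset_def using Radd Rmult Rminus hadd hmult hminus by (metis image_eqI)+
  qed auto
  show "inverse x \<in> Kset k r" if x: "x \<in> Kset k r" for x
  proof (cases "x = 0")
    case False
    obtain a where a: "a \<in> RR" "x = sp a" using x by (auto simp: Kset_def)
    then have "inverse a \<in> RR" using regular_inverse False by simp
    then show ?thesis unfolding Kset_def using a hinverse[of a] by (metis image_eqI)
  qed (use x in simp)
  show "sv \<in> Kset k r" "qv \<in> Kset k r" unfolding Kset_def using RR_gen spec_s_t(2) spec_q_t(2) by (metis image_eqI)+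
qed

interpretation G: daha_simple n s_t q_t by (rule generic)
interpretation V: daha_field n sv qv r "Kset k r" by (rule special)

text \<open>The denominators in the construction specialize to differences of special eigenvalues,
  nonzero by simplicity of the special spectrum, so the generic polynomial is built from regular
  coefficients. Its specialization satisfies the conditions that determine the polynomial at the
  special parameters.\<close>

lemma E_spec:
  assumes l: "length lam = n"
  shows "regular k r (Emac n s_t q_t lam a)" "Espec n k r lam = Emac n sv qv lam"
proof -
  interpret R: coeff_hom RR sp by (rule spec_coeff_hom)
  have Rid: "coeff_hom RR (\<lambda>x. x)" by unfold_locales (rule R.R0 R.R1 R.Radd R.Rmult R.Rminus refl; assumption?)+
  have evR: "G.ev mu i \<in> RR" "sp (G.ev mu i) = V.ev mu i" for mu i
    unfolding G.ev_def V.ev_def by (rule RR_monomial sp_monomial)+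
  have "\<exists>f. G.wt f (G.ev lam) \<and> f lam = 1 \<and> (\<forall>mu. f mu \<noteq> 0 \<longrightarrow> mu = lam \<or> prec mu lam) \<and> (\<forall>a. f a \<in> RR)"
  proof (rule G.E_exists[OF l Rid RR_gen])
    fix mu assume p: "prec mu lam"
    then have "lam \<noteq> mu" "length mu = n" using l prec_length by auto
    then obtain i where i: "i < n" "V.ev lam i \<noteq> V.ev mu i" using V.ev_inj l by blast
    have "sp (G.ev lam i - G.ev mu i) \<noteq> 0" using i(2) by (simp add: R.hdiff evR[unfolded mem_Collect_eq] evR)
    moreover have "G.ev lam i - G.ev mu i \<in> RR" by (intro R.Rdiff evR)
    ultimately have "inverse (G.ev lam i - G.ev mu i) \<in> RR" using regular_inverse by simp
    moreover have "G.ev lam i \<noteq> G.ev mu i" using i(2) evR(2) by metis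
    ultimately show "\<exists>i<n. G.ev lam i \<noteq> G.ev mu i \<and> inverse (G.ev lam i - G.ev mu i) \<in> RR" using i(1) by blast
  qed
  then obtain f where f: "G.wt f (G.ev lam)" "f lam = 1" "\<forall>mu. f mu \<noteq> 0 \<longrightarrow> mu = lam \<or> prec mu lam" "\<And>a. f a \<in> RR"
    by blast
  have E: "Emac n s_t q_t lam = f" by (rule G.E_eqI[OF l f(1-3)])
  show "regular k r (Emac n s_t q_t lam a)" unfolding E using f(4) by simp
  let ?h = "\<lambda>a. sp (f a)"
  have fl: "lp n f" using f(1) by (rule G.wt_lp)
  have "V.wt ?h (V.ev lam)" unfolding V.wt_def
  proof (intro conjI allI impI)
    show "lp n ?h" by (rule R.lp_hom[OF fl])
    fix i assume i: "i < n"
    show "Yop n sv qv i ?h = (\<lambda>a. V.ev lam i * ?h a)"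
    proof (rule ext)
      fix a
      have "Yop n sv qv i ?h a = sp (Yop n s_t q_t i f a)"
        using R.Yop_hom(2)[OF RR_gen i G.q0 fl f(4)] by (simp only: spec_s_t spec_q_t)
      also have "Yop n s_t q_t i f a = G.ev lam i * f a" using f(1) i by (simp add: G.wt_def)
      also have "sp (G.ev lam i * f a) = V.ev lam i * ?h a" by (simp only: R.hmult[OF evR(1) f(4)] evR(2))
      finally show "Yop n sv qv i ?h a = V.ev lam i * ?h a" .
    qed
  qed
  moreover have "\<forall>mu. ?h mu \<noteq> 0 \<longrightarrow> mu = lam \<or> prec mu lam" using f(3) R.h0 by metis
  ultimately have "Emac n sv qv lam = ?h" using f(2) R.h1 by (intro V.E_eqI[OF l]) auto
  then show "Espec n k r lam = Emac n sv qv lam" by (simp add: Espec_def E)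
qed

lemma Vset_eq: "Vset n k r = V.VK"
  by (simp add: Vset_def V.VK_def)

lemma Zset_eq: "Zset n k r = V.Zg"
  unfolding Zset_def V.Zg_def V.chain_idx_def nk_eq by (simp add: nk)

lemma Iset_eq: "Iset n k r = V.IK"
  unfolding Iset_def V.IK_def Vset_eq Zset_eq ..

lemma H_invariant_eq: "H_invariant n k r W = V.Hinv W"
  unfolding H_invariant_def V.Hinv_def Vset_eq ..

lemma basis_and_irreducible:
  "(\<forall>lam\<in>Sset n k r. \<forall>a. regular k r (Emac n s_t q_t lam a))
    \<and> quot_basis (Kset k r) (Vset n k r) (Iset n k r)
        (Sset n k r) (Espec n k r)
    \<and> quot_irreducible n k r"
proof (intro conjI)
  note S = Sset_eq_alc[OF n2, of r, unfolded nk_eq]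
  show "\<forall>lam\<in>Sset n k r. \<forall>a. regular k r (Emac n s_t q_t lam a)"
    using E_spec(1) alcD(1) unfolding S by blast
  have e: "Espec n k r b = Emac n sv qv b" if "b \<in> alc n r" for b
    using E_spec(2) alcD(1)[OF that] by blast
  show "quot_basis (Kset k r) (Vset n k r) (Iset n k r) (Sset n k r) (Espec n k r)"
    unfolding S Vset_eq Iset_eq using V.basis by (rule quot_basis_cong) (simp add: e)
  show "quot_irreducible n k r"
    unfolding quot_irreducible_def Iset_eq Vset_eq H_invariant_eq using V.IK_ne_VK V.irreducible by blast
qed

end

theorem theorem6p2:
  fixes n r :: nat
  assumes "n \<ge> 2" and "r \<ge> 2"
  shows "(\<forall>lam\<in>Sset n (n - 1) r. \<forall>a. regular (n - 1) r (Emac n s_t q_t lam a))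
    \<and> quot_basis (Kset (n - 1) r) (Vset n (n - 1) r) (Iset n (n - 1) r)
        (Sset n (n - 1) r) (Espec n (n - 1) r)
    \<and> quot_irreducible n (n - 1) r"
proof -
  have "n = (n - 1) + 1" using assms by simp
  from basis_and_irreducible[OF assms this] show ?thesis .
qed

end
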